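(* Let $K\ge 1$ be an integer and $B>1$, and let $(X_n)_{n\ge0}$ be the nearest neighbour walk on $\{0,1,2,\dots\}$ with $p_R=\frac14\Lambda(K,R,B)$ (in the sense described in the context). Then, almost surely, $$\limsup_{R\to\infty}\frac{\xi(R,\infty)}{2D(R,\infty)\log\log R}\le 1$$ and $$\limsup_{R\to\infty}\frac{\xi(R,\infty)}{2D(R,\infty)\log_{K+1}R}\ge 1 .$$ In particular, when $K=1$, i.e. $p_R=\frac{B}{4R}$ with $B>1$, in which case $D(R,\infty)=(1+o(1))\frac{R}{B-1}$ as $R\to\infty$, one has almost surely $$\limsup_{R\to\infty}\frac{(B-1)\,\xi(R,\infty)}{2R\log\log R}=\limsup_{R\to\infty}\frac{(B-1)\,\xi(R,\infty,\uparrow)}{R\log\log R}=1 .$$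
   Context: Walk: for $0\le p_i<1/2$, $i\ge1$, $(X_n)_{n\ge0}$ is the Markov chain on $\{0,1,2,\dots\}$ with $X_0=0$ and $\mathbf P(X_{n+1}=i+1\mid X_n=i)=1-\mathbf P(X_{n+1}=i-1\mid X_n=i)=E_i$, where $E_0=1$ and $E_i=1/2+p_i$ for $i\ge1$. Local time and upcrossings: $\xi(x,\infty)=\#\{k\ge0: X_k=x\}$ and $\xi(x,\infty,\uparrow)=\#\{k\ge 0: X_k=x,\ X_{k+1}=x+1\}$. $D$: with $U_i=\frac{1/2-p_i}{1/2+p_i}$, $D(m,\infty)=1+\sum_{j=1}^{\infty}\prod_{i=1}^{j}U_{m+i}$. Iterated logarithms: $\log_0 i=i$, $\log_1 i=\log i$, $\log_k i=\log\log_{k-1}i$. Put $\lambda(0,i)=1$, $\lambda(1,i)=i$, $\lambda(k,i)=\lambda(k-1,i)\log_{k-1}i$ for $k\ge2$; $\Lambda(0,i)=0$, $\Lambda(K,i)=\sum_{k=1}^{K}\frac1{\lambda(k,i)}$, and $\Lambda(K,i,B)=\Lambda(K-1,i)+\frac{B}{\lambda(K,i)}$ for $B>0$. (So $\Lambda(1,i,B)=B/i$.) Convention: "$p_i=\frac14\Lambda(K,i,B)$" means the following. Let $i_0$ be the smallest positive integer $i$ such that $\log_{K-1}i$ is defined and positive and $\frac14\Lambda(K,i,B)<\frac12$; then $p_i=\frac14\Lambda(K,i,B)$ for $i\ge i_0$ and $p_i=p_{i_0}$ for $1\le i\le i_0$. *)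

theory Defs
  imports "HOL-Probability.Probability"
begin

subsection \<open>Nearest neighbour walks\<close>

definition up_prob :: "(nat \<Rightarrow> real) \<Rightarrow> nat \<Rightarrow> real" where
  "up_prob p i = (if i = 0 then 1 else 1/2 + p i)"

(* The walk is a Markov chain on an arbitrary probability space; conditional
   probabilities are only prescribed given events of positive probability. *)
locale nearest_neighbour_walk = prob_space M
  for M :: "'a measure" and X :: "nat \<Rightarrow> 'a \<Rightarrow> nat" and p :: "nat \<Rightarrow> real" +
  assumes random_variable_walk: "\<And>n. random_variable (count_space UNIV) (X n)"
    and start: "AE \<omega> in M. X 0 \<omega> = 0"
    and markov: "\<And>n x y. \<P>(\<omega> in M. \<forall>k\<le>n. X k \<omega> = x k) > 0 \<Longrightarrow>
      \<P>(\<omega> in M. X (Suc n) \<omega> = y \<bar> \<forall>k\<le>n. X k \<omega> = x k)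
        = \<P>(\<omega> in M. X (Suc n) \<omega> = y \<bar> X n \<omega> = x n)"
    and step_up: "\<And>n i. \<P>(\<omega> in M. X n \<omega> = i) > 0 \<Longrightarrow>
      \<P>(\<omega> in M. X (Suc n) \<omega> = i + 1 \<bar> X n \<omega> = i) = up_prob p i"
    and step_down: "\<And>n i. i \<ge> 1 \<Longrightarrow> \<P>(\<omega> in M. X n \<omega> = i) > 0 \<Longrightarrow>
      \<P>(\<omega> in M. X (Suc n) \<omega> = i - 1 \<bar> X n \<omega> = i) = 1 - up_prob p i"

text \<open>Local time and number of upcrossings of a path; both may be infinite.\<close>

definition local_time :: "(nat \<Rightarrow> nat) \<Rightarrow> nat \<Rightarrow> ereal" where
  "local_time w x = enn2ereal (emeasure (count_space UNIV) {k. w k = x})"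

definition upcrossings :: "(nat \<Rightarrow> nat) \<Rightarrow> nat \<Rightarrow> ereal" where
  "upcrossings w x = enn2ereal (emeasure (count_space UNIV) {k. w k = x \<and> w (Suc k) = x + 1})"

definition U_ratio :: "(nat \<Rightarrow> real) \<Rightarrow> nat \<Rightarrow> real" where
  "U_ratio p i = (1/2 - p i) / (1/2 + p i)"

(* Extended-real valued, so that a divergent series has the value infinity. *)
definition D_inf :: "(nat \<Rightarrow> real) \<Rightarrow> nat \<Rightarrow> ereal" where
  "D_inf p m = 1 + (\<Sum>j. ereal (\<Prod>i=1..Suc j. U_ratio p (m + i)))"

subsection \<open>Iterated logarithms\<close>

primrec iter_log :: "nat \<Rightarrow> real \<Rightarrow> real" where
  "iter_log 0 x = x"
| "iter_log (Suc k) x = ln (iter_log k x)"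

(* In HOL, ln is total, so definedness of the iterated logarithm is tracked separately. *)
primrec iter_log_defined :: "nat \<Rightarrow> real \<Rightarrow> bool" where
  "iter_log_defined 0 x \<longleftrightarrow> True"
| "iter_log_defined (Suc k) x \<longleftrightarrow> iter_log_defined k x \<and> iter_log k x > 0"

fun lambda_iter :: "nat \<Rightarrow> real \<Rightarrow> real" where
  "lambda_iter 0 x = 1"
| "lambda_iter (Suc 0) x = x"
| "lambda_iter (Suc (Suc k)) x = lambda_iter (Suc k) x * iter_log (Suc k) x"

definition Lambda_iter :: "nat \<Rightarrow> real \<Rightarrow> real" where
  "Lambda_iter K x = (\<Sum>k=1..K. 1 / lambda_iter k x)"

definition Lambda_B :: "nat \<Rightarrow> real \<Rightarrow> real \<Rightarrow> real" where
  "Lambda_B K x B = Lambda_iter (K - 1) x + B / lambda_iter K x"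

definition drift_start :: "nat \<Rightarrow> real \<Rightarrow> nat" where
  "drift_start K B = (LEAST i. i > 0 \<and> iter_log_defined (K - 1) (real i) \<and>
     iter_log (K - 1) (real i) > 0 \<and> 1/4 * Lambda_B K (real i) B < 1/2)"

(* Frozen at its value in drift_start below drift_start; the value at 0 is never used. *)
definition drift :: "nat \<Rightarrow> real \<Rightarrow> nat \<Rightarrow> real" where
  "drift K B i = 1/4 * Lambda_B K (real (max i (drift_start K B))) B"

subsection \<open>The drift takes values in the required interval\<close>

lemma Lambda_B_1: "Lambda_B 1 x B = B / x"
  by (simp add: Lambda_B_def Lambda_iter_def)

lemma iter_log_at_top: "filterlim (iter_log k) at_top at_top"
proof (induction k)
  case 0
  have "iter_log 0 = (\<lambda>x. x)" by auto
  then show ?case by (simp add: filterlim_ident)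
next
  case (Suc k)
  have "iter_log (Suc k) = (\<lambda>x. ln (iter_log k x))" by auto
  then show ?case using filterlim_compose[OF ln_at_top Suc] by simp
qed

lemma iter_log_mono:
  assumes "iter_log_defined k x" "x \<le> y"
  shows "iter_log k x \<le> iter_log k y \<and> iter_log_defined k y"
  using assms by (induction k) auto

lemma iter_log_defined_pos: "iter_log_defined k x \<Longrightarrow> j < k \<Longrightarrow> iter_log j x > 0"
  by (induction k) (auto simp: less_Suc_eq)

lemma lambda_iter_Suc: "lambda_iter (Suc k) x = lambda_iter k x * iter_log k x"
  by (cases k) auto

lemma lambda_pos_mono:
  assumes "iter_log_defined k x" "x \<le> y"
  shows "0 < lambda_iter k x \<and> lambda_iter k x \<le> lambda_iter k y"
  using assms
proof (induction k)
  case (Suc k)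
  then show ?case using iter_log_mono[of k x y]
    by (auto simp: lambda_iter_Suc simp del: lambda_iter.simps intro!: mult_mono)
qed auto

lemma iter_log_defined_le: "iter_log_defined k x \<Longrightarrow> j \<le> k \<Longrightarrow> iter_log_defined j x"
  by (induction k) (auto simp: le_Suc_eq)

lemma Lambda_B_pos_antimono:
  assumes "iter_log_defined K x" "x \<le> y" "B > 0"
  shows "0 \<le> Lambda_B K y B \<and> Lambda_B K y B \<le> Lambda_B K x B"
proof -
  have *: "0 \<le> 1 / lambda_iter k y \<and> 1 / lambda_iter k y \<le> 1 / lambda_iter k x" if "k \<le> K" for k
    using lambda_pos_mono[OF iter_log_defined_le[OF assms(1) that] assms(2)]
    by (auto simp: divide_simps)
  have "0 \<le> Lambda_iter (K - 1) y \<and> Lambda_iter (K - 1) y \<le> Lambda_iter (K - 1) x"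
    using * unfolding Lambda_iter_def by (auto intro!: sum_nonneg sum_mono)
  moreover have "0 \<le> B / lambda_iter K y \<and> B / lambda_iter K y \<le> B / lambda_iter K x"
    using *[of K] assms(3) mult_left_mono[of "1 / lambda_iter K y" "1 / lambda_iter K x" B] by auto
  ultimately show ?thesis unfolding Lambda_B_def by linarith
qed

lemma iter_log_ev: "\<forall>\<^sub>F x in at_top. iter_log_defined k x"
proof (induction k)
  case (Suc k)
  have "\<forall>\<^sub>F x in at_top. iter_log k x > 0"
    using iter_log_at_top[of k] by (simp add: filterlim_at_top_dense)
  with Suc show ?case by eventually_elim simp
qed simp

lemma lambda_at_top: "k \<ge> 1 \<Longrightarrow> filterlim (lambda_iter k) at_top at_top"
proof (induction k rule: dec_induct)
  case base
  have "lambda_iter 1 = (\<lambda>x. x)" by auto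
  then show ?case by (simp add: filterlim_ident)
next
  case (step k)
  have "lambda_iter (Suc k) = (\<lambda>x. lambda_iter k x * iter_log k x)" by (auto simp: lambda_iter_Suc)
  then show ?case using filterlim_at_top_mult_at_top[OF step.IH iter_log_at_top[of k]] by simp
qed

lemma Lambda_B_tendsto:
  assumes "K \<ge> 1" shows "((\<lambda>x. Lambda_B K x B) \<longlongrightarrow> 0) at_top"
proof -
  have *: "((\<lambda>x. c / lambda_iter k x) \<longlongrightarrow> 0) at_top" if "k \<ge> 1" for c k
    using real_tendsto_divide_at_top[OF tendsto_const lambda_at_top[OF that]] by simp
  have "((\<lambda>x. \<Sum>k=1..K-1. 1 / lambda_iter k x) \<longlongrightarrow> (\<Sum>k=1..K-1. 0)) at_top"
    by (intro tendsto_sum *) auto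
  then have "((\<lambda>x. (\<Sum>k=1..K-1. 1 / lambda_iter k x) + B / lambda_iter K x) \<longlongrightarrow> 0 + 0) at_top"
    by (intro tendsto_add * assms) simp
  then show ?thesis by (simp add: Lambda_B_def Lambda_iter_def)
qed

lemma drift_start:
  assumes "K \<ge> 1"
  shows "drift_start K B > 0" "iter_log_defined K (real (drift_start K B))"
    "1/4 * Lambda_B K (real (drift_start K B)) B < 1/2"
proof -
  let ?P = "\<lambda>i. i > 0 \<and> iter_log_defined (K - 1) (real i) \<and>
     iter_log (K - 1) (real i) > 0 \<and> 1/4 * Lambda_B K (real i) B < 1/2"
  have def: "iter_log_defined K x \<longleftrightarrow> iter_log_defined (K - 1) x \<and> iter_log (K - 1) x > 0" for x
    using assms by (cases K) auto
  have "\<forall>\<^sub>F x in at_top. Lambda_B K x B < 2"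
    using order_tendstoD(2)[OF Lambda_B_tendsto[OF assms], of 2] by simp
  then have "\<forall>\<^sub>F x in at_top. iter_log_defined K x \<and> Lambda_B K x B < 2"
    using iter_log_ev[of K] by eventually_elim simp
  then have "\<forall>\<^sub>F i in sequentially. iter_log_defined K (real i) \<and> Lambda_B K (real i) B < 2"
    using filterlim_real_sequentially by (auto simp: filterlim_iff)
  then have "\<forall>\<^sub>F i in sequentially. ?P i"
    using eventually_gt_at_top[of 0] by eventually_elim (auto simp: def)
  then have "\<exists>i. ?P i" by (auto simp: eventually_sequentially)
  then have "?P (drift_start K B)" unfolding drift_start_def by (rule LeastI_ex)
  then show "drift_start K B > 0" "iter_log_defined K (real (drift_start K B))"
    "1/4 * Lambda_B K (real (drift_start K B)) B < 1/2" by (auto simp: def)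
qed

lemma drift_bounds:
  assumes "K \<ge> 1" "B > 0"
  shows "0 \<le> drift K B i \<and> drift K B i < 1/2"
proof -
  have "real (drift_start K B) \<le> real (max i (drift_start K B))" by simp
  from Lambda_B_pos_antimono[OF drift_start(2)[OF assms(1)] this assms(2)]
  show ?thesis using drift_start(3)[OF assms(1), of B] unfolding drift_def by linarith
qed

end

theory Submission
  imports Defs
begin

text \<open>
  Let \<open>Z r\<close> be the number of upcrossings from \<open>r\<close> to \<open>r + 1\<close>; it is geometric with mean \<open>D r\<close>, and the local time at
  \<open>r\<close> is at most \<open>Z r + Z (r - 1)\<close>.

  Upper bound: an explicit harmonic function gives
  \<open>E ((1 + u / D r) powr - Z r * (1 - u / D s) powr - Z s) \<le> 1 / (1 - u\<^sup>2 \<delta>)\<close> for \<open>r < s\<close>, where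
  \<open>\<delta> = (rho r + \<dots> + rho s) / (\<Sum>j\<ge>r. rho j)\<close>. Hence the normalised increments
  \<open>Z s / D s - Z r / D r\<close> have exponential tails at scale \<open>sqrt \<delta>\<close>. Cutting \<open>[2 ^ j, 2 ^ (j + 1)]\<close> into a
  bounded number of dyadic blocks, chaining reduces the supremum of \<open>Z r / D r\<close> over a block to its left
  endpoint, and Borel--Cantelli over \<open>j\<close> applies.

  Lower bound: along levels \<open>R k\<close> with \<open>log_K (R k)\<close> of order \<open>k\<close>, the numbers of visits to \<open>R k\<close> before the
  first visit to \<open>R (k + 1)\<close> are independent and geometric with mean about \<open>2 D (R k)\<close>. The product of the
  conditional failure probabilities is a martingale, which replaces the second Borel--Cantelli lemma.
\<close>

subsection \<open>Histories of the walk\<close>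

text \<open>At level \<open>(1 + \<epsilon>) * ln (ln r)\<close> the tail of
  \<open>Z r / D r\<close> is roughly \<open>ln r powr - (1 + \<epsilon>)\<close>. This is summable
  along \<open>r = 2 ^ j\<close> but not over all \<open>r\<close>, so a maximal inequality inside
  \<open>[2 ^ j, 2 ^ (j + 1)]\<close> is unavoidable. It closes because \<open>D r\<close> grows at
  least linearly: blocks that are a small fixed fraction of \<open>2 ^ j\<close> make the ratio
  \<delta> small, and their number does not depend on \<open>j\<close>.

  For the lower bound, the scale tail at \<open>n\<close> is of order
  \<open>exp ((1 - B) * log_K n)\<close>. A fixed step in \<open>log_K\<close> therefore shrinks it
  by a fixed factor, and a walk that has reached \<open>R (k + 1)\<close> hardly ever returns to
  \<open>R k\<close>. Asking for \<open>2 * D * log_(K+1)\<close> visits at \<open>R k\<close>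
  succeeds with probability about \<open>exp (- log_(K+1) (R k)) = 1 / log_K (R k)\<close>, of order
  \<open>1 / k\<close>: the harmonic series is the borderline that fixes the normalisation. The two
  normalisations coincide exactly for \<open>K = 1\<close>.

  Both halves rest on supermartingales that are functions of the finite history; Fatou's lemma
  carries the bounds to infinite time.\<close>

primrec hist :: "(nat \<Rightarrow> nat) \<Rightarrow> nat \<Rightarrow> nat list" where
  "hist w 0 = [w 0]"
| "hist w (Suc n) = w (Suc n) # hist w n"

lemma hist_neq_Nil [simp]: "hist w n \<noteq> []"
  by (cases n) auto

lemma hd_hist [simp]: "hd (hist w n) = w n"
  by (cases n) auto

lemma set_hist: "set (hist w n) = w ` {..n}"
  by (induction n) (auto simp: atMost_Suc)

lemma hist_eq_iff: "hist w n = hist v n \<longleftrightarrow> (\<forall>k\<le>n. w k = v k)"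
  by (induction n) (auto simp: le_Suc_eq)

text \<open>Histories list the latest position first, so a step of the walk is a Cons and
  \<open>hd\<close> is the current state. The start at 0 is the last entry of the list.\<close>

fun nn_path :: "nat list \<Rightarrow> bool" where
  "nn_path [] \<longleftrightarrow> False"
| "nn_path [x] \<longleftrightarrow> x = 0"
| "nn_path (y # x # h) \<longleftrightarrow> nn_path (x # h) \<and> (y = Suc x \<or> x = Suc y)"

lemma nn_path_Cons: "h \<noteq> [] \<Longrightarrow> nn_path (y # h) \<longleftrightarrow> nn_path h \<and> (y = Suc (hd h) \<or> hd h = Suc y)"
  by (cases h) auto

text \<open>At \<open>i = 0\<close> the truncated value \<open>i - 1 = 0\<close> would be a wrong
  successor, but it carries probability 0 because \<open>up_prob p 0 = 1\<close>.\<close>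

definition step_pmf :: "(nat \<Rightarrow> real) \<Rightarrow> nat \<Rightarrow> nat pmf" where
  "step_pmf p i = map_pmf (\<lambda>b. if b then Suc i else i - 1) (bernoulli_pmf (up_prob p i))"

primrec hist_pmf :: "(nat \<Rightarrow> real) \<Rightarrow> nat \<Rightarrow> nat list pmf" where
  "hist_pmf p 0 = return_pmf [0]"
| "hist_pmf p (Suc n) = hist_pmf p n \<bind> (\<lambda>h. map_pmf (\<lambda>y. y # h) (step_pmf p (hd h)))"

lemma pmf_hist_Suc:
  "pmf (hist_pmf p (Suc n)) (y # h) = pmf (hist_pmf p n) h * pmf (step_pmf p (hd h)) y"
proof -
  have *: "pmf (map_pmf (\<lambda>y. y # h') (step_pmf p (hd h'))) (y # h)
      = indicator {h} h' * pmf (step_pmf p (hd h)) y" for h'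
  proof (cases "h' = h")
    case True
    have "inj (\<lambda>y. y # h)" by (simp add: inj_on_def)
    from pmf_map_inj'[OF this] True show ?thesis by simp
  next
    case False
    then have "y # h \<notin> set_pmf (map_pmf (\<lambda>y. y # h') (step_pmf p (hd h')))" by auto
    then have "pmf (map_pmf (\<lambda>y. y # h') (step_pmf p (hd h'))) (y # h) = 0"
      by (simp only: pmf_eq_0_set_pmf not_False_eq_True)
    then show ?thesis using False by simp
  qed
  show ?thesis by (simp add: pmf_bind * measure_pmf_single)
qed

locale drift_range =
  fixes p :: "nat \<Rightarrow> real"
  assumes p_nonneg: "0 \<le> p i" and p_less: "p i < 1/2"
begin

lemma up_prob_bounds: "0 < up_prob p i" "1/2 \<le> up_prob p i" "up_prob p i \<le> 1"
  using p_nonneg[of i] p_less[of i] by (auto simp: up_prob_def)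

end

section \<open>The law of the history and supermartingale bounds\<close>

locale bounded_nn_walk = nearest_neighbour_walk + drift_range
begin

lemma pmf_step:
  "pmf (step_pmf p i) y = (if y = Suc i then up_prob p i else if Suc y = i then 1 - up_prob p i else 0)"
proof -
  have inj: "inj (\<lambda>b. if b then Suc i else i - 1)" by (auto simp: inj_on_def)
  have u: "up_prob p i \<ge> 0" "up_prob p i \<le> 1" using up_prob_bounds[of i] by auto
  consider "y = Suc i" | "y \<noteq> Suc i" "Suc y = i" | "y \<noteq> Suc i" "Suc y \<noteq> i" by blast
  then show ?thesis
  proof cases
    case 1
    have "pmf (step_pmf p i) ((\<lambda>b. if b then Suc i else i - 1) True) = pmf (bernoulli_pmf (up_prob p i)) True"
      unfolding step_pmf_def by (rule pmf_map_inj'[OF inj])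
    then show ?thesis using 1 u by simp
  next
    case 2
    have "pmf (step_pmf p i) ((\<lambda>b. if b then Suc i else i - 1) False) = pmf (bernoulli_pmf (up_prob p i)) False"
      unfolding step_pmf_def by (rule pmf_map_inj'[OF inj])
    then show ?thesis using 2 u by auto
  next
    case 3
    have "y \<notin> set_pmf (step_pmf p i)"
    proof
      assume "y \<in> set_pmf (step_pmf p i)"
      then obtain b where b: "b \<in> set_pmf (bernoulli_pmf (up_prob p i))" "y = (if b then Suc i else i - 1)"
        unfolding step_pmf_def by auto
      with 3 have "\<not> b" "i = 0" by (auto split: if_splits)
      then have "pmf (bernoulli_pmf (up_prob p i)) b = 0" by (simp add: up_prob_def)
      with b show False by (simp add: set_pmf_iff)
    qed
    then show ?thesis using 3 by (simp add: set_pmf_iff)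
  qed
qed

lemma set_hist_pmf: "h \<in> set_pmf (hist_pmf p n) \<Longrightarrow> nn_path h"
proof (induction n arbitrary: h)
  case (Suc n)
  then obtain h' y where h: "h' \<in> set_pmf (hist_pmf p n)" "y \<in> set_pmf (step_pmf p (hd h'))" "h = y # h'"
    by auto
  from h(2) have "y = Suc (hd h') \<or> Suc y = hd h'"
    by (auto simp: set_pmf_iff pmf_step split: if_splits)
  with Suc.IH[OF h(1)] h(3) show ?case by (cases h') auto
qed auto

lemma measurable_X [measurable]: "X n \<in> measurable M (count_space UNIV)"
  by (rule random_variable_walk)

lemma measurable_hist [measurable]: "(\<lambda>\<omega>. hist (\<lambda>n. X n \<omega>) n) \<in> measurable M (count_space UNIV)"
  by (induction n) auto

lemma prob_hist: "prob {\<omega> \<in> space M. hist (\<lambda>n. X n \<omega>) n = h} = pmf (hist_pmf p n) h"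
proof (induction n arbitrary: h)
  case 0
  show ?case
  proof (cases "h = [0]")
    case True
    have "prob {\<omega> \<in> space M. X 0 \<omega> = 0} = 1"
      using start by (subst prob_Collect_eq_1) auto
    then show ?thesis using True by simp
  next
    case False
    have "AE \<omega> in M. \<not> hist (\<lambda>n. X n \<omega>) 0 = h"
      using start by eventually_elim (use False in auto)
    then have "prob {\<omega> \<in> space M. hist (\<lambda>n. X n \<omega>) 0 = h} = 0"
      by (subst prob_eq_0) auto
    then show ?thesis using False by (simp add: pmf_eq_0_set_pmf del: hist.simps)
  qed
next
  case (Suc n)
  show ?case
  proof (cases h)
    case Nil
    then have "h \<notin> set_pmf (hist_pmf p (Suc n))" using set_hist_pmf by fastforce
    then show ?thesis using Nil by (simp add: set_pmf_iff del: hist_pmf.simps)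
  next
    case (Cons y h')
    let ?E = "{\<omega> \<in> space M. hist (\<lambda>n. X n \<omega>) n = h'}"
    have split: "{\<omega> \<in> space M. hist (\<lambda>n. X n \<omega>) (Suc n) = h}
        = {\<omega> \<in> space M. X (Suc n) \<omega> = y \<and> hist (\<lambda>n. X n \<omega>) n = h'}" using Cons by auto
    show ?thesis
    proof (cases "prob ?E = 0")
      case True
      have "prob {\<omega> \<in> space M. X (Suc n) \<omega> = y \<and> hist (\<lambda>n. X n \<omega>) n = h'} \<le> prob ?E"
        by (intro finite_measure_mono) auto
      then have "prob {\<omega> \<in> space M. hist (\<lambda>n. X n \<omega>) (Suc n) = h} = 0"
        using True split by (simp add: measure_le_0_iff)
      moreover have "pmf (hist_pmf p (Suc n)) h = 0"
        using True Suc.IH[of h'] by (simp only: Cons pmf_hist_Suc)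
      ultimately show ?thesis by (simp del: hist.simps hist_pmf.simps)
    next
      case False
      \<comment> \<open>A history of positive probability is realised by some sample point, which
        gives the explicit sequence \<open>x\<close> that the Markov hypothesis asks for.\<close>
      then obtain \<omega>0 where \<omega>0: "\<omega>0 \<in> ?E" by (metis (no_types, lifting) equals0I measure_empty)
      define x where "x k = X k \<omega>0" for k
      have h'_eq: "h' = hist x n" using \<omega>0 unfolding x_def by auto
      have E_eq: "?E = {\<omega> \<in> space M. \<forall>k\<le>n. X k \<omega> = x k}" by (simp add: h'_eq hist_eq_iff)
      have pos: "prob {\<omega> \<in> space M. \<forall>k\<le>n. X k \<omega> = x k} > 0"
        using False E_eq by (simp add: zero_less_measure_iff)
      let ?i = "x n"
      let ?F = "{\<omega> \<in> space M. X n \<omega> = ?i}"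
      have "prob {\<omega> \<in> space M. \<forall>k\<le>n. X k \<omega> = x k} \<le> prob ?F"
        by (intro finite_measure_mono) auto
      with pos have posF: "prob ?F > 0" by linarith
      have cp: "cond_prob M (\<lambda>\<omega>. X (Suc n) \<omega> = z) (\<lambda>\<omega>. X n \<omega> = ?i) = pmf (step_pmf p ?i) z" for z
      proof -
        consider "z = Suc ?i" | "Suc z = ?i" | "z \<noteq> Suc ?i" "Suc z \<noteq> ?i" by blast
        then show ?thesis
        proof cases
          case 1
          then show ?thesis using step_up[OF posF] by (simp add: pmf_step)
        next
          case 2
          then have z: "z = ?i - 1" "?i \<ge> 1" by auto
          show ?thesis using step_down[OF z(2) posF] 2 unfolding z(1)[symmetric] by (auto simp: pmf_step)
        next
          case 3
          \<comment> \<open>The steps up and down already exhaust the mass of \<open>?F\<close>, so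
            every other successor is null.\<close>
          have up: "prob {\<omega> \<in> space M. X (Suc n) \<omega> = Suc ?i \<and> X n \<omega> = ?i} = up_prob p ?i * prob ?F"
            using step_up[OF posF] posF by (simp add: cond_prob_def field_simps)
          have dn: "prob {\<omega> \<in> space M. Suc (X (Suc n) \<omega>) = ?i \<and> X n \<omega> = ?i} = (1 - up_prob p ?i) * prob ?F"
          proof (cases "?i = 0")
            case True
            then show ?thesis by (simp add: up_prob_def)
          next
            case False
            then have "{\<omega> \<in> space M. Suc (X (Suc n) \<omega>) = ?i \<and> X n \<omega> = ?i}
               = {\<omega> \<in> space M. X (Suc n) \<omega> = ?i - 1 \<and> X n \<omega> = ?i}" by auto
            then show ?thesis
              using step_down[OF _ posF] posF False by (simp add: cond_prob_def field_simps)
          qed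
          have "prob {\<omega> \<in> space M. X (Suc n) \<omega> = z \<and> X n \<omega> = ?i}
             + (prob {\<omega> \<in> space M. X (Suc n) \<omega> = Suc ?i \<and> X n \<omega> = ?i}
             + prob {\<omega> \<in> space M. Suc (X (Suc n) \<omega>) = ?i \<and> X n \<omega> = ?i})
             = prob ({\<omega> \<in> space M. X (Suc n) \<omega> = z \<and> X n \<omega> = ?i} \<union>
             ({\<omega> \<in> space M. X (Suc n) \<omega> = Suc ?i \<and> X n \<omega> = ?i} \<union>
              {\<omega> \<in> space M. Suc (X (Suc n) \<omega>) = ?i \<and> X n \<omega> = ?i}))"
            using 3 by (subst finite_measure_Union; (subst finite_measure_Union)?) auto
          also have "\<dots> \<le> prob ?F" by (intro finite_measure_mono) auto
          finally have "prob {\<omega> \<in> space M. X (Suc n) \<omega> = z \<and> X n \<omega> = ?i} \<le> 0"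
            unfolding up dn by (simp add: algebra_simps)
          then have "prob {\<omega> \<in> space M. X (Suc n) \<omega> = z \<and> X n \<omega> = ?i} = 0"
            by (simp add: measure_le_0_iff)
          then show ?thesis using 3 by (simp add: cond_prob_def pmf_step)
        qed
      qed
      have "cond_prob M (\<lambda>\<omega>. X (Suc n) \<omega> = y) (\<lambda>\<omega>. \<forall>k\<le>n. X k \<omega> = x k) = pmf (step_pmf p ?i) y"
        using markov[OF pos, of y] cp by simp
      then have "prob {\<omega> \<in> space M. X (Suc n) \<omega> = y \<and> (\<forall>k\<le>n. X k \<omega> = x k)}
          = prob ?E * pmf (step_pmf p ?i) y"
        using pos E_eq by (simp add: cond_prob_def field_simps)
      moreover have "{\<omega> \<in> space M. X (Suc n) \<omega> = y \<and> (\<forall>k\<le>n. X k \<omega> = x k)}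
         = {\<omega> \<in> space M. X (Suc n) \<omega> = y \<and> hist (\<lambda>n. X n \<omega>) n = h'}"
        by (simp add: h'_eq hist_eq_iff)
      ultimately have "prob {\<omega> \<in> space M. hist (\<lambda>n. X n \<omega>) (Suc n) = h}
          = prob ?E * pmf (step_pmf p ?i) y" using split by simp
      then show ?thesis unfolding Suc.IH Cons pmf_hist_Suc by (simp add: h'_eq)
    qed
  qed
qed

lemma distr_hist: "distr M (count_space UNIV) (\<lambda>\<omega>. hist (\<lambda>n. X n \<omega>) n) = measure_pmf (hist_pmf p n)"
proof (rule measure_eqI_countable)
  fix h :: "nat list"
  have "emeasure (distr M (count_space UNIV) (\<lambda>\<omega>. hist (\<lambda>n. X n \<omega>) n)) {h}
      = emeasure M {\<omega> \<in> space M. hist (\<lambda>n. X n \<omega>) n = h}"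
    by (subst emeasure_distr) (auto intro!: arg_cong[where f="emeasure M"])
  also have "\<dots> = ennreal (pmf (hist_pmf p n) h)"
    by (simp only: emeasure_eq_measure prob_hist)
  finally show "emeasure (distr M (count_space UNIV) (\<lambda>\<omega>. hist (\<lambda>n. X n \<omega>) n)) {h}
      = emeasure (measure_pmf (hist_pmf p n)) {h}" by (simp add: emeasure_pmf_single)
qed (auto simp: countable_subset)

lemma AE_nn_path: "AE \<omega> in M. nn_path (hist (\<lambda>n. X n \<omega>) n)"
proof -
  have "AE h in measure_pmf (hist_pmf p n). nn_path h"
    using set_hist_pmf by (simp add: AE_measure_pmf_iff)
  then show ?thesis unfolding distr_hist[symmetric] by (subst (asm) AE_distr_iff) auto
qed

text \<open>The law of the history is an iterated pmf, so the one-step inequality can be integrated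
  and iterated. Everything is required along nearest neighbour paths only, since other lists have
  probability 0.\<close>

lemma nn_integral_supermartingale:
  fixes g :: "nat list \<Rightarrow> real"
  assumes nonneg: "\<And>h. nn_path h \<Longrightarrow> 0 \<le> g h"
  assumes super: "\<And>h. nn_path h \<Longrightarrow> up_prob p (hd h) * g (Suc (hd h) # h)
      + (1 - up_prob p (hd h)) * g ((hd h - 1) # h) \<le> g h"
  shows "(\<integral>\<^sup>+\<omega>. ennreal (g (hist (\<lambda>n. X n \<omega>) n)) \<partial>M) \<le> ennreal (g [0])"
proof -
  have step: "(\<integral>\<^sup>+y. ennreal (g (y # h)) \<partial>measure_pmf (step_pmf p (hd h))) \<le> ennreal (g h)"
    if h: "nn_path h" for h
  proof -
    let ?u = "up_prob p (hd h)"
    have ne: "h \<noteq> []" using h by auto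
    have u: "0 \<le> ?u" "?u \<le> 1" using up_prob_bounds[of "hd h"] by auto
    have "(\<integral>\<^sup>+y. ennreal (g (y # h)) \<partial>measure_pmf (step_pmf p (hd h)))
        = ennreal (g (Suc (hd h) # h)) * ennreal ?u + ennreal (g ((hd h - 1) # h)) * ennreal (1 - ?u)"
      unfolding step_pmf_def using u by simp
    also have "\<dots> = ennreal (?u * g (Suc (hd h) # h) + (1 - ?u) * g ((hd h - 1) # h))"
    proof -
      have 1: "0 \<le> g (Suc (hd h) # h)" using ne h by (intro nonneg) (simp add: nn_path_Cons)
      have 2: "0 \<le> g ((hd h - 1) # h)" if "hd h \<noteq> 0" using ne h that
        by (intro nonneg) (simp add: nn_path_Cons)
      show ?thesis
      \<comment> \<open>At 0 the lower successor \<open>0 # h\<close> is not a path and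
        \<open>g\<close> may be negative there, but its weight vanishes.\<close>
      proof (cases "hd h = 0")
        case True
        then show ?thesis by (simp add: up_prob_def)
      next
        case False
        then show ?thesis using 1 2 u
          by (simp add: ennreal_mult[symmetric] ennreal_plus[symmetric] mult.commute del: ennreal_plus)
      qed
    qed
    also have "\<dots> \<le> ennreal (g h)" by (intro ennreal_leI super h)
    finally show ?thesis .
  qed
  have "(\<integral>\<^sup>+h. ennreal (g h) \<partial>measure_pmf (hist_pmf p n)) \<le> ennreal (g [0])"
  proof (induction n)
    case (Suc n)
    have "(\<integral>\<^sup>+h. ennreal (g h) \<partial>measure_pmf (hist_pmf p (Suc n)))
      = (\<integral>\<^sup>+h. (\<integral>\<^sup>+y. ennreal (g (y # h)) \<partial>measure_pmf (step_pmf p (hd h))) \<partial>measure_pmf (hist_pmf p n))"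
      by simp
    also have "\<dots> \<le> (\<integral>\<^sup>+h. ennreal (g h) \<partial>measure_pmf (hist_pmf p n))"
      using set_hist_pmf by (intro nn_integral_mono_AE) (auto simp: AE_measure_pmf_iff intro!: step)
    finally show ?case using Suc by simp
  qed simp
  moreover have "(\<integral>\<^sup>+\<omega>. ennreal (g (hist (\<lambda>n. X n \<omega>) n)) \<partial>M)
      = (\<integral>\<^sup>+h. ennreal (g h) \<partial>measure_pmf (hist_pmf p n))"
    unfolding distr_hist[symmetric] by (subst nn_integral_distr) auto
  ultimately show ?thesis by simp
qed

end

subsection \<open>Scale function and exponential moments of upcrossings\<close>

definition rho :: "(nat \<Rightarrow> real) \<Rightarrow> nat \<Rightarrow> real" where
  "rho p n = (\<Prod>i=1..n. U_ratio p i)"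

text \<open>\<open>rho\<close> is the increment of the classical scale function, and this is its
  remaining mass beyond \<open>n\<close>. For \<open>x \<ge> m\<close> the quotient
  \<open>scale_tail p x / scale_tail p m\<close> is the probability of ever hitting \<open>m\<close>
  from \<open>x\<close>.\<close>

definition scale_tail :: "(nat \<Rightarrow> real) \<Rightarrow> nat \<Rightarrow> real" where
  "scale_tail p n = (\<Sum>j. rho p (n + j))"

definition D_val :: "(nat \<Rightarrow> real) \<Rightarrow> nat \<Rightarrow> real" where
  "D_val p n = scale_tail p n / rho p n"

lemma rho_0 [simp]: "rho p 0 = 1"
  by (simp add: rho_def)

lemma rho_Suc: "rho p (Suc n) = rho p n * U_ratio p (Suc n)"
  by (simp add: rho_def)

context drift_range
begin

lemma U_ratio_bounds: "0 < U_ratio p i" "U_ratio p i \<le> 1"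
  using p_nonneg[of i] p_less[of i] by (auto simp: U_ratio_def field_simps)

lemma rho_pos: "0 < rho p n"
  by (simp add: rho_def prod_pos U_ratio_bounds)

lemma rho_neq_0 [simp]: "rho p n \<noteq> 0"
  using rho_pos[of n] by simp

lemma rho_Suc_le: "rho p (Suc n) \<le> rho p n"
  unfolding rho_Suc using U_ratio_bounds[of "Suc n"] rho_pos[of n] by (simp add: mult_left_le)

lemma rho_antimono: "m \<le> n \<Longrightarrow> rho p n \<le> rho p m"
proof (induction n rule: dec_induct)
  case (step n)
  then show ?case using rho_Suc_le[of n] by simp
qed simp

end

locale transient_drift = drift_range +
  assumes summable_rho: "summable (rho p)"
begin

lemma summable_rho_shift: "summable (\<lambda>j. rho p (n + j))"
  using summable_ignore_initial_segment[OF summable_rho, of n] by (simp add: add.commute)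

lemma scale_tail_Suc: "scale_tail p n = rho p n + scale_tail p (Suc n)"
  using suminf_split_head[OF summable_rho_shift[of n]] by (simp add: scale_tail_def)

lemma scale_tail_pos: "0 < scale_tail p n"
  unfolding scale_tail_def by (intro suminf_pos summable_rho_shift rho_pos)

lemma scale_tail_neq_0 [simp]: "scale_tail p n \<noteq> 0"
  using scale_tail_pos[of n] by simp

lemma scale_tail_split: "m \<le> n \<Longrightarrow> scale_tail p m = (\<Sum>j=m..<n. rho p j) + scale_tail p n"
proof (induction n rule: dec_induct)
  case (step n)
  then show ?case using scale_tail_Suc[of n] by simp
qed simp

lemma scale_tail_strict_antimono: "m < n \<Longrightarrow> scale_tail p n < scale_tail p m"
proof (induction n rule: less_Suc_induct)
  case (1 n)
  then show ?case using scale_tail_Suc[of n] rho_pos[of n] by simp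
qed simp

lemma scale_tail_antimono: "m \<le> n \<Longrightarrow> scale_tail p n \<le> scale_tail p m"
  using scale_tail_strict_antimono[of m n] by (cases "m = n") auto

text \<open>The definition of \<open>U_ratio\<close> amounts to the balance
  \<open>up_prob p x * rho p x = (1 - up_prob p x) * rho p (x - 1)\<close> of the two increments at
  \<open>x\<close>.\<close>

lemma scale_tail_harmonic:
  assumes "x \<ge> 1"
  shows "up_prob p x * scale_tail p (Suc x) + (1 - up_prob p x) * scale_tail p (x - 1) = scale_tail p x"
proof -
  obtain y where x: "x = Suc y" using assms by (cases x) auto
  have 1: "scale_tail p y = rho p y + scale_tail p x" "scale_tail p x = rho p x + scale_tail p (Suc x)"
    unfolding x by (rule scale_tail_Suc)+
  have "(1/2 + p x) * rho p x = (1/2 - p x) * rho p y"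
    unfolding x rho_Suc U_ratio_def using p_nonneg[of "Suc y"] by (simp add: field_simps)
  then have "up_prob p x * rho p x = (1 - up_prob p x) * rho p y"
    using x by (simp add: up_prob_def)
  then show ?thesis using 1 x by (simp add: algebra_simps)
qed

lemma D_val_pos: "0 < D_val p n"
  by (simp add: D_val_def scale_tail_pos rho_pos)

lemma D_val_neq_0 [simp]: "D_val p n \<noteq> 0"
  using D_val_pos[of n] by simp

lemma D_val_ge_1: "1 \<le> D_val p n"
  using scale_tail_Suc[of n] scale_tail_pos[of "Suc n"] rho_pos[of n] by (simp add: D_val_def divide_simps)

text \<open>This recursion is used twice: it bounds \<open>D_val\<close> at a level by its value at
  the next one, and it identifies the closed form when \<open>K = 1\<close>.\<close>

lemma D_val_pred: "D_val p n = 1 + U_ratio p (Suc n) * D_val p (Suc n)"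
  using rho_pos[of n] rho_pos[of "Suc n"] U_ratio_bounds(1)[of "Suc n"] unfolding D_val_def
  by (subst scale_tail_Suc) (simp add: rho_Suc field_simps)

lemma D_inf_eq: "D_inf p m = ereal (D_val p m)"
proof -
  have *: "(\<Prod>i=1..Suc j. U_ratio p (m + i)) = rho p (m + Suc j) / rho p m" for j
  proof (induction j)
    case 0
    then show ?case using rho_pos[of m] by (simp add: rho_Suc)
  next
    case (Suc j)
    have "(\<Prod>i=1..Suc (Suc j). U_ratio p (m + i)) = (\<Prod>i=1..Suc j. U_ratio p (m + i)) * U_ratio p (m + Suc (Suc j))"
      by simp
    then show ?case using Suc rho_Suc[of p "m + Suc j"] by (simp add: mult.commute)
  qed
  have "(\<lambda>j. rho p (Suc m + j)) sums scale_tail p (Suc m)"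
    unfolding scale_tail_def by (intro summable_sums summable_rho_shift)
  then have "(\<lambda>j. rho p (m + Suc j) / rho p m) sums (scale_tail p (Suc m) / rho p m)"
    using sums_divide by fastforce
  then have "(\<lambda>j. ereal (\<Prod>i=1..Suc j. U_ratio p (m + i))) sums ereal (scale_tail p (Suc m) / rho p m)"
    unfolding * by (simp add: sums_ereal)
  then have "(\<Sum>j. ereal (\<Prod>i=1..Suc j. U_ratio p (m + i))) = ereal (scale_tail p (Suc m) / rho p m)"
    by (simp only: sums_iff)
  then show ?thesis unfolding D_inf_def D_val_def using scale_tail_Suc[of m] rho_pos[of m]
    by (simp add: field_simps one_ereal_def)
qed

end

section \<open>Counting upcrossings along histories\<close>

fun ups :: "nat \<Rightarrow> nat list \<Rightarrow> nat" where
  "ups r (y # x # h) = ups r (x # h) + (if x = r \<and> y = Suc r then 1 else 0)"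
| "ups r h = 0"

lemma ups_Cons: "h \<noteq> [] \<Longrightarrow> ups r (y # h) = ups r h + (if hd h = r \<and> y = Suc r then 1 else 0)"
  by (cases h) auto

lemma ups_hist: "ups r (hist w n) = card {k. k < n \<and> w k = r \<and> w (Suc k) = Suc r}"
proof (induction n)
  case (Suc n)
  have "{k. k < Suc n \<and> w k = r \<and> w (Suc k) = Suc r} =
    (if w n = r \<and> w (Suc n) = Suc r then insert n else id) {k. k < n \<and> w k = r \<and> w (Suc k) = Suc r}"
    by (auto simp: less_Suc_eq)
  then show ?case using Suc by (simp add: ups_Cons)
qed simp

lemma finite_if_card_bounded_initial:
  fixes A :: "nat set"
  assumes "\<And>n. card {k. k < n \<and> k \<in> A} \<le> b"
  shows "finite A"
proof (rule ccontr)
  assume "infinite A"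
  then obtain B where B: "B \<subseteq> A" "finite B" "card B = Suc b"
    using infinite_arbitrarily_large by blast
  obtain n where n: "\<forall>k\<in>B. k < n" using B(2) finite_nat_set_iff_bounded by blast
  have "card B \<le> card {k. k < n \<and> k \<in> A}" using B n by (intro card_mono) auto
  then show False using assms[of n] B(3) by simp
qed

lemma card_initial_eventually:
  fixes A :: "nat set"
  assumes "finite A"
  shows "\<forall>\<^sub>F n in sequentially. card {k. k < n \<and> k \<in> A} = card A"
proof -
  obtain N where "\<forall>k\<in>A. k < N" using assms finite_nat_set_iff_bounded by blast
  then have "{k. k < n \<and> k \<in> A} = A" if "n \<ge> N" for n using that by fastforce
  then have "card {k. k < n \<and> k \<in> A} = card A" if "n \<ge> N" for n using that by simp
  then show ?thesis by (auto simp only: eventually_sequentially)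
qed

context bounded_nn_walk
begin

text \<open>The factors \<alpha> and \<beta> are charged at each step up from \<open>r\<close> and
  \<open>s\<close>; the hypothesis on \<open>f\<close> makes the accumulated weight times
  \<open>f\<close> at the current position a supermartingale started at \<open>f 0\<close>. At time
  \<open>n\<close> the factor \<open>f\<close> is dropped because it is at least 1, so the bound is
  uniform in \<open>n\<close>.\<close>

lemma nn_integral_ups_le:
  assumes ab: "0 < \<alpha>" "0 < \<beta>" "r \<noteq> s" and f: "\<And>x. 1 \<le> f x"
    and super: "\<And>x. up_prob p x * ((if x = r then \<alpha> else if x = s then \<beta> else 1) * f (Suc x))
       + (1 - up_prob p x) * f (x - 1) \<le> f x"
  shows "(\<integral>\<^sup>+\<omega>. ennreal (\<alpha> ^ ups r (hist (\<lambda>n. X n \<omega>) n) * \<beta> ^ ups s (hist (\<lambda>n. X n \<omega>) n)) \<partial>M) \<le> ennreal (f 0)"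
proof -
  define g where "g h = \<alpha> ^ ups r h * \<beta> ^ ups s h * f (hd h)" for h
  have "(\<integral>\<^sup>+\<omega>. ennreal (\<alpha> ^ ups r (hist (\<lambda>n. X n \<omega>) n) * \<beta> ^ ups s (hist (\<lambda>n. X n \<omega>) n)) \<partial>M)
     \<le> (\<integral>\<^sup>+\<omega>. ennreal (g (hist (\<lambda>n. X n \<omega>) n)) \<partial>M)"
  proof (intro nn_integral_mono ennreal_leI)
    fix \<omega>
    let ?h = "hist (\<lambda>n. X n \<omega>) n"
    have "\<alpha> ^ ups r ?h * \<beta> ^ ups s ?h * 1 \<le> \<alpha> ^ ups r ?h * \<beta> ^ ups s ?h * f (hd ?h)"
      using ab f by (intro mult_left_mono) auto
    then show "\<alpha> ^ ups r ?h * \<beta> ^ ups s ?h \<le> g ?h" by (simp add: g_def)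
  qed
  also have "\<dots> \<le> ennreal (g [0])"
  proof (rule nn_integral_supermartingale)
    fix h assume h: "nn_path h"
    show "0 \<le> g h" unfolding g_def using ab f[of "hd h"] by simp
    let ?x = "hd h" and ?w = "\<alpha> ^ ups r h * \<beta> ^ ups s h"
    have ne: "h \<noteq> []" using h by auto
    have up: "g (Suc ?x # h) = ?w * ((if ?x = r then \<alpha> else if ?x = s then \<beta> else 1) * f (Suc ?x))"
      using ab ne by (auto simp: g_def ups_Cons)
    have dn: "g ((?x - 1) # h) = ?w * f (?x - 1)" using ne by (auto simp: g_def ups_Cons)
    have "?w * (up_prob p ?x * ((if ?x = r then \<alpha> else if ?x = s then \<beta> else 1) * f (Suc ?x))
       + (1 - up_prob p ?x) * f (?x - 1)) \<le> ?w * f ?x"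
      using ab by (intro mult_left_mono super) auto
    then show "up_prob p ?x * g (Suc ?x # h) + (1 - up_prob p ?x) * g ((?x - 1) # h) \<le> g h"
      unfolding up dn g_def[of h] by (simp add: algebra_simps)
  qed
  also have "g [0] = f 0" by (simp add: g_def)
  finally show ?thesis .
qed

lemma prob_ge_le_exp:
  assumes [measurable]: "f \<in> borel_measurable M" and u: "u > 0"
    and le: "(\<integral>\<^sup>+\<omega>. ennreal (exp (u * f \<omega>)) \<partial>M) \<le> ennreal C" and C: "C \<ge> 0"
  shows "prob {\<omega> \<in> space M. f \<omega> \<ge> x} \<le> C * exp (- (u * x))"
proof -
  have "emeasure M {\<omega> \<in> space M. f \<omega> \<ge> x} \<le> (\<integral>\<^sup>+\<omega>. ennreal (exp (- (u * x))) * ennreal (exp (u * f \<omega>)) \<partial>M)"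
  proof -
    have "emeasure M {\<omega> \<in> space M. f \<omega> \<ge> x} = (\<integral>\<^sup>+\<omega>. indicator {\<omega> \<in> space M. f \<omega> \<ge> x} \<omega> \<partial>M)"
      by simp
    also have "\<dots> \<le> (\<integral>\<^sup>+\<omega>. ennreal (exp (- (u * x))) * ennreal (exp (u * f \<omega>)) \<partial>M)"
    proof (rule nn_integral_mono)
      fix \<omega>
      show "indicator {\<omega> \<in> space M. f \<omega> \<ge> x} \<omega> \<le> ennreal (exp (- (u * x))) * ennreal (exp (u * f \<omega>))"
        using u by (auto simp: indicator_def ennreal_mult[symmetric] exp_add[symmetric] simp flip: ennreal_1 intro!: ennreal_leI)
    qed
    finally show ?thesis .
  qed
  also have "\<dots> = ennreal (exp (- (u * x))) * (\<integral>\<^sup>+\<omega>. ennreal (exp (u * f \<omega>)) \<partial>M)"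
    by (rule nn_integral_cmult) measurable
  also have "\<dots> \<le> ennreal (exp (- (u * x))) * ennreal C"
    by (intro mult_left_mono le) auto
  also have "\<dots> = ennreal (C * exp (- (u * x)))" using C by (simp add: ennreal_mult mult.commute)
  finally show ?thesis using C by (simp add: emeasure_eq_measure)
qed

end

section \<open>Exponential moments and tails of upcrossing numbers\<close>

locale transient_nn_walk = bounded_nn_walk + transient_drift
begin

text \<open>The function \<open>f\<close> below is the expected weight of the future upcrossings:
  constant up to \<open>r\<close>, and beyond \<open>r\<close> affine in the scale tail with limit 1
  at infinity. Writing the weight as \<open>1 / (1 - v / D)\<close> makes the matching condition at
  \<open>r\<close> solve to \<open>V = 1 / (1 - v)\<close>, which is free of
  \<open>r\<close>.\<close>

lemma nn_integral_ups_one: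
  assumes v: "0 < v" "v < 1"
  shows "(\<integral>\<^sup>+\<omega>. ennreal ((1 / (1 - v / D_val p r)) ^ ups r (hist (\<lambda>n. X n \<omega>) n)) \<partial>M) \<le> ennreal (1 / (1 - v))"
proof -
  let ?S = "scale_tail p" and ?D = "D_val p r"
  define V where "V = 1 / (1 - v)"
  have V: "V \<ge> 1" "V - 1 = V * v" using v by (auto simp: V_def field_simps)
  have D: "v / ?D < 1" "?D \<ge> 1" using D_val_ge_1[of r] v by (auto simp: divide_simps)
  define f where "f x = (if x \<le> r then V else 1 + (V - 1) * ?S x / ?S r)" for x
  have f_tail: "f x = 1 + (V - 1) * ?S x / ?S r" if "x \<ge> r" for x
    using that scale_tail_pos[of r] by (auto simp: f_def)
  have "(\<integral>\<^sup>+\<omega>. ennreal ((1 / (1 - v / ?D)) ^ ups r (hist (\<lambda>n. X n \<omega>) n) * 1 ^ ups (Suc r) (hist (\<lambda>n. X n \<omega>) n)) \<partial>M)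
      \<le> ennreal (f 0)"
  \<comment> \<open>Only one level counts here; \<open>Suc r\<close> is a dummy second level with
    the neutral weight 1.\<close>
  proof (rule nn_integral_ups_le)
    show "0 < 1 / (1 - v / ?D)" using D by simp
    show "1 \<le> f x" for x using V scale_tail_pos[of x] scale_tail_pos[of r] by (auto simp: f_def)
    fix x
    consider "x < r" | "x = r" | "x > r" by linarith
    then show "up_prob p x * ((if x = r then 1 / (1 - v / ?D) else if x = Suc r then 1 else 1) * f (Suc x))
       + (1 - up_prob p x) * f (x - 1) \<le> f x"
    proof cases
      case 1
      then have "f (Suc x) = V" "f (x - 1) = V" "f x = V" by (auto simp: f_def)
      then show ?thesis using 1 by (simp add: algebra_simps)
    next
      case 2
      have "f (Suc r) = 1 + (V - 1) * (?S r - rho p r) / ?S r" using scale_tail_Suc[of r] by (simp add: f_def)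
      also have "\<dots> = V - (V - 1) / ?D"
        using scale_tail_pos[of r] rho_pos[of r] by (simp add: D_val_def field_simps)
      also have "\<dots> = V * (1 - v / ?D)" unfolding V(2) by (simp add: algebra_simps)
      finally have "1 / (1 - v / ?D) * f (Suc r) = V" using D by simp
      moreover have "f r = V" "f (r - 1) = V" by (auto simp: f_def)
      ultimately show ?thesis using 2 by (simp add: algebra_simps)
    next
      case 3
      define c where "c = (V - 1) / ?S r"
      have a: "f (Suc x) = 1 + c * ?S (Suc x)" "f (x - 1) = 1 + c * ?S (x - 1)"
        "f x = 1 + c * ?S x" using 3 f_tail by (auto simp: c_def)
      have "up_prob p x * f (Suc x) + (1 - up_prob p x) * f (x - 1) = 1 + c *
         (up_prob p x * ?S (Suc x) + (1 - up_prob p x) * ?S (x - 1))"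
        unfolding a by (simp add: algebra_simps)
      also have "\<dots> = f x" using 3 by (subst scale_tail_harmonic) (auto simp: a)
      finally show ?thesis using 3 by simp
    qed
  qed auto
  then show ?thesis by (simp add: f_def V_def)
qed

text \<open>\<open>Z r / D_val p r\<close> and \<open>Z s / D_val p s\<close> both have mean 1, so
  the first-order effects of the opposite weights cancel and the cost is quadratic in
  \<open>u\<close>. Its coefficient \<delta> is the probability that the walk never returns to
  \<open>r\<close> from \<open>Suc s\<close>, which is small for close levels.\<close>

lemma nn_integral_ups_two:
  assumes rs: "r < s" and u: "0 < u" "u < D_val p s"
    and d: "u\<^sup>2 * (scale_tail p r - scale_tail p (Suc s)) \<le> scale_tail p r / 4"
  shows "(\<integral>\<^sup>+\<omega>. ennreal ((1 / (1 + u / D_val p r)) ^ ups r (hist (\<lambda>n. X n \<omega>) n) *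
       (1 / (1 - u / D_val p s)) ^ ups s (hist (\<lambda>n. X n \<omega>) n)) \<partial>M) \<le> ennreal (4/3)"
proof -
  let ?S = "scale_tail p" and ?\<alpha> = "1 / (1 + u / D_val p r)" and ?\<beta> = "1 / (1 - u / D_val p s)"
  define \<delta> where "\<delta> = (?S r - ?S (Suc s)) / ?S r"
  have Sp: "?S r > 0" "?S s > 0" by (auto intro: scale_tail_pos)
  have \<delta>: "u\<^sup>2 * \<delta> \<le> 1/4" "0 < \<delta>"
    using d Sp scale_tail_strict_antimono[of r "Suc s"] rs by (auto simp: \<delta>_def field_simps)
  \<comment> \<open>The value of \<open>f\<close> up to \<open>r\<close> is forced by the junction
    at \<open>s\<close>: it is the solution of \<open>V - 1 = V * u^2 * \<delta>\<close>. The
    hypothesis \<open>u^2 * \<delta> \<le> 1/4\<close> is what gives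
    \<open>V \<le> 4/3\<close>.\<close>
  define V where "V = 1 / (1 - u\<^sup>2 * \<delta>)"
  have V: "V \<ge> 1" "V \<le> 4/3" "V - 1 = V * u\<^sup>2 * \<delta>" using \<delta> u by (auto simp: V_def field_simps)
  have D: "u / D_val p s < 1" "D_val p r > 0" using u D_val_pos[of s] D_val_pos[of r] by (auto simp: divide_simps)
  \<comment> \<open>\<open>f\<close> is affine in the scale function on each piece; \<open>m (Suc s)\<close> is its value just before the factor
    of the upcrossing from \<open>s\<close> is taken into account.\<close>
  define m where "m x = V * (1 + u * (?S r - ?S x) / ?S r)" for x
  define t where "t x = 1 + (m s - 1) * ?S x / ?S s" for x
  define f where "f x = (if x \<le> r then V else if x \<le> s then m x else t x)" for x
  have m_r: "m r = V" by (simp add: m_def)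
  have t_s: "t s = m s" using Sp by (simp add: t_def)
  have f_mid: "f x = m x" if "r \<le> x" "x \<le> s" for x using that m_r by (auto simp: f_def)
  have f_tail: "f x = t x" if "s \<le> x" for x using that rs t_s by (auto simp: f_def)
  have m_ge: "m x \<ge> 1" if "x \<ge> r" for x
  proof -
    have "u * (?S r - ?S x) / ?S r \<ge> 0" using u Sp scale_tail_antimono[OF that] by simp
    then have "1 * 1 \<le> V * (1 + u * (?S r - ?S x) / ?S r)" using V by (intro mult_mono) auto
    then show ?thesis by (simp add: m_def)
  qed
  have t_ge: "t x \<ge> 1" for x using m_ge[of s] rs Sp scale_tail_pos[of x] by (simp add: t_def)
  have junction: "t (Suc s) = (1 - u / D_val p s) * m (Suc s)"
  proof -
    define \<kappa> where "\<kappa> = rho p s / ?S s"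
    have \<kappa>: "u / D_val p s = u * \<kappa>" by (simp add: \<kappa>_def D_val_def)
    have Ss: "?S (Suc s) = ?S s * (1 - \<kappa>)" using scale_tail_Suc[of s] Sp by (simp add: \<kappa>_def field_simps)
    have \<kappa>0: "\<kappa> > 0" using rho_pos[of s] Sp by (simp add: \<kappa>_def)
    have mS: "m (Suc s) = V * (1 + u * \<delta>)" by (simp add: m_def \<delta>_def)
    have "(1 - \<delta>) * ?S r = ?S s * (1 - \<kappa>)" unfolding \<delta>_def Ss[symmetric] using Sp by (simp add: field_simps)
    define \<theta> where "\<theta> = ?S s / ?S r"
    have \<theta>: "1 - \<delta> = \<theta> * (1 - \<kappa>)"
      using \<open>(1 - \<delta>) * ?S r = ?S s * (1 - \<kappa>)\<close> Sp by (simp add: \<theta>_def field_simps)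
    have ms: "m s = V * (1 + u * (1 - \<theta>))" using Sp by (simp add: m_def \<theta>_def field_simps)
    have tS: "t (Suc s) = 1 + (m s - 1) * (1 - \<kappa>)" unfolding t_def Ss using Sp by simp
    \<comment> \<open>The first bracket vanishes by the choice of \<open>V\<close>, the second
      because \<open>1 - \<delta>\<close> and \<open>\<theta> * (1 - \<kappa>)\<close> are both
      \<open>?S (Suc s) / ?S r\<close>.\<close>
    have "t (Suc s) - (1 - u * \<kappa>) * m (Suc s) =
       \<kappa> * (1 - V + V * u\<^sup>2 * \<delta>) + V * u * ((1 - \<delta>) - \<theta> * (1 - \<kappa>))"
      unfolding tS ms mS by (simp add: algebra_simps power2_eq_square)
    also have "\<dots> = 0" unfolding \<theta> using V(3) by simp
    finally show ?thesis unfolding \<kappa> by simp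
  qed
  have "(\<integral>\<^sup>+\<omega>. ennreal (?\<alpha> ^ ups r (hist (\<lambda>n. X n \<omega>) n) * ?\<beta> ^ ups s (hist (\<lambda>n. X n \<omega>) n)) \<partial>M)
      \<le> ennreal (f 0)"
  proof (rule nn_integral_ups_le)
    show "0 < ?\<alpha>" "0 < ?\<beta>" "r \<noteq> s" using D u rs by (auto simp: add_pos_pos)
    show "1 \<le> f x" for x using V t_ge[of x] m_ge[of x] by (auto simp: f_def)
    have m_harm: "up_prob p x * m (Suc x) + (1 - up_prob p x) * m (x - 1) = m x" if "x \<ge> 1" for x
    proof -
      have "up_prob p x * m (Suc x) + (1 - up_prob p x) * m (x - 1)
        = V * (1 + u) - V * u / ?S r * (up_prob p x * ?S (Suc x) + (1 - up_prob p x) * ?S (x - 1))"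
        unfolding m_def using Sp by (simp add: field_simps)
      also have "\<dots> = m x" unfolding scale_tail_harmonic[OF that] m_def using Sp by (simp add: field_simps)
      finally show ?thesis .
    qed
    have t_harm: "up_prob p x * t (Suc x) + (1 - up_prob p x) * t (x - 1) = t x" if "x \<ge> 1" for x
    proof -
      have "up_prob p x * t (Suc x) + (1 - up_prob p x) * t (x - 1)
        = 1 + (m s - 1) / ?S s * (up_prob p x * ?S (Suc x) + (1 - up_prob p x) * ?S (x - 1))"
        unfolding t_def using Sp by (simp add: field_simps)
      also have "\<dots> = t x" unfolding scale_tail_harmonic[OF that] t_def by simp
      finally show ?thesis .
    qed
    fix x
    consider "x < r" | "x = r" | "r < x" "x < s" | "x = s" | "s < x" by linarith
    then show "up_prob p x * ((if x = r then ?\<alpha> else if x = s then ?\<beta> else 1) * f (Suc x))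
       + (1 - up_prob p x) * f (x - 1) \<le> f x"
    proof cases
      case 1
      then have "f (Suc x) = V" "f (x - 1) = V" "f x = V" by (auto simp: f_def)
      then show ?thesis using 1 rs by (simp add: algebra_simps)
    next
      case 2
      have "f (Suc r) = m (Suc r)" using rs by (intro f_mid) auto
      also have "\<dots> = V * (1 + u / D_val p r)"
        using scale_tail_Suc[of r] Sp rho_pos[of r] by (simp add: m_def D_val_def)
      finally have "?\<alpha> * f (Suc r) = V" using D u by (simp add: add_pos_pos less_imp_neq[symmetric])
      moreover have "f r = V" "f (r - 1) = V" by (auto simp: f_def)
      ultimately show ?thesis using 2 by (simp add: algebra_simps)
    next
      case 3
      then have "f (Suc x) = m (Suc x)" "f (x - 1) = m (x - 1)" "f x = m x" by (auto intro!: f_mid)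
      then show ?thesis using 3 m_harm[of x] by simp
    next
      case 4
      have "f (Suc s) = t (Suc s)" "f (s - 1) = m (s - 1)" "f s = m s" using rs by (auto intro!: f_mid f_tail)
      moreover have "?\<beta> * t (Suc s) = m (Suc s)" unfolding junction using D u by simp
      ultimately show ?thesis using 4 rs m_harm[of s] by simp
    next
      case 5
      then have "f (Suc x) = t (Suc x)" "f (x - 1) = t (x - 1)" "f x = t x" using rs by (auto intro!: f_tail)
      then show ?thesis using 5 rs t_harm[of x] by simp
    qed
  qed
  also have "\<dots> \<le> ennreal (4/3)" using V by (intro ennreal_leI) (simp add: f_def)
  finally show ?thesis .
qed

text \<open>As a limit of functions of finite histories this is measurable at once; where the limit
  fails to exist the value is arbitrary, but almost surely it is the number of upcrossings.\<close>

definition Z :: "nat \<Rightarrow> 'a \<Rightarrow> real" where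
  "Z r \<omega> = lim (\<lambda>n. real (ups r (hist (\<lambda>n. X n \<omega>) n)))"

lemma measurable_Z [measurable]: "Z r \<in> borel_measurable M"
  unfolding Z_def by measurable

text \<open>An exponential moment with base above 1 is bounded uniformly in \<open>n\<close>, so by
  monotone convergence the supremum over \<open>n\<close> is almost surely finite. The parameter
  \<open>1/2\<close> is an arbitrary choice from \<open>(0, 1)\<close>.\<close>

lemma AE_finite_upcrossings: "AE \<omega> in M. finite {k. X k \<omega> = r \<and> X (Suc k) \<omega> = Suc r}"
proof -
  define a where "a = 1 / (1 - (1/2) / D_val p r)"
  have a: "a > 1" using D_val_ge_1[of r] by (simp add: a_def field_simps)
  let ?u = "\<lambda>n \<omega>. ups r (hist (\<lambda>n. X n \<omega>) n)"
  have mono: "incseq (\<lambda>n \<omega>. ennreal (a ^ ?u n \<omega>))"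
  proof (rule incseq_SucI, rule le_funI)
    fix n \<omega>
    show "ennreal (a ^ ?u n \<omega>) \<le> ennreal (a ^ ?u (Suc n) \<omega>)"
      using a by (intro ennreal_leI power_increasing) (auto simp: ups_Cons)
  qed
  have "(\<integral>\<^sup>+\<omega>. (SUP n. ennreal (a ^ ?u n \<omega>)) \<partial>M) = (SUP n. \<integral>\<^sup>+\<omega>. ennreal (a ^ ?u n \<omega>) \<partial>M)"
    by (rule nn_integral_monotone_convergence_SUP[OF mono]) measurable
  also have "\<dots> \<le> ennreal (1 / (1 - 1/2))"
    unfolding a_def by (intro SUP_least nn_integral_ups_one) auto
  finally have "(\<integral>\<^sup>+\<omega>. (SUP n. ennreal (a ^ ?u n \<omega>)) \<partial>M) \<noteq> \<infinity>"
    by (metis ennreal_neq_top infinity_ennreal_def top.extremum_unique)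
  then have "AE \<omega> in M. (SUP n. ennreal (a ^ ?u n \<omega>)) \<noteq> \<infinity>"
    by (intro nn_integral_noteq_infinite) measurable
  then show ?thesis
  proof eventually_elim
    case (elim \<omega>)
    then obtain c where c: "c \<ge> 0" "(SUP n. ennreal (a ^ ?u n \<omega>)) = ennreal c"
      by (cases "SUP n. ennreal (a ^ ?u n \<omega>)") auto
    obtain b where b: "c < a ^ b" using real_arch_pow[OF a] by blast
    have "?u n \<omega> \<le> b" for n
    proof -
      have "ennreal (a ^ ?u n \<omega>) \<le> ennreal c" unfolding c(2)[symmetric] by (intro SUP_upper) auto
      then have "a ^ ?u n \<omega> < a ^ b" using c(1) b by simp
      then show ?thesis using a by (simp add: power_strict_increasing_iff)
    qed
    then show ?case by (intro finite_if_card_bounded_initial[of _ b]) (simp add: ups_hist)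
  qed
qed

lemma AE_ups_eventually_Z:
  "AE \<omega> in M. \<forall>r. Z r \<omega> = real (card {k. X k \<omega> = r \<and> X (Suc k) \<omega> = Suc r}) \<and>
     (\<forall>\<^sub>F n in sequentially. real (ups r (hist (\<lambda>n. X n \<omega>) n)) = Z r \<omega>)"
proof -
  have "AE \<omega> in M. \<forall>r. finite {k. X k \<omega> = r \<and> X (Suc k) \<omega> = Suc r}"
    using AE_finite_upcrossings by (simp add: AE_all_countable)
  then show ?thesis
  proof eventually_elim
    case (elim \<omega>)
    show ?case
    proof
      fix r
      let ?A = "{k. X k \<omega> = r \<and> X (Suc k) \<omega> = Suc r}"
      have ev: "\<forall>\<^sub>F n in sequentially. real (ups r (hist (\<lambda>n. X n \<omega>) n)) = real (card ?A)"
        using card_initial_eventually[of ?A] elim by (simp add: ups_hist)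
      then have "(\<lambda>n. real (ups r (hist (\<lambda>n. X n \<omega>) n))) \<longlonglongrightarrow> real (card ?A)"
        by (rule tendsto_eventually)
      then have "Z r \<omega> = real (card ?A)" unfolding Z_def by (rule limI)
      then show "Z r \<omega> = real (card ?A) \<and>
          (\<forall>\<^sub>F n in sequentially. real (ups r (hist (\<lambda>n. X n \<omega>) n)) = Z r \<omega>)" using ev by simp
    qed
  qed
qed

text \<open>One weight may lie below 1 and the other above, so the integrand need not be monotone in
  \<open>n\<close>; Fatou's lemma takes the place of monotone convergence.\<close>

lemma nn_integral_Z_le:
  assumes ab: "0 < \<alpha>" "0 < \<beta>"
    and le: "\<And>n. (\<integral>\<^sup>+\<omega>. ennreal (\<alpha> ^ ups r (hist (\<lambda>n. X n \<omega>) n) * \<beta> ^ ups s (hist (\<lambda>n. X n \<omega>) n)) \<partial>M) \<le> C"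
  shows "(\<integral>\<^sup>+\<omega>. ennreal (\<alpha> powr Z r \<omega> * \<beta> powr Z s \<omega>) \<partial>M) \<le> C"
proof -
  let ?g = "\<lambda>n \<omega>. ennreal (\<alpha> ^ ups r (hist (\<lambda>n. X n \<omega>) n) * \<beta> ^ ups s (hist (\<lambda>n. X n \<omega>) n))"
  have "AE \<omega> in M. ennreal (\<alpha> powr Z r \<omega> * \<beta> powr Z s \<omega>) = liminf (\<lambda>n. ?g n \<omega>)"
    using AE_ups_eventually_Z
  proof eventually_elim
    case (elim \<omega>)
    have "\<forall>\<^sub>F n in sequentially. ?g n \<omega> = ennreal (\<alpha> powr Z r \<omega> * \<beta> powr Z s \<omega>)"
      using elim[rule_format, THEN conjunct2, of r] elim[rule_format, THEN conjunct2, of s]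
    proof eventually_elim
      case (elim n)
      show ?case unfolding elim[symmetric] using ab by (simp add: powr_realpow)
    qed
    then have "(\<lambda>n. ?g n \<omega>) \<longlonglongrightarrow> ennreal (\<alpha> powr Z r \<omega> * \<beta> powr Z s \<omega>)"
      by (rule tendsto_eventually)
    then show ?case by (metis lim_imp_Liminf trivial_limit_sequentially)
  qed
  then have "(\<integral>\<^sup>+\<omega>. ennreal (\<alpha> powr Z r \<omega> * \<beta> powr Z s \<omega>) \<partial>M) = (\<integral>\<^sup>+\<omega>. liminf (\<lambda>n. ?g n \<omega>) \<partial>M)"
    by (rule nn_integral_cong_AE)
  also have "\<dots> \<le> liminf (\<lambda>n. \<integral>\<^sup>+\<omega>. ?g n \<omega> \<partial>M)" by (rule nn_integral_liminf) measurable
  also have "\<dots> \<le> C" using le by (intro Liminf_le) auto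
  finally show ?thesis .
qed

lemma prob_Z_ge:
  assumes v: "0 < v" "v < 1"
  shows "prob {\<omega> \<in> space M. Z r \<omega> / D_val p r \<ge> x} \<le> 1 / (1 - v) * exp (- (v * x))"
proof (rule prob_ge_le_exp)
  let ?a = "1 / (1 - v / D_val p r)"
  have D: "v / D_val p r < 1" "D_val p r > 0" using D_val_ge_1[of r] v by (auto simp: divide_simps)
  have pos: "?a > 0" using D by simp
  have "(\<integral>\<^sup>+\<omega>. ennreal (exp (v * (Z r \<omega> / D_val p r))) \<partial>M) \<le> (\<integral>\<^sup>+\<omega>. ennreal (?a powr Z r \<omega> * 1 powr Z r \<omega>) \<partial>M)"
  proof (rule nn_integral_mono_AE)
    show "AE \<omega> in M. ennreal (exp (v * (Z r \<omega> / D_val p r))) \<le> ennreal (?a powr Z r \<omega> * 1 powr Z r \<omega>)"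
      using AE_ups_eventually_Z
    proof eventually_elim
      case (elim \<omega>)
      have Z: "Z r \<omega> \<ge> 0" using elim by simp
      have "exp (v / D_val p r) \<le> ?a"
        using exp_ge_add_one_self[of "- (v / D_val p r)"] D by (simp add: exp_minus field_simps)
      then have "ln ?a \<ge> v / D_val p r" using pos by (simp add: ln_ge_iff)
      have "v \<noteq> D_val p r" using v D_val_ge_1[of r] by auto
      with mult_left_mono[OF \<open>ln ?a \<ge> v / D_val p r\<close> Z] show ?case using pos by (intro ennreal_leI) (simp add: powr_def mult.commute)
    qed
  qed
  also have "\<dots> \<le> ennreal (1 / (1 - v))"
    using pos nn_integral_ups_one[OF v, of r] by (intro nn_integral_Z_le) auto
  finally show "(\<integral>\<^sup>+\<omega>. ennreal (exp (v * (Z r \<omega> / D_val p r))) \<partial>M) \<le> ennreal (1 / (1 - v))" .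
qed (use v in auto)

text \<open>Since \<open>rho\<close> is nonincreasing, the scale mass between \<open>r\<close> and
  \<open>s\<close> is at most \<open>(s - r + 1) * rho p r\<close>, which turns the smallness
  condition on \<open>u\<close> into a comparison of the spacing with \<open>D_val p r\<close>. The
  inequalities \<open>ln (1 + x) \<le> x\<close> and \<open>1 - x \<le> exp (- x)\<close> both point
  the right way for replacing the two powers by one exponential.\<close>

lemma prob_Z_diff_ge:
  assumes rs: "r < s" and u: "0 < u" "u < D_val p s" and d: "4 * u\<^sup>2 * real (s - r + 1) \<le> D_val p r"
  shows "prob {\<omega> \<in> space M. Z s \<omega> / D_val p s - Z r \<omega> / D_val p r \<ge> x} \<le> 4/3 * exp (- (u * x))"
proof (rule prob_ge_le_exp)
  let ?a = "1 / (1 + u / D_val p r)" and ?b = "1 / (1 - u / D_val p s)"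
  have D: "u / D_val p s < 1" "D_val p r > 0" "D_val p s > 0" 
    using D_val_pos[of s] D_val_pos[of r] u by (auto simp: divide_simps)
  have pos: "?a > 0" "?b > 0" using D u by (auto simp: add_pos_pos)
  have "scale_tail p r - scale_tail p (Suc s) = (\<Sum>j=r..<Suc s. rho p j)"
    using scale_tail_split[of r "Suc s"] rs by simp
  also have "\<dots> \<le> (\<Sum>j=r..<Suc s. rho p r)" using rho_antimono by (intro sum_mono) auto
  also have "\<dots> = real (s - r + 1) * rho p r" using rs by (simp add: Suc_diff_le)
  finally have "u\<^sup>2 * (scale_tail p r - scale_tail p (Suc s)) \<le> u\<^sup>2 * (real (s - r + 1) * rho p r)"
    by (intro mult_left_mono) auto
  also have "\<dots> = (4 * u\<^sup>2 * real (s - r + 1)) * rho p r / 4" by simp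
  also have "\<dots> \<le> D_val p r * rho p r / 4"
    using d rho_pos[of r] by (intro divide_right_mono mult_right_mono) auto
  also have "\<dots> = scale_tail p r / 4" using rho_pos[of r] by (simp add: D_val_def less_imp_neq[symmetric])
  finally have d': "u\<^sup>2 * (scale_tail p r - scale_tail p (Suc s)) \<le> scale_tail p r / 4" .
  have "(\<integral>\<^sup>+\<omega>. ennreal (exp (u * (Z s \<omega> / D_val p s - Z r \<omega> / D_val p r))) \<partial>M)
     \<le> (\<integral>\<^sup>+\<omega>. ennreal (?a powr Z r \<omega> * ?b powr Z s \<omega>) \<partial>M)"
  proof (rule nn_integral_mono_AE)
    show "AE \<omega> in M. ennreal (exp (u * (Z s \<omega> / D_val p s - Z r \<omega> / D_val p r)))
        \<le> ennreal (?a powr Z r \<omega> * ?b powr Z s \<omega>)"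
      using AE_ups_eventually_Z
    proof eventually_elim
      case (elim \<omega>)
      have Z: "Z r \<omega> \<ge> 0" "Z s \<omega> \<ge> 0" using elim by auto
      have "exp (u / D_val p s) \<le> ?b"
        using exp_ge_add_one_self[of "- (u / D_val p s)"] D by (simp add: exp_minus field_simps)
      then have 1: "ln ?b \<ge> u / D_val p s" using pos by (simp add: ln_ge_iff)
      have "ln (1 + u / D_val p r) \<le> u / D_val p r" using D u by (intro ln_add_one_self_le_self) auto
      then have 2: "ln ?a \<ge> - (u / D_val p r)" using D u by (simp add: ln_div add_pos_pos)
      from mult_left_mono[OF 1 Z(2)] mult_left_mono[OF 2 Z(1)]
      have "u * (Z s \<omega> / D_val p s - Z r \<omega> / D_val p r) \<le> Z r \<omega> * ln ?a + Z s \<omega> * ln ?b"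
        by (simp add: algebra_simps)
      then show ?case using pos u by (intro ennreal_leI) (simp add: powr_def exp_add[symmetric])
    qed
  qed
  also have "\<dots> \<le> ennreal (4/3)"
    using pos nn_integral_ups_two[OF rs u d'] by (intro nn_integral_Z_le) auto
  finally show "(\<integral>\<^sup>+\<omega>. ennreal (exp (u * (Z s \<omega> / D_val p s - Z r \<omega> / D_val p r))) \<partial>M) \<le> ennreal (4/3)" .
qed (use u in auto)

end

subsection \<open>Many visits along sparse levels\<close>

text \<open>A path from 0 with unit steps cannot jump over a level.\<close>

lemma nn_path_below:
  assumes "nn_path h" "r \<notin> set h"
  shows "\<forall>x\<in>set h. x < r"
  using assms by (induction h rule: nn_path.induct) auto

text \<open>Classify visits to \<open>Suc r\<close> by the direction of entry. Entries from below
  number \<open>ups r h\<close>; entries from above match the upcrossings from \<open>Suc r\<close>,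
  except for one still open when the path ends above \<open>Suc r\<close>.\<close>

lemma count_list_ups:
  assumes "nn_path h"
  shows "count_list h (Suc r) + (if hd h > Suc r then 1 else 0) = ups (Suc r) h + ups r h"
  using assms by (induction h rule: nn_path.induct) (auto split: if_splits)

lemma count_list_0_ups:
  assumes "nn_path h"
  shows "count_list h 0 = ups 0 h + (if hd h = 0 then 1 else 0)"
  using assms by (induction h rule: nn_path.induct) auto

lemma count_list_hist: "count_list (hist w n) r = card {k. k < Suc n \<and> k \<in> {k. w k = r}}"
proof (induction n)
  case 0
  have "{k. k = 0 \<and> w k = r} = (if w 0 = r then {0} else {})" by auto
  then show ?case by simp
next
  case (Suc n)
  have "{k. k < Suc (Suc n) \<and> k \<in> {k. w k = r}} =
    (if w (Suc n) = r then insert (Suc n) else id) {k. k < Suc n \<and> k \<in> {k. w k = r}}"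
    by (auto simp: less_Suc_eq)
  then show ?case using Suc by simp
qed

primrec visits_before :: "nat \<Rightarrow> nat \<Rightarrow> nat list \<Rightarrow> nat" where
  "visits_before r r' [] = 0"
| "visits_before r r' (x # h) = visits_before r r' h + (if x = r \<and> r' \<notin> set h then 1 else 0)"

lemma visits_before_le: "visits_before r r' h \<le> count_list h r"
  by (induction h) auto

lemma visits_before_eq_0: "r \<notin> set h \<Longrightarrow> visits_before r r' h = 0"
  by (induction h) auto

text \<open>Gambler's ruin: for \<open>x \<le> r'\<close> this is the probability of reaching
  \<open>r'\<close> before \<open>r\<close>. It is 0 up to \<open>r\<close>, since from below the
  walk meets \<open>r\<close> first.\<close>

definition hit_prob :: "(nat \<Rightarrow> real) \<Rightarrow> nat \<Rightarrow> nat \<Rightarrow> nat \<Rightarrow> real" where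
  "hit_prob p r r' x =
     (if x \<le> r then 0 else (scale_tail p r - scale_tail p x) / (scale_tail p r - scale_tail p r'))"

text \<open>The probability, for a walk at \<open>r\<close>, of reaching \<open>r'\<close> before
  returning to \<open>r\<close>.\<close>

definition escape_prob :: "(nat \<Rightarrow> real) \<Rightarrow> nat \<Rightarrow> nat \<Rightarrow> real" where
  "escape_prob p r r' = up_prob p r * rho p r / (scale_tail p r - scale_tail p r')"

text \<open>The conditional probability, given the history, of visiting \<open>r\<close> at least \<open>\<nu>\<close> times
  before the first visit to \<open>r'\<close>.\<close>

definition success_prob :: "(nat \<Rightarrow> real) \<Rightarrow> nat \<Rightarrow> nat \<Rightarrow> nat \<Rightarrow> nat list \<Rightarrow> real" where
  "success_prob p r r' \<nu> h =
    (if \<nu> \<le> visits_before r r' h then 1 else if r' \<in> set h then 0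
     else (1 - (up_prob p (hd h) * hit_prob p r r' (Suc (hd h)) +
                (1 - up_prob p (hd h)) * hit_prob p r r' (hd h - 1))) *
       (1 - escape_prob p r r') ^ (\<nu> - visits_before r r' h - 1))"

context transient_drift
begin

context
  fixes r r' :: nat
  assumes rr': "r < r'"
begin

lemma scale_tail_diff_pos: "0 < scale_tail p r - scale_tail p r'"
  using scale_tail_strict_antimono[OF rr'] by simp

lemma hit_prob_bounds: "x \<le> r' \<Longrightarrow> 0 \<le> hit_prob p r r' x \<and> hit_prob p r r' x \<le> 1"
  using scale_tail_diff_pos scale_tail_antimono[of r x] scale_tail_antimono[of x r']
  by (auto simp: hit_prob_def divide_simps)

lemma hit_prob_target: "hit_prob p r r' r' = 1"
  using rr' scale_tail_diff_pos by (simp add: hit_prob_def)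

lemma escape_prob_eq: "escape_prob p r r' = up_prob p r * hit_prob p r r' (Suc r)"
  using scale_tail_Suc[of r] by (simp add: escape_prob_def hit_prob_def)

lemma escape_prob_bounds: "0 \<le> escape_prob p r r'" "escape_prob p r r' \<le> 1"
  using hit_prob_bounds[of "Suc r"] rr' up_prob_bounds[of r] unfolding escape_prob_eq
  by (auto intro!: mult_le_one)

lemma hit_prob_harmonic:
  assumes "x \<noteq> r"
  shows "up_prob p x * hit_prob p r r' (Suc x) + (1 - up_prob p x) * hit_prob p r r' (x - 1)
    = hit_prob p r r' x"
proof (cases "x < r")
  case True
  then have "x - 1 \<le> r" by simp
  then show ?thesis using True by (simp add: hit_prob_def)
next
  case False
  define c where "c = 1 / (scale_tail p r - scale_tail p r')"
  have *: "hit_prob p r r' y = c * (scale_tail p r - scale_tail p y)" if "y \<ge> r" for y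
    using that by (auto simp: hit_prob_def c_def)
  have x: "x \<ge> 1" "x \<ge> r" "x - 1 \<ge> r" using False assms by auto
  have "up_prob p x * hit_prob p r r' (Suc x) + (1 - up_prob p x) * hit_prob p r r' (x - 1)
    = c * scale_tail p r - c * (up_prob p x * scale_tail p (Suc x) + (1 - up_prob p x) * scale_tail p (x - 1))"
    using x by (simp add: * algebra_simps)
  then show ?thesis unfolding scale_tail_harmonic[OF x(1)] using x by (simp add: * algebra_simps)
qed

text \<open>In \<open>success_prob\<close> the hitting probability is averaged over the next step.
  Away from \<open>r\<close> this changes nothing by harmonicity; at \<open>r\<close> it gives the
  escape probability, as it must because the current visit has already been counted. One formula
  thus covers every successor of an undecided history.\<close>

lemma success_prob_Cons:
  assumes h: "nn_path h" "nn_path (y # h)" "r' \<notin> set h" and c: "visits_before r r' h < \<nu>"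
  shows "success_prob p r r' \<nu> (y # h) = (1 - hit_prob p r r' y) *
    (1 - escape_prob p r r') ^ (\<nu> - visits_before r r' h - 1)"
proof -
  let ?c = "visits_before r r' h" and ?q = "escape_prob p r r'"
  consider "y = r" "\<nu> = Suc ?c" | "y = r" "\<nu> > Suc ?c" | "y = r'" "y \<noteq> r" | "y \<noteq> r'" "y \<noteq> r"
    using c by linarith
  then show ?thesis
  proof cases
    case 1
    then show ?thesis using h by (simp add: success_prob_def hit_prob_def)
  next
    case 2
    then have "\<nu> - ?c - 1 = Suc (\<nu> - Suc ?c - 1)" by simp
    then have "(1 - ?q) ^ (\<nu> - ?c - 1) = (1 - ?q) * (1 - ?q) ^ (\<nu> - Suc ?c - 1)" by simp
    moreover have "hit_prob p r r' (r - 1) = 0" "hit_prob p r r' r = 0" by (auto simp: hit_prob_def)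
    ultimately show ?thesis using 2 h rr' by (simp add: success_prob_def escape_prob_eq)
  next
    case 3
    then show ?thesis using c hit_prob_target by (simp add: success_prob_def)
  next
    case 4
    then show ?thesis using c h hit_prob_harmonic[of y] by (simp add: success_prob_def)
  qed
qed

lemma success_prob_average:
  assumes h: "nn_path h" "r' \<notin> set h"
  shows "up_prob p (hd h) * success_prob p r r' \<nu> (Suc (hd h) # h)
    + (1 - up_prob p (hd h)) * success_prob p r r' \<nu> ((hd h - 1) # h) = success_prob p r r' \<nu> h"
proof (cases "visits_before r r' h < \<nu>")
  case False
  then show ?thesis by (simp add: success_prob_def)
next
  case True
  let ?x = "hd h" and ?e = "(1 - escape_prob p r r') ^ (\<nu> - visits_before r r' h - 1)"
  have ne: "h \<noteq> []" using h by auto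
  have up: "success_prob p r r' \<nu> (Suc ?x # h) = (1 - hit_prob p r r' (Suc ?x)) * ?e"
    using h ne True by (intro success_prob_Cons) (auto simp: nn_path_Cons)
  have dn: "(1 - up_prob p ?x) * success_prob p r r' \<nu> ((?x - 1) # h)
      = (1 - up_prob p ?x) * ((1 - hit_prob p r r' (?x - 1)) * ?e)"
  proof (cases "?x = 0")
    case True
    then show ?thesis by (simp add: up_prob_def)
  next
    case False
    then show ?thesis using h ne True by (subst success_prob_Cons) (auto simp: nn_path_Cons)
  qed
  show ?thesis unfolding up dn using True h by (simp add: success_prob_def algebra_simps)
qed

lemma success_prob_after: "r' \<in> set h \<Longrightarrow> success_prob p r r' \<nu> (y # h) = success_prob p r r' \<nu> h"
  by (simp add: success_prob_def)

text \<open>On its way from 0 to \<open>r'\<close> the walk has to pass \<open>r\<close>, so the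
  first visit is free and only \<open>\<nu> - 1\<close> returns have to succeed.\<close>

lemma success_prob_unvisited:
  assumes h: "nn_path h" "r \<notin> set h" and \<nu>: "\<nu> \<ge> 1"
  shows "success_prob p r r' \<nu> h = (1 - escape_prob p r r') ^ (\<nu> - 1)"
proof -
  have x: "hd h < r" "r' \<notin> set h" using nn_path_below[OF h] h rr' by (cases h; force)+
  then have "hd h - 1 \<le> r" by simp
  then show ?thesis using x h \<nu> by (simp add: success_prob_def visits_before_eq_0 hit_prob_def)
qed

lemma success_prob_before:
  assumes h: "nn_path h" "nn_path (y # h)" "r \<notin> set h" and \<nu>: "\<nu> \<ge> 1"
  shows "success_prob p r r' \<nu> (y # h) = success_prob p r r' \<nu> h"
proof -
  have ne: "h \<noteq> []" using h by auto
  have x: "hd h < r" "r' \<notin> set h" using nn_path_below[OF h(1,3)] h rr' ne by (cases h; force)+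
  have "y \<le> r" using h(2) ne x by (auto simp: nn_path_Cons)
  then have "success_prob p r r' \<nu> (y # h) = (1 - escape_prob p r r') ^ (\<nu> - 1)"
    using x h \<nu> by (subst success_prob_Cons) (auto simp: visits_before_eq_0 hit_prob_def)
  then show ?thesis using success_prob_unvisited[OF h(1,3) \<nu>] by simp
qed

lemma success_prob_bounds:
  assumes h: "nn_path h"
  shows "0 \<le> success_prob p r r' \<nu> h" "success_prob p r r' \<nu> h \<le> 1"
proof -
  let ?x = "hd h"
  have ne: "h \<noteq> []" using h by auto
  let ?a = "up_prob p ?x * hit_prob p r r' (Suc ?x) + (1 - up_prob p ?x) * hit_prob p r r' (?x - 1)"
  let ?e = "(1 - escape_prob p r r') ^ (\<nu> - visits_before r r' h - 1)"
  have e: "0 \<le> ?e" "?e \<le> 1" using escape_prob_bounds by (auto intro!: power_le_one)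
  have a: "0 \<le> ?a \<and> ?a \<le> 1" if "r' \<notin> set h"
  proof -
    have "?x < r'" using nn_path_below[OF h that] ne by simp
    then have b: "0 \<le> hit_prob p r r' (Suc ?x)" "hit_prob p r r' (Suc ?x) \<le> 1"
       "0 \<le> hit_prob p r r' (?x - 1)" "hit_prob p r r' (?x - 1) \<le> 1" using hit_prob_bounds by auto
    have u: "0 \<le> up_prob p ?x" "0 \<le> 1 - up_prob p ?x" using up_prob_bounds[of ?x] by auto
    show ?thesis using mult_left_mono[OF b(2) u(1)] mult_left_mono[OF b(4) u(2)] b(1,3) u by simp
  qed
  show "0 \<le> success_prob p r r' \<nu> h" unfolding success_prob_def using a e by auto
  show "success_prob p r r' \<nu> h \<le> 1" unfolding success_prob_def using a e by (auto intro!: mult_le_one)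
qed

end

end

section \<open>Transience and a substitute for the second Borel-Cantelli lemma\<close>

context transient_nn_walk
begin

lemma AE_all_nn_path: "AE \<omega> in M. \<forall>n. nn_path (hist (\<lambda>n. X n \<omega>) n)"
  using AE_nn_path by (simp add: AE_all_countable)

lemma AE_finite_visits:
  "AE \<omega> in M. \<forall>r. finite {k. X k \<omega> = r} \<and> real (card {k. X k \<omega> = Suc r}) \<le> Z (Suc r) \<omega> + Z r \<omega>"
proof -
  have "AE \<omega> in M. \<forall>r. finite {k. X k \<omega> = r \<and> X (Suc k) \<omega> = Suc r}"
    using AE_finite_upcrossings by (simp add: AE_all_countable)
  with AE_all_nn_path AE_ups_eventually_Z show ?thesis
  proof eventually_elim
    case (elim \<omega>)
    let ?h = "hist (\<lambda>n. X n \<omega>)"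
    have fin: "finite {k. X k \<omega> = r \<and> X (Suc k) \<omega> = Suc r}" for r using elim(3) by blast
    have ups_le: "ups r (?h n) \<le> card {k. X k \<omega> = r \<and> X (Suc k) \<omega> = Suc r}" for r n
      unfolding ups_hist by (intro card_mono fin) auto
    have Suc_le: "count_list (?h n) (Suc r) \<le> card {k. X k \<omega> = Suc r \<and> X (Suc k) \<omega> = Suc (Suc r)}
         + card {k. X k \<omega> = r \<and> X (Suc k) \<omega> = Suc r}" for r n
      using count_list_ups[of "?h n" r] elim(1) ups_le[of "Suc r" n] ups_le[of r n] by auto
    have 0: "count_list (?h n) 0 \<le> card {k. X k \<omega> = 0 \<and> X (Suc k) \<omega> = Suc 0} + 1" for n
      using count_list_0_ups[of "?h n"] elim(1) ups_le[of 0 n] by auto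
    have bd: "\<exists>b. \<forall>n. card {k. k < n \<and> k \<in> {k. X k \<omega> = r}} \<le> b" for r
    proof -
      obtain b where b: "\<And>n. count_list (?h n) r \<le> b" using Suc_le 0 by (cases r) blast+
      have "card {k. k < n \<and> k \<in> {k. X k \<omega> = r}} \<le> b" for n
        using b[of "n - 1"] by (cases n) (auto simp: count_list_hist)
      then show ?thesis by blast
    qed
    have fv: "finite {k. X k \<omega> = r}" for r using bd[of r] finite_if_card_bounded_initial by blast
    show ?case
    proof (intro allI conjI fv)
      fix r
      obtain n where n: "card {k. k < n \<and> k \<in> {k. X k \<omega> = Suc r}} = card {k. X k \<omega> = Suc r}" "n > 0"
        using eventually_happens[OF eventually_conj[OF card_initial_eventually[OF fv[of "Suc r"]] eventually_gt_at_top[of 0]]]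
        by auto
      then have "card {k. X k \<omega> = Suc r} = count_list (?h (n - 1)) (Suc r)" by (simp add: count_list_hist)
      also note Suc_le[of "n - 1" r]
      finally have "real (card {k. X k \<omega> = Suc r}) \<le> real (card {k. X k \<omega> = Suc r \<and> X (Suc k) \<omega> = Suc (Suc r)}
         + card {k. X k \<omega> = r \<and> X (Suc k) \<omega> = Suc r})" by (simp only: of_nat_le_iff)
      then show "real (card {k. X k \<omega> = Suc r}) \<le> Z (Suc r) \<omega> + Z r \<omega>" using elim(2) by simp
    qed
  qed
qed

text \<open>A path avoiding \<open>r\<close> stays below it, hence spends infinite time in a finite
  set, although each level is visited only finitely often.\<close>

lemma AE_hits: "AE \<omega> in M. \<forall>r. \<exists>n. X n \<omega> = r"
  using AE_all_nn_path AE_finite_visits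
proof eventually_elim
  case (elim \<omega>)
  show ?case
  proof (rule allI, rule ccontr)
    fix r assume no: "\<not> (\<exists>n. X n \<omega> = r)"
    have "X n \<omega> < r" for n
      using nn_path_below[of "hist (\<lambda>n. X n \<omega>) n" r] elim(1) no by (auto simp: set_hist)
    then have "(UNIV :: nat set) \<subseteq> (\<Union>i<r. {k. X k \<omega> = i})" by auto
    moreover have "finite (\<Union>i<r. {k. X k \<omega> = i})" using elim(2) by simp
    ultimately show False using finite_subset infinite_UNIV_nat by blast
  qed
qed

text \<open>Independence of the stages enters as disjointness in time: stage \<open>k\<close> runs
  from the first visit to \<open>R k\<close> until the first visit to \<open>R (Suc k)\<close>, and
  the factors of all other stages stand still meanwhile.\<close>

lemma nn_integral_all_fail:
  assumes R: "strict_mono R" "\<And>k. 0 < R k" and \<nu>: "\<And>k. 1 \<le> \<nu> k"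
  shows "(\<integral>\<^sup>+\<omega>. ennreal (\<Prod>k=m..<N. 1 - success_prob p (R k) (R (Suc k)) (\<nu> k) (hist (\<lambda>n. X n \<omega>) n)) \<partial>M)
    \<le> ennreal (\<Prod>k=m..<N. 1 - (1 - escape_prob p (R k) (R (Suc k))) ^ (\<nu> k - 1))"
proof -
  define v where "v k h = 1 - success_prob p (R k) (R (Suc k)) (\<nu> k) h" for k h
  have RS: "R k < R (Suc k)" for k using R(1) by (simp add: strict_mono_Suc_iff)
  have v0: "0 \<le> v k h" if "nn_path h" for k h
    using success_prob_bounds(2)[OF RS that] by (simp add: v_def)
  have frozen: "v k (y # h) = v k h"
    if "nn_path h" "nn_path (y # h)" "R k \<notin> set h \<or> R (Suc k) \<in> set h" for k y h
    using that success_prob_before[OF RS that(1,2) _ \<nu>] success_prob_after[OF RS]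
    by (auto simp: v_def)
  have "(\<integral>\<^sup>+\<omega>. ennreal (\<Prod>k=m..<N. v k (hist (\<lambda>n. X n \<omega>) n)) \<partial>M) \<le> ennreal (\<Prod>k=m..<N. v k [0])"
  proof (rule nn_integral_supermartingale)
    fix h assume h: "nn_path h"
    have ne: "h \<noteq> []" using h by auto
    let ?x = "hd h"
    show "0 \<le> (\<Prod>k=m..<N. v k h)" using v0[OF h] by (simp add: prod_nonneg)
    have up: "nn_path (Suc ?x # h)" using h ne by (simp add: nn_path_Cons)
    have dn: "?x = 0 \<or> nn_path ((?x - 1) # h)" using h ne by (cases "?x = 0") (auto simp: nn_path_Cons)
    have up1: "?x = 0 \<Longrightarrow> up_prob p ?x = 1" by (simp add: up_prob_def)
    show "up_prob p ?x * (\<Prod>k=m..<N. v k (Suc ?x # h)) + (1 - up_prob p ?x) * (\<Prod>k=m..<N. v k ((?x - 1) # h))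
       \<le> (\<Prod>k=m..<N. v k h)"
    proof (cases "\<exists>k\<in>{m..<N}. R k \<in> set h \<and> R (Suc k) \<notin> set h")
      case False
      then have *: "v k (y # h) = v k h" if "k \<in> {m..<N}" "nn_path (y # h)" for k y
        using frozen[OF h that(2)] that by blast
      have "(\<Prod>k=m..<N. v k (Suc ?x # h)) = (\<Prod>k=m..<N. v k h)" using * up by (intro prod.cong) auto
      moreover have "(1 - up_prob p ?x) * (\<Prod>k=m..<N. v k ((?x - 1) # h)) = (1 - up_prob p ?x) * (\<Prod>k=m..<N. v k h)"
        using dn up1 * by (auto intro!: prod.cong)
      ultimately show ?thesis by (simp add: algebra_simps)
    next
      case True
      \<comment> \<open>Only the factor of the stage in progress changes in one step.\<close>
      then obtain k where k: "k \<in> {m..<N}" "R k \<in> set h" "R (Suc k) \<notin> set h" by blast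
      \<comment> \<open>Two stages in progress at once would mean that a level was reached while a
        level not above it had never been visited.\<close>
      have other: "R k' \<notin> set h \<or> R (Suc k') \<in> set h" if "k' \<noteq> k" for k'
      proof (rule ccontr)
        assume *: "\<not> (R k' \<notin> set h \<or> R (Suc k') \<in> set h)"
        have imp: False if "i < j" "R j \<in> set h" "R (Suc i) \<notin> set h" for i j
        proof -
          have "R j < R (Suc i)" using nn_path_below[OF h that(3)] that(2) by blast
          moreover have "R (Suc i) \<le> R j" using that(1) R(1) by (simp add: strict_mono_less_eq)
          ultimately show False by simp
        qed
        show False using imp[of k k'] imp[of k' k] k * that by (cases "k < k'") auto
      qed
      have split: "(\<Prod>k=m..<N. v k h') = v k h' * (\<Prod>k\<in>{m..<N} - {k}. v k h')" for h'
        using k(1) by (intro prod.remove) auto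
      have rest: "(\<Prod>k\<in>{m..<N} - {k}. v k (y # h)) = (\<Prod>k\<in>{m..<N} - {k}. v k h)" if "nn_path (y # h)" for y
        using other frozen[OF h that] by (intro prod.cong) auto
      let ?P = "\<Prod>k\<in>{m..<N} - {k}. v k h"
      have a: "(\<Prod>k=m..<N. v k (Suc ?x # h)) = v k (Suc ?x # h) * ?P" using split rest[OF up] by simp
      have b: "(1 - up_prob p ?x) * (\<Prod>k=m..<N. v k ((?x - 1) # h)) = (1 - up_prob p ?x) * (v k ((?x - 1) # h) * ?P)"
        using dn up1 split rest by auto
      have avg: "up_prob p ?x * v k (Suc ?x # h) + (1 - up_prob p ?x) * v k ((?x - 1) # h) = v k h"
        using success_prob_average[OF RS h k(3), of "\<nu> k"] by (simp add: v_def algebra_simps)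
      have "up_prob p ?x * (\<Prod>k=m..<N. v k (Suc ?x # h)) + (1 - up_prob p ?x) * (\<Prod>k=m..<N. v k ((?x - 1) # h))
        = (up_prob p ?x * v k (Suc ?x # h) + (1 - up_prob p ?x) * v k ((?x - 1) # h)) * ?P"
        unfolding a b by (simp add: algebra_simps)
      also have "\<dots> = (\<Prod>k=m..<N. v k h)" unfolding avg split[of h] ..
      finally show ?thesis by simp
    qed
  qed
  also have "(\<Prod>k=m..<N. v k [0]) = (\<Prod>k=m..<N. 1 - (1 - escape_prob p (R k) (R (Suc k))) ^ (\<nu> k - 1))"
  proof (rule prod.cong)
    fix k
    show "v k [0] = 1 - (1 - escape_prob p (R k) (R (Suc k))) ^ (\<nu> k - 1)"
      using success_prob_unvisited[OF RS _ _ \<nu>, of "[0]" k k] R(2)[of k] by (simp add: v_def)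
  qed simp
  finally show ?thesis by (simp add: v_def)
qed

lemma AE_infinitely_often_many_visits:
  assumes R: "strict_mono R" "\<And>k. 0 < R k" and \<nu>: "\<And>k. 1 \<le> \<nu> k"
    and div: "\<not> summable (\<lambda>k. (1 - escape_prob p (R k) (R (Suc k))) ^ (\<nu> k - 1))"
  shows "AE \<omega> in M. \<forall>m. \<exists>k\<ge>m. \<nu> k \<le> card {n. X n \<omega> = R k}"
proof -
  define P where "P k = (1 - escape_prob p (R k) (R (Suc k))) ^ (\<nu> k - 1)" for k
  have RS: "R k < R (Suc k)" for k using R(1) by (simp add: strict_mono_Suc_iff)
  have P01: "0 \<le> P k" "P k \<le> 1" for k
    using escape_prob_bounds[OF RS] by (auto simp: P_def intro!: power_le_one)
  \<comment> \<open>\<open>F m\<close> restricts all visits to \<open>R k\<close>, not just those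
    before \<open>R (Suc k)\<close>, so it forces every stage from \<open>m\<close> on to
    fail.\<close>
  define F where "F m = {\<omega> \<in> space M. \<forall>k\<ge>m. \<forall>n. count_list (hist (\<lambda>n. X n \<omega>) n) (R k) < \<nu> k}" for m
  have F_sets [measurable]: "F m \<in> sets M" for m unfolding F_def by measurable
  have F_le: "emeasure M (F m) \<le> ennreal (\<Prod>k=m..<N. 1 - P k)" for m N
  proof -
    let ?g = "\<lambda>n \<omega>. \<Prod>k=m..<N. 1 - success_prob p (R k) (R (Suc k)) (\<nu> k) (hist (\<lambda>n. X n \<omega>) n)"
    have "AE \<omega> in M. indicator (F m) \<omega> \<le> liminf (\<lambda>n. ennreal (?g n \<omega>))"
      using AE_hits
    proof eventually_elim
      case (elim \<omega>)
      show ?case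
      proof (cases "\<omega> \<in> F m")
        \<comment> \<open>Once every \<open>R (Suc k)\<close> with \<open>k < N\<close> has been
          visited, the stages in question are over; on \<open>F m\<close> they all failed, so each
          factor is exactly 1.\<close>
        case True
        have "\<forall>\<^sub>F n in sequentially. ennreal (?g n \<omega>) = 1"
          using eventually_ge_at_top[of "Max ((\<lambda>k. LEAST n. X n \<omega> = R (Suc k)) ` {..N})"]
        proof eventually_elim
          case (elim n)
          have "1 - success_prob p (R k) (R (Suc k)) (\<nu> k) (hist (\<lambda>n. X n \<omega>) n) = 1" if "k \<in> {m..<N}" for k
          proof -
            have "(LEAST n. X n \<omega> = R (Suc k)) \<le> n" using elim that by simp
            moreover have "X (LEAST n. X n \<omega> = R (Suc k)) \<omega> = R (Suc k)"
              using \<open>\<forall>r. \<exists>n. X n \<omega> = r\<close> by (meson LeastI_ex)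
            ultimately have "R (Suc k) \<in> set (hist (\<lambda>n. X n \<omega>) n)" unfolding set_hist by force
            moreover have "visits_before (R k) (R (Suc k)) (hist (\<lambda>n. X n \<omega>) n) < \<nu> k"
              using True that visits_before_le[of "R k" "R (Suc k)" "hist (\<lambda>n. X n \<omega>) n"]
              unfolding F_def by (fastforce intro: le_less_trans)
            ultimately show ?thesis by (simp add: success_prob_def)
          qed
          then have "?g n \<omega> = 1" by (intro prod.neutral) auto
          then show ?case by simp
        qed
        then have "(\<lambda>n. ennreal (?g n \<omega>)) \<longlonglongrightarrow> 1" by (rule tendsto_eventually)
        then have "liminf (\<lambda>n. ennreal (?g n \<omega>)) = 1" by (intro lim_imp_Liminf) auto
        then show ?thesis by (simp add: indicator_def)
      qed (simp add: indicator_def)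
    qed
    then have "(\<integral>\<^sup>+\<omega>. indicator (F m) \<omega> \<partial>M) \<le> (\<integral>\<^sup>+\<omega>. liminf (\<lambda>n. ennreal (?g n \<omega>)) \<partial>M)"
      by (rule nn_integral_mono_AE)
    also have "\<dots> \<le> liminf (\<lambda>n. \<integral>\<^sup>+\<omega>. ennreal (?g n \<omega>) \<partial>M)" by (rule nn_integral_liminf) measurable
    also have "\<dots> \<le> ennreal (\<Prod>k=m..<N. 1 - P k)"
      using nn_integral_all_fail[OF R \<nu>] unfolding P_def by (intro Liminf_le) auto
    finally show ?thesis by simp
  qed
  have "emeasure M (F m) = 0" for m
  proof -
    have "\<not> summable P" using div by (simp add: P_def[abs_def])
    then have "\<not> summable (\<lambda>j. P (j + m))" by (simp only: summable_iff_shift not_False_eq_True)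
    have unb: "\<exists>N. (\<Sum>k=m..<N. P k) > b" for b
    proof (rule ccontr)
      assume "\<not> ?thesis"
      then have le: "(\<Sum>k=m..<N. P k) \<le> b" for N by (auto simp: not_less)
      have "summable (\<lambda>j. P (j + m))"
      proof (rule bounded_imp_summable)
        fix n
        have "(\<Sum>j\<le>n. P (j + m)) = (\<Sum>k=m..<Suc n + m. P k)"
          using sum.shift_bounds_nat_ivl[of P 0 m "Suc n"]
          by (simp add: atLeast0LessThan lessThan_Suc_atMost)
        then show "(\<Sum>j\<le>n. P (j + m)) \<le> b" by (simp only: le)
      qed (rule P01)
      then show False using \<open>\<not> summable (\<lambda>j. P (j + m))\<close> by simp
    qed
    have "measure M (F m) \<le> exp (- b)" for b
    proof -
      obtain N where N: "(\<Sum>k=m..<N. P k) > b" using unb by blast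
      have "(\<Prod>k=m..<N. 1 - P k) \<le> (\<Prod>k=m..<N. exp (- P k))"
        using P01 exp_ge_add_one_self[of "- P _"] by (intro prod_mono) auto
      also have "\<dots> = exp (- (\<Sum>k=m..<N. P k))" by (simp add: exp_sum sum_negf[symmetric])
      also have "\<dots> \<le> exp (- b)" using N by simp
      finally have "(\<Prod>k=m..<N. 1 - P k) \<le> exp (- b)" .
      moreover have "measure M (F m) \<le> (\<Prod>k=m..<N. 1 - P k)"
        using F_le[of m N] P01 by (simp add: emeasure_eq_measure prod_nonneg)
      ultimately show ?thesis by simp
    qed
    then have lim: "measure M (F m) \<le> 0"
    proof -
      have "((\<lambda>b. exp (- b)) \<longlongrightarrow> (0::real)) at_top"
        by (rule filterlim_compose[OF exp_at_bot filterlim_uminus_at_bot_at_top])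
      then show ?thesis using \<open>\<And>b. measure M (F m) \<le> exp (- b)\<close>
        by (intro tendsto_le[OF _ _ tendsto_const[of "measure M (F m)"]]) auto
    qed
    then show ?thesis by (simp add: emeasure_eq_measure measure_le_0_iff)
  qed
  then have "AE \<omega> in M. \<omega> \<notin> F m" for m by (intro AE_not_in) (auto simp: null_sets_def)
  then have "AE \<omega> in M. \<forall>m. \<omega> \<notin> F m" by (simp add: AE_all_countable)
  then show ?thesis using AE_finite_visits AE_space
  proof eventually_elim
    case (elim \<omega>)
    show ?case
    proof
      fix m
      obtain k n where k: "k \<ge> m" "\<nu> k \<le> count_list (hist (\<lambda>n. X n \<omega>) n) (R k)"
        using elim(1)[rule_format, of m] elim(3) unfolding F_def by (auto simp: not_less)
      have "count_list (hist (\<lambda>n. X n \<omega>) n) (R k) \<le> card {n. X n \<omega> = R k}"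
        unfolding count_list_hist using elim(2) by (intro card_mono) auto
      then show "\<exists>k\<ge>m. \<nu> k \<le> card {n. X n \<omega> = R k}" using k by (intro exI[of _ k]) auto
    qed
  qed
qed

end

subsection \<open>Chaining\<close>

text \<open>A point of dyadic level \<open>L + 1\<close> either belongs to level \<open>L\<close> or
  lies one step of the finer grid to the right of such a point. So at most one increment per level
  is used, always to the right, and one-sided bounds suffice.\<close>

lemma chaining_bound:
  fixes y x :: "nat \<Rightarrow> real"
  assumes incr: "\<And>l k. l \<le> N \<Longrightarrow> k < 2 ^ l \<Longrightarrow> y (A + Suc k * 2 ^ (N - l)) - y (A + k * 2 ^ (N - l)) \<le> x l"
    and nonneg: "\<And>l. 0 \<le> x l" and i: "i \<le> 2 ^ N"
  shows "y (A + i) \<le> y A + (\<Sum>l\<le>N. x l)"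
proof -
  have "y (A + k * 2 ^ (N - L)) \<le> y A + (\<Sum>l\<le>L. x l)" if "L \<le> N" "k \<le> 2 ^ L" for L k
    using that
  proof (induction L arbitrary: k)
    case 0
    then have "k = 0 \<or> k = 1" by auto
    then show ?case using incr[of 0 0] nonneg[of 0] by auto
  next
    case (Suc L)
    have pw: "2 ^ (N - L) = 2 * (2::nat) ^ (N - Suc L)"
      using Suc.prems(1) by (simp flip: power_Suc add: Suc_diff_Suc)
    have even: "y (A + (2 * k') * 2 ^ (N - Suc L)) \<le> y A + (\<Sum>l\<le>L. x l)" if "k' \<le> 2 ^ L" for k'
      using Suc.IH[of k'] Suc.prems(1) that pw by (simp add: mult.assoc mult.left_commute)
    show ?case
    proof (cases "even k")
      case True
      then obtain k' where "k = 2 * k'" by blast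
      then show ?thesis using even[of k'] Suc.prems nonneg[of "Suc L"] by simp
    next
      case False
      then obtain k' where k': "k = Suc (2 * k')" by (metis oddE Suc_eq_plus1)
      then have "y (A + k * 2 ^ (N - Suc L)) - y (A + (2 * k') * 2 ^ (N - Suc L)) \<le> x (Suc L)"
        using incr[of "Suc L" "2 * k'"] Suc.prems by simp
      then show ?thesis using even[of k'] Suc.prems k' by simp
    qed
  qed
  from this[of N i] i show ?thesis by simp
qed

context transient_nn_walk
begin

text \<open>Level \<open>l\<close> of the chain gets the threshold \<open>h * t * (3/4) ^ l\<close>,
  and these sum to at most \<open>4 * h * t\<close>. Its \<open>2 ^ l\<close> increments each exceed
  the threshold with probability at most \<open>4/3 * exp (- (2 * t)) * (1/4) ^ l\<close>; summing
  \<open>(1/2) ^ l\<close> over the levels turns \<open>4/3\<close> into \<open>8/3\<close>.\<close>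

lemma prob_block_le:
  assumes D: "\<And>r. A \<le> r \<Longrightarrow> r \<le> A + 2 ^ N \<Longrightarrow> b * 2 ^ N \<le> D_val p r"
    and G: "1 \<le> G" "8 * G\<^sup>2 \<le> b" and h: "0 < h" "40 \<le> G * h" and t: "1 \<le> t"
  shows "prob {\<omega> \<in> space M. \<exists>i\<le>2 ^ N. Z (A + i) \<omega> / D_val p (A + i) \<ge> x + 4 * h * t}
    \<le> prob {\<omega> \<in> space M. Z A \<omega> / D_val p A \<ge> x} + 8 / 3 * exp (- (2 * t))"
proof -
  define Y where "Y r \<omega> = Z r \<omega> / D_val p r" for r \<omega>
  have [measurable]: "Y r \<in> borel_measurable M" for r unfolding Y_def by measurable
  define E where "E l k = {\<omega> \<in> space M. Y (A + Suc k * 2 ^ (N - l)) \<omega> - Y (A + k * 2 ^ (N - l)) \<omega> \<ge> h * t * (3/4) ^ l}" for l k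
  have [measurable]: "E l k \<in> sets M" for l k unfolding E_def by measurable
  have b0: "0 \<le> b" using G order_trans[of 0 "8 * G\<^sup>2" b] by simp
  have geo: "(\<Sum>l\<le>n. q ^ l) < 1 / (1 - q)" if "0 < q" "q < (1::real)" for q n
  proof -
    have "(\<Sum>l\<le>n. q ^ l) = (1 - q ^ Suc n) / (1 - q)"
      using that sum_gp0[of q n] by simp
    also have "\<dots> < 1 / (1 - q)" using that by (intro divide_strict_right_mono) auto
    finally show ?thesis .
  qed
  have sub: "{\<omega> \<in> space M. \<exists>i\<le>2 ^ N. Y (A + i) \<omega> \<ge> x + 4 * h * t}
     \<subseteq> {\<omega> \<in> space M. Y A \<omega> \<ge> x} \<union> (\<Union>l\<le>N. \<Union>k<2 ^ l. E l k)"
  proof (rule subsetI, rule ccontr)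
    fix \<omega> assume w: "\<omega> \<in> {\<omega> \<in> space M. \<exists>i\<le>2 ^ N. Y (A + i) \<omega> \<ge> x + 4 * h * t}"
      "\<omega> \<notin> {\<omega> \<in> space M. Y A \<omega> \<ge> x} \<union> (\<Union>l\<le>N. \<Union>k<2 ^ l. E l k)"
    then obtain i where i: "i \<le> 2 ^ N" "Y (A + i) \<omega> \<ge> x + 4 * h * t" and sp: "\<omega> \<in> space M" by auto
    have "Y (A + i) \<omega> \<le> Y A \<omega> + (\<Sum>l\<le>N. h * t * (3/4) ^ l)"
    proof (rule chaining_bound[OF _ _ i(1)])
      show "Y (A + Suc k * 2 ^ (N - l)) \<omega> - Y (A + k * 2 ^ (N - l)) \<omega> \<le> h * t * (3/4) ^ l"
        if "l \<le> N" "k < 2 ^ l" for l k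
      proof -
        have "\<omega> \<notin> E l k" using w that by auto
        then show ?thesis using sp unfolding E_def by simp
      qed
      show "0 \<le> h * t * (3/4) ^ l" for l using h t by simp
    qed
    also have "(\<Sum>l\<le>N. h * t * (3/4) ^ l) = h * t * (\<Sum>l\<le>N. (3/4) ^ l)" by (simp add: sum_distrib_left)
    also have "\<dots> \<le> h * t * 4"
      using geo[of "3/4" N] h t by (intro mult_left_mono) auto
    finally have "Y (A + i) \<omega> \<le> Y A \<omega> + 4 * h * t" by simp
    moreover have "Y A \<omega> < x" using w sp by auto
    ultimately show False using i(2) by simp
  qed
  have E_le: "prob (E l k) \<le> 4/3 * (exp (- (2 * t)) * (1/4) ^ l)" if lk: "l \<le> N" "k < 2 ^ l" for l k
  proof -
    \<comment> \<open>\<open>(7/5)\<^sup>2 \<le> 2\<close> makes \<open>u\<close> admissible at spacing \<open>2 ^ (N - l)\<close>, while \<open>(7/5) * (3/4) > 1\<close> makes the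
      tails decay in \<open>l\<close>.\<close>
    define u where "u = G * (7/5) ^ l"
    let ?r = "A + k * 2 ^ (N - l)" and ?s = "A + Suc k * 2 ^ (N - l)"
    have pN: "(2::nat) ^ l * 2 ^ (N - l) = 2 ^ N" using lk by (simp flip: power_add)
    have sN: "Suc k * 2 ^ (N - l) \<le> (2::nat) ^ N"
      unfolding pN[symmetric] using lk by (intro mult_right_mono) auto
    have Dr: "b * 2 ^ N \<le> D_val p ?r" and Ds: "b * 2 ^ N \<le> D_val p ?s"
      using sN by (auto intro!: D)
    have pNr: "(2::real) ^ l * 2 ^ (N - l) = 2 ^ N" using lk by (simp flip: power_add)
    have u0: "0 < u" using G by (simp add: u_def)
    have "u \<le> G * 2 ^ N"
    proof -
      have "(7/5::real) ^ l \<le> 2 ^ l" by (intro power_mono) auto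
      also have "\<dots> \<le> 2 ^ N" using lk by (intro power_increasing) auto
      finally show ?thesis unfolding u_def using G by (intro mult_left_mono) auto
    qed
    also have "G * 2 ^ N < 8 * G\<^sup>2 * 2 ^ N" using G by (simp add: power2_eq_square)
    also have "\<dots> \<le> b * 2 ^ N" using G by (intro mult_right_mono) auto
    also note Ds
    finally have us: "u < D_val p ?s" .
    have d: "4 * u\<^sup>2 * real (?s - ?r + 1) \<le> D_val p ?r"
    proof -
      \<comment> \<open>The spacing is at least 1, so the extra 1 at most doubles it; with the
        factor 4 of the increment bound this is the 8 in \<open>8 * G^2 \<le> b\<close>.\<close>
      have "real (?s - ?r + 1) \<le> 2 * 2 ^ (N - l)" by simp
      then have "4 * u\<^sup>2 * real (?s - ?r + 1) \<le> 4 * u\<^sup>2 * (2 * 2 ^ (N - l))" by (intro mult_left_mono) auto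
      also have "\<dots> = 8 * G\<^sup>2 * ((49/25) ^ l * 2 ^ (N - l))"
        by (simp add: u_def power_mult_distrib power_divide flip: power_mult)
           (simp add: mult.commute[of l] power_mult)
      also have "\<dots> \<le> b * (2 ^ l * 2 ^ (N - l))"
        using G b0 by (intro mult_mono power_mono) auto
      also have "\<dots> \<le> D_val p ?r" using Dr pNr by simp
      finally show ?thesis .
    qed
    have rs: "?r < ?s" by simp
    have "prob (E l k) \<le> 4/3 * exp (- (u * (h * t * (3/4) ^ l)))"
      using prob_Z_diff_ge[OF rs u0 us d] unfolding E_def Y_def by simp
    also have "\<dots> \<le> 4/3 * (exp (- (2 * t)) * (1/4) ^ l)"
    proof -
      \<comment> \<open>\<open>(7/5) * (3/4) = 21/20\<close>, and \<open>40 * (1/20) = 2\<close>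
        leaves the term \<open>2 * t * l\<close> in the exponent; by
        \<open>exp (- 2) \<le> 1/4\<close> it outweighs the number \<open>2 ^ l\<close> of
        increments.\<close>
      have bern: "1 + real l * (1/20) \<le> (21/20) ^ l"
        using Bernoulli_inequality[of "1/20" l] by simp
      have "u * (h * t * (3/4) ^ l) = G * h * t * (21/20) ^ l"
        by (simp add: u_def field_simps flip: power_mult_distrib)
      also have "\<dots> \<ge> G * h * t * (1 + real l * (1/20))"
        using bern h t by (intro mult_left_mono) auto
      also have "G * h * t * (1 + real l * (1/20)) \<ge> 40 * t * (1 + real l * (1/20))"
        using h t by (intro mult_right_mono) auto
      finally have "u * (h * t * (3/4) ^ l) \<ge> 40 * t + 2 * (t * real l)" by (simp add: algebra_simps)
      moreover have "t * real l \<ge> real l" using t mult_right_mono[of 1 t "real l"] by simp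
      ultimately have "- (u * (h * t * (3/4) ^ l)) \<le> - (2 * t) + real l * (- 2)" using t by simp
      then have "exp (- (u * (h * t * (3/4) ^ l))) \<le> exp (- (2 * t)) * exp (real l * (- 2))"
        by (simp flip: exp_add)
      also have "exp (real l * (- 2)) = exp (- 2) ^ l" by (rule exp_of_nat_mult)
      also have "exp (- (2 * t)) * exp (- 2) ^ l \<le> exp (- (2 * t)) * (1/4) ^ l"
      proof -
        have "(2::real) ^ 2 \<le> exp 1 ^ 2" using exp_ge_add_one_self[of 1] by (intro power_mono) auto
        also have "exp (1::real) ^ 2 = exp 2" by (simp flip: exp_of_nat_mult)
        finally have "exp (- 2) \<le> (1/4::real)" by (simp add: exp_minus field_simps)
        then show ?thesis by (intro mult_left_mono power_mono) auto
      qed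
      finally show ?thesis by simp
    qed
    finally show ?thesis .
  qed
  have "prob (\<Union>l\<le>N. \<Union>k<2 ^ l. E l k) \<le> (\<Sum>l\<le>N. prob (\<Union>k<2 ^ l. E l k))"
    by (intro finite_measure_subadditive_finite) auto
  also have "\<dots> \<le> (\<Sum>l\<le>N. \<Sum>k<2 ^ l. prob (E l k))"
    by (intro sum_mono finite_measure_subadditive_finite) auto
  also have "\<dots> \<le> (\<Sum>l\<le>N. \<Sum>k<(2::nat) ^ l. 4/3 * (exp (- (2 * t)) * (1/4) ^ l))"
    by (intro sum_mono E_le) auto
  also have "\<dots> = 4/3 * exp (- (2 * t)) * (\<Sum>l\<le>N. (1/2) ^ l)"
  proof -
    have "(\<Sum>k<(2::nat) ^ l. 4/3 * (exp (- (2 * t)) * (1/4) ^ l)) = 4/3 * exp (- (2 * t)) * (1/2) ^ l" for l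
    proof -
      have "(2::real) ^ l * (1/4) ^ l = (1/2) ^ l" by (simp flip: power_mult_distrib)
      then show ?thesis by (simp add: mult.left_commute)
    qed
    then show ?thesis by (simp only: sum_distrib_left)
  qed
  also have "\<dots> \<le> 4/3 * exp (- (2 * t)) * 2"
    using geo[of "1/2" N] by (intro mult_left_mono) auto
  finally have U: "prob (\<Union>l\<le>N. \<Union>k<2 ^ l. E l k) \<le> 8/3 * exp (- (2 * t))" by simp
  have "prob {\<omega> \<in> space M. \<exists>i\<le>2 ^ N. Y (A + i) \<omega> \<ge> x + 4 * h * t}
     \<le> prob ({\<omega> \<in> space M. Y A \<omega> \<ge> x} \<union> (\<Union>l\<le>N. \<Union>k<2 ^ l. E l k))"
    by (intro finite_measure_mono sub) measurable
  also have "\<dots> \<le> prob {\<omega> \<in> space M. Y A \<omega> \<ge> x} + prob (\<Union>l\<le>N. \<Union>k<2 ^ l. E l k)"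
    by (intro measure_Un_le) measurable
  finally show ?thesis using U unfolding Y_def by simp
qed

lemma AE_Z_eventually_le_aux:
  assumes c: "0 < c" and D: "\<And>r. r \<ge> r0 \<Longrightarrow> c * real r \<le> D_val p r" and \<epsilon>: "0 < \<epsilon>" "\<epsilon> \<le> 1"
  shows "AE \<omega> in M. \<forall>\<^sub>F r in sequentially. Z r \<omega> \<le> (1 + \<epsilon>) * D_val p r * ln (ln (real r))"
proof -
  \<comment> \<open>The chaining loss \<open>4 * h * t\<close> is then a quarter of
    \<open>\<epsilon> * t\<close>, within the gap between \<open>1 + \<epsilon> / 2\<close> at the
    left endpoints and \<open>1 + \<epsilon>\<close>. \<open>G\<close> is dictated by
    \<open>40 \<le> G * h\<close>, and \<open>s\<close> makes blocks of length
    \<open>2 ^ (j - s)\<close> short enough for \<open>8 * G^2 \<le> b\<close>.\<close>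
  define h where "h = \<epsilon> / 16"
  define G where "G = 40 / h"
  have h: "0 < h" "G * h = 40" and G1: "1 \<le> G" using \<epsilon> by (auto simp: h_def G_def)
  obtain s where s: "8 * G\<^sup>2 / c < 2 ^ s" using real_arch_pow[of 2] by auto
  define b where "b = c * 2 ^ s"
  have b: "8 * G\<^sup>2 \<le> b" using s c by (simp add: b_def field_simps)
  \<comment> \<open>So close to 1 that the exponent
    \<open>\<gamma> = v * (1 + \<epsilon> / 2)\<close> of the Borel-Cantelli series still exceeds 1;
    \<open>\<gamma> \<le> 2\<close> lets the chaining error \<open>exp (- (2 * t j))\<close> be
    absorbed.\<close>
  define v where "v = 1 / (1 + \<epsilon> / 4)"
  have v: "0 < v" "v < 1" using \<epsilon> by (auto simp: v_def)
  define \<gamma> where "\<gamma> = v * (1 + \<epsilon> / 2)"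
  have \<gamma>: "1 < \<gamma>" "\<gamma> \<le> 2" using \<epsilon> by (auto simp: \<gamma>_def v_def field_simps)
  \<comment> \<open>This is \<open>ln (ln (2 ^ j))\<close>, the normalisation at the left end of the
    dyadic interval.\<close>
  define t where "t j = ln (real j * ln 2)" for j :: nat
  define Bad where "Bad j = {\<omega> \<in> space M. \<exists>R\<in>{2 ^ j..<2 ^ Suc j}. Z R \<omega> / D_val p R \<ge> (1 + \<epsilon>) * t j}" for j
  have [measurable]: "Bad j \<in> sets M" for j unfolding Bad_def by measurable
  define K where "K = 2 ^ s * (1 / (1 - v) + 8 / 3)"
  have t_top: "filterlim (\<lambda>j. t j) at_top sequentially"
    unfolding t_def by (intro filterlim_compose[OF ln_at_top] filterlim_at_top_mult_tendsto_pos[OF tendsto_const]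
      filterlim_real_sequentially) auto
  have Bad_le: "prob (Bad j) \<le> K * (real j * ln 2) powr (- \<gamma>)"
    if j: "j \<ge> s" "2 ^ j \<ge> r0" "t j \<ge> 1" for j
  proof -
    define N where "N = j - s"
    have jN: "2 ^ j = (2::nat) ^ s * 2 ^ N" using j by (simp add: N_def flip: power_add)
    define A where "A i = (2 ^ s + i) * 2 ^ N" for i :: nat
    define B where "B i = {\<omega> \<in> space M. \<exists>k\<le>2 ^ N. Z (A i + k) \<omega> / D_val p (A i + k)
        \<ge> (1 + \<epsilon> / 2) * t j + 4 * h * t j}" for i
    have [measurable]: "B i \<in> sets M" for i unfolding B_def by measurable
    have jpos: "real j * ln 2 > 0" using j(3) by (cases "j = 0") (auto simp: t_def)
    have Ddom: "b * 2 ^ N \<le> D_val p r" if "A i \<le> r" for i r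
    proof -
      have "(2::nat) ^ j \<le> A i" by (simp add: A_def jN)
      then have rj: "2 ^ j \<le> r" using that by simp
      then have "real (2 ^ j) \<le> real r" by (simp only: of_nat_le_iff)
      then have "c * (2 ^ s * 2 ^ N) \<le> c * real r" using c jN by (intro mult_left_mono) auto
      also have "\<dots> \<le> D_val p r" using rj j by (intro D) auto
      finally show ?thesis by (simp add: b_def mult.assoc)
    qed
    have B_le: "prob (B i) \<le> (1 / (1 - v) + 8 / 3) * (real j * ln 2) powr (- \<gamma>)" for i
    proof -
      have "prob (B i) \<le> prob {\<omega> \<in> space M. Z (A i) \<omega> / D_val p (A i) \<ge> (1 + \<epsilon> / 2) * t j} + 8 / 3 * exp (- (2 * t j))"
        unfolding B_def using Ddom G1 b h j by (intro prob_block_le) auto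
      also have "\<dots> \<le> 1 / (1 - v) * exp (- (v * ((1 + \<epsilon> / 2) * t j))) + 8 / 3 * exp (- (2 * t j))"
        using prob_Z_ge[OF v] by (intro add_right_mono)
      also have "\<dots> \<le> 1 / (1 - v) * exp (- (\<gamma> * t j)) + 8 / 3 * exp (- (\<gamma> * t j))"
        using \<gamma> j v by (intro add_mono mult_left_mono) (auto simp: \<gamma>_def mult.assoc)
      also have "\<dots> = (1 / (1 - v) + 8 / 3) * exp (- (\<gamma> * t j))" by (simp add: algebra_simps)
      also have "exp (- (\<gamma> * t j)) = (real j * ln 2) powr (- \<gamma>)"
        using jpos by (cases "j = 0") (simp_all add: powr_def t_def)
      finally show ?thesis .
    qed
    have "Bad j \<subseteq> (\<Union>i<2 ^ s. B i)"
    proof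
      fix \<omega> assume "\<omega> \<in> Bad j"
      then obtain R where R: "2 ^ j \<le> R" "R < 2 ^ Suc j" "Z R \<omega> / D_val p R \<ge> (1 + \<epsilon>) * t j"
        and sp: "\<omega> \<in> space M" unfolding Bad_def by auto
      define i where "i = (R - 2 ^ j) div 2 ^ N"
      define k where "k = (R - 2 ^ j) mod 2 ^ N"
      have "R - 2 ^ j = i * 2 ^ N + k" unfolding i_def k_def by (simp only: div_mult_mod_eq)
      then have "R = 2 ^ j + (i * 2 ^ N + k)" using R by simp
      then have RA: "R = A i + k" by (simp add: A_def jN algebra_simps)
      have "R - 2 ^ j < 2 ^ s * 2 ^ N" using R jN by simp
      then have i: "i < 2 ^ s" unfolding i_def by (simp add: less_mult_imp_div_less)
      have k: "k \<le> 2 ^ N" unfolding k_def by (simp add: less_imp_le)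
      have "(1 + \<epsilon> / 2) * t j + 4 * h * t j \<le> (1 + \<epsilon>) * t j" using \<epsilon> j by (simp add: h_def algebra_simps)
      then have "\<omega> \<in> B i" unfolding B_def using R(3) RA k sp by (auto intro!: exI[of _ k])
      then show "\<omega> \<in> (\<Union>i<2 ^ s. B i)" using i by auto
    qed
    then have "prob (Bad j) \<le> prob (\<Union>i<2 ^ s. B i)" by (intro finite_measure_mono) auto
    also have "\<dots> \<le> (\<Sum>i<2 ^ s. prob (B i))" by (intro finite_measure_subadditive_finite) auto
    also have "\<dots> \<le> (\<Sum>i<(2::nat) ^ s. (1 / (1 - v) + 8 / 3) * (real j * ln 2) powr (- \<gamma>))"
      by (intro sum_mono B_le)
    also have "\<dots> = K * (real j * ln 2) powr (- \<gamma>)" by (simp add: K_def)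
    finally show ?thesis .
  qed
  have "summable (\<lambda>j. prob (Bad j))"
  proof (rule summable_comparison_test_ev)
    have "\<forall>\<^sub>F j in sequentially. (2::nat) ^ j \<ge> r0"
      using eventually_ge_at_top[of r0] by eventually_elim (meson le_trans less_exp less_imp_le)
    moreover have "\<forall>\<^sub>F j in sequentially. t j \<ge> 1"
      using t_top by (simp add: filterlim_at_top)
    ultimately show "\<forall>\<^sub>F j in sequentially. norm (prob (Bad j)) \<le> K * ln 2 powr (- \<gamma>) * real j powr (- \<gamma>)"
      using eventually_ge_at_top[of s]
    proof eventually_elim
      case (elim j)
      then show ?case using Bad_le[of j] by (simp add: powr_mult mult.commute mult.left_commute)
    qed
    show "summable (\<lambda>j. K * ln 2 powr (- \<gamma>) * real j powr (- \<gamma>))"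
      using \<gamma> by (intro summable_mult) (simp add: summable_real_powr_iff)
  qed
  then have "AE \<omega> in M. \<forall>\<^sub>F j in sequentially. \<omega> \<in> space M - Bad j"
    by (intro borel_cantelli_AE1) (auto simp: emeasure_eq_measure)
  then show ?thesis
  proof eventually_elim
    case (elim \<omega>)
    have "\<forall>\<^sub>F j in sequentially. \<omega> \<in> space M - Bad j \<and> t j \<ge> 1"
      using elim t_top by (simp add: filterlim_at_top eventually_conj_iff)
    then obtain J where J: "\<And>j. j \<ge> J \<Longrightarrow> \<omega> \<in> space M - Bad j \<and> t j \<ge> 1"
      by (auto simp: eventually_sequentially)
    show ?case
      using eventually_ge_at_top[of "2 ^ J"]
    proof eventually_elim
      case (elim R)
      have "1 \<le> R" using elim by (meson le_trans one_le_numeral one_le_power)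
      then obtain j where j: "2 ^ j \<le> R" "R < 2 ^ (j + 1)" using ex_power_ivl1[of 2 R] by auto
      have "(2::nat) ^ J < 2 ^ (j + 1)" using elim j by simp
      then have "J < j + 1" by (subst (asm) power_strict_increasing_iff) auto
      then have Jj: "\<omega> \<in> space M - Bad j" "t j \<ge> 1" using J[of j] by auto
      then have "Z R \<omega> / D_val p R < (1 + \<epsilon>) * t j" using j unfolding Bad_def by (auto simp: not_le)
      also have "\<dots> \<le> (1 + \<epsilon>) * ln (ln (real R))"
      proof -
        have jpos: "real j * ln 2 > 0" using Jj(2) by (cases "j = 0") (auto simp: t_def)
        have "real (2 ^ j) \<le> real R" using j by (simp only: of_nat_le_iff)
        then have "ln (real (2 ^ j)) \<le> ln (real R)" by (intro ln_mono) auto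
        then have "real j * ln 2 \<le> ln (real R)" by (simp add: ln_realpow)
        moreover have "j > 0" using jpos by (cases j) auto
        ultimately have "t j \<le> ln (ln (real R))" unfolding t_def using jpos by (intro ln_mono) auto
        then show ?thesis using \<epsilon> by (intro mult_left_mono) auto
      qed
      finally show ?case using D_val_pos[of R] by (simp add: divide_simps mult.commute mult.left_commute)
    qed
  qed
qed

lemma AE_Z_eventually_le:
  assumes c: "0 < c" and D: "\<And>r. r \<ge> r0 \<Longrightarrow> c * real r \<le> D_val p r"
  shows "AE \<omega> in M. \<forall>\<epsilon>>0. \<forall>\<^sub>F r in sequentially. Z r \<omega> \<le> (1 + \<epsilon>) * D_val p r * ln (ln (real r))"
proof -
  have "AE \<omega> in M. \<forall>i. \<forall>\<^sub>F r in sequentially. Z r \<omega> \<le> (1 + 1 / real (Suc i)) * D_val p r * ln (ln (real r))"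
    unfolding AE_all_countable by (intro allI AE_Z_eventually_le_aux[OF c D]) auto
  then show ?thesis
  proof eventually_elim
    case (elim \<omega>)
    show ?case
    proof (intro allI impI)
      fix \<epsilon> :: real assume "\<epsilon> > 0"
      then obtain i where i: "1 / real (Suc i) < \<epsilon>" by (meson nat_approx_posE)
      have "filterlim (\<lambda>r. ln (ln (real r))) at_top sequentially"
        by (intro filterlim_compose[OF ln_at_top] filterlim_real_sequentially)
      then have "\<forall>\<^sub>F r in sequentially. ln (ln (real r)) \<ge> 0" by (simp add: filterlim_at_top)
      with elim[rule_format, of i]
      show "\<forall>\<^sub>F r in sequentially. Z r \<omega> \<le> (1 + \<epsilon>) * D_val p r * ln (ln (real r))"
      proof eventually_elim
        case (elim r)
        have "(1 + 1 / real (Suc i)) * (D_val p r * ln (ln (real r))) \<le> (1 + \<epsilon>) * (D_val p r * ln (ln (real r)))"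
          using i elim(2) D_val_pos[of r] by (intro mult_right_mono) auto
        then show ?case using elim(1) by (simp add: mult.assoc)
      qed
    qed
  qed
qed

end

subsection \<open>Iterated logarithms\<close>

lemma DERIV_iter_log:
  "iter_log_defined K x \<Longrightarrow> DERIV (iter_log K) x :> 1 / lambda_iter K x"
proof (induction K)
  case 0
  have "iter_log 0 = (\<lambda>x. x)" by auto
  then show ?case by simp
next
  case (Suc K)
  have "iter_log (Suc K) = (\<lambda>x. ln (iter_log K x))" by auto
  moreover have "DERIV (\<lambda>x. ln (iter_log K x)) x :> 1 / iter_log K x * (1 / lambda_iter K x)"
    using Suc by (intro DERIV_chain2[OF DERIV_ln_divide]) auto
  ultimately show ?case by (simp add: lambda_iter_Suc mult.commute del: lambda_iter.simps)
qed

lemma lambda_iter_eq_exp: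
  "iter_log_defined K x \<Longrightarrow> lambda_iter K x = exp (\<Sum>k=1..K. iter_log k x)"
  by (induction K) (simp_all add: lambda_iter_Suc exp_add del: lambda_iter.simps(2,3))

text \<open>Nonnegativity of the last iterate puts the earlier ones at 1 or above, where
  \<open>ln\<close> has slope at most 1. Hence rounding a level up to an integer costs at most 1 on
  the \<open>iter_log K\<close> scale.\<close>

lemma iter_log_add_one_le:
  "iter_log_defined K x \<Longrightarrow> iter_log K x \<ge> 0 \<Longrightarrow> iter_log K (x + 1) \<le> iter_log K x + 1"
proof (induction K)
  case (Suc K)
  let ?a = "iter_log K x"
  have a: "?a \<ge> 1" using Suc.prems by simp
  have "iter_log K (x + 1) \<le> ?a + 1" using Suc a by simp
  moreover have "iter_log K (x + 1) > 0" using iter_log_mono[of K x "x + 1"] Suc.prems a by simp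
  ultimately have "ln (iter_log K (x + 1)) \<le> ln (?a + 1)" by simp
  also have "\<dots> = ln ?a + ln (1 + 1 / ?a)" 
  proof -
    have "?a + 1 = ?a * (1 + 1 / ?a)" using a by (simp add: field_simps)
    moreover have "ln (?a * (1 + 1 / ?a)) = ln ?a + ln (1 + 1 / ?a)"
      using a by (intro ln_mult_pos) (auto simp: add_pos_pos)
    ultimately show ?thesis by (simp only:)
  qed
  also have "ln (1 + 1 / ?a) \<le> 1 / ?a" using a by (intro ln_add_one_self_le_self) auto
  also have "1 / ?a \<le> 1" using a by simp
  finally show ?case by simp
qed simp

lemma iter_log_surj: "\<exists>x. iter_log_defined K x \<and> iter_log K x = y"
proof (induction K arbitrary: y)
  case (Suc K)
  obtain x where "iter_log_defined K x" "iter_log K x = exp y" using Suc by blast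
  then show ?case by (intro exI[of _ x]) auto
qed simp

lemma exists_nat_iter_log:
  assumes "K \<ge> 1" "y \<ge> 0"
  shows "\<exists>n::nat. iter_log_defined K (real n) \<and> y \<le> iter_log K (real n) \<and> iter_log K (real n) \<le> y + 1"
proof -
  obtain x where x: "iter_log_defined K x" "iter_log K x = y" using iter_log_surj by blast
  have "x > 0" using iter_log_defined_pos[OF x(1), of 0] assms by simp
  then have n: "x \<le> real (nat \<lceil>x\<rceil>)" "real (nat \<lceil>x\<rceil>) \<le> x + 1" by linarith+
  show ?thesis
    using iter_log_mono[OF x(1) n(1)] iter_log_add_one_le[OF x(1)] x assms
      iter_log_mono[of K "real (nat \<lceil>x\<rceil>)" "x + 1"] n(2)
    by (intro exI[of _ "nat \<lceil>x\<rceil>"]) auto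
qed

lemma eventually_lambda_iter_ge: "\<forall>\<^sub>F x in at_top. \<forall>k\<in>{1..K}. x \<le> lambda_iter k x"
proof -
  have "\<forall>\<^sub>F x in at_top. x \<le> lambda_iter k x" if "k \<ge> 1" for k
    using that
  proof (induction k rule: dec_induct)
    case (step k)
    have "\<forall>\<^sub>F x in at_top. iter_log k x \<ge> 1" using iter_log_at_top[of k] by (simp add: filterlim_at_top)
    with step.IH eventually_ge_at_top[of 0] show ?case
    proof eventually_elim
      case (elim x)
      have "x * 1 \<le> lambda_iter k x * iter_log k x" using elim by (intro mult_mono) auto
      then show ?case by (simp add: lambda_iter_Suc del: lambda_iter.simps)
    qed
  qed simp
  then show ?thesis by (intro eventually_ball_finite) auto
qed

lemma eventually_Lambda_B_le:
  assumes "K \<ge> 1" "B > 0"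
  shows "\<forall>\<^sub>F x in at_top. Lambda_B K x B \<le> (real K + B) / x"
  using eventually_lambda_iter_ge[of K] eventually_gt_at_top[of 0]
proof eventually_elim
  case (elim x)
  have "(\<Sum>k=1..K - 1. 1 / lambda_iter k x) \<le> (\<Sum>k=1..K - 1. 1 / x)"
    using elim by (intro sum_mono divide_left_mono mult_pos_pos) (auto intro: less_le_trans)
  also have "\<dots> \<le> real K / x" using elim by (simp add: divide_right_mono)
  finally have "(\<Sum>k=1..K - 1. 1 / lambda_iter k x) \<le> real K / x" .
  moreover have "B / lambda_iter K x \<le> B / x"
    using elim assms by (intro divide_left_mono mult_pos_pos) (auto intro: less_le_trans)
  ultimately show ?case by (simp add: Lambda_B_def Lambda_iter_def add_divide_distrib)
qed

section \<open>Asymptotics of the scale function for the iterated logarithm drift\<close>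

locale iterated_log_drift =
  fixes K :: nat and B :: real
  assumes K: "K \<ge> 1" and B: "B > 1"
begin

lemma drift_range: "drift_range (drift K B)"
  using drift_bounds[of K B] K B by unfold_locales auto

sublocale drift_range "drift K B"
  by (rule drift_range)

abbreviation \<Lambda> :: "real \<Rightarrow> real" where "\<Lambda> x \<equiv> Lambda_B K x B"

text \<open>The antiderivative of \<Lambda>. As \<open>ln (U_ratio p n)\<close> is close to
  \<open>- 4 * p n = - \<Lambda> n\<close>, the model for \<open>rho\<close> is
  \<open>exp (- \<Psi>)\<close>.\<close>

definition \<Psi> :: "real \<Rightarrow> real" where
  "\<Psi> x = (\<Sum>k=1..K - 1. iter_log k x) + B * iter_log K x"

text \<open>Since \<open>lambda_iter K\<close> is the exponential of the sum of the first
  \<open>K\<close> iterated logarithms, \<open>exp (- \<Psi>) = \<phi> / lambda_iter K\<close>; this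
  is a multiple of the derivative of \<phi>, so \<phi> is the model for
  \<open>scale_tail\<close>.\<close>

definition \<phi> :: "real \<Rightarrow> real" where
  "\<phi> x = exp ((1 - B) * iter_log K x)"

lemma drift_eq: "n \<ge> drift_start K B \<Longrightarrow> 4 * drift K B n = \<Lambda> (real n)"
  by (simp add: drift_def max_def)

lemma iter_log_defined_from_start: "x \<ge> real (drift_start K B) \<Longrightarrow> iter_log_defined K x"
  using drift_start(2)[OF K] iter_log_mono by blast

lemma DERIV_\<Psi>:
  assumes "iter_log_defined K x"
  shows "DERIV \<Psi> x :> \<Lambda> x"
proof -
  have "DERIV (iter_log k) x :> 1 / lambda_iter k x" if "k \<le> K" for k
    using DERIV_iter_log iter_log_defined_le[OF assms that] by blast
  then show ?thesis unfolding \<Psi>_def[abs_def] Lambda_B_def Lambda_iter_def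
    by (auto intro!: derivative_eq_intros)
qed

lemma DERIV_\<phi>:
  assumes "iter_log_defined K x"
  shows "DERIV \<phi> x :> (1 - B) * exp (- \<Psi> x)"
proof -
  have "DERIV \<phi> x :> exp ((1 - B) * iter_log K x) * ((1 - B) * (1 / lambda_iter K x))"
    unfolding \<phi>_def[abs_def] by (auto intro!: derivative_eq_intros DERIV_iter_log assms)
  also have "exp ((1 - B) * iter_log K x) * ((1 - B) * (1 / lambda_iter K x))
      = (1 - B) * (exp ((1 - B) * iter_log K x) * (1 / lambda_iter K x))" by simp
  also have "exp ((1 - B) * iter_log K x) * (1 / lambda_iter K x) = exp (- \<Psi> x)"
  proof -
    have "{1..K} = insert K {1..K - 1}" using K by auto
    then have "(\<Sum>k=1..K. iter_log k x) = iter_log K x + (\<Sum>k=1..K - 1. iter_log k x)" using K by simp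
    then show ?thesis
      unfolding lambda_iter_eq_exp[OF assms] \<Psi>_def
      by (simp add: exp_minus[symmetric] exp_add[symmetric] divide_inverse algebra_simps)
  qed
  finally show ?thesis .
qed

lemma \<Psi>_mono:
  assumes "real (drift_start K B) \<le> x" "x \<le> y"
  shows "\<Psi> x \<le> \<Psi> y"
proof (rule DERIV_nonneg_imp_nondecreasing[OF assms(2)])
  fix z assume "x \<le> z" "z \<le> y"
  then have "iter_log_defined K z" using assms by (intro iter_log_defined_from_start) auto
  then show "\<exists>d. (\<Psi> has_real_derivative d) (at z) \<and> 0 \<le> d"
    using DERIV_\<Psi> Lambda_B_pos_antimono[of K z z B] B by force
qed

lemma \<Psi>_diff:
  assumes "drift_start K B \<le> n"
  shows "\<Lambda> (real (Suc n)) \<le> \<Psi> (real (Suc n)) - \<Psi> (real n)"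
    "\<Psi> (real (Suc n)) - \<Psi> (real n) \<le> \<Lambda> (real n)"
proof -
  have "\<exists>z. real n < z \<and> z < real (Suc n) \<and> \<Psi> (real (Suc n)) - \<Psi> (real n) = (real (Suc n) - real n) * \<Lambda> z"
    using assms by (intro MVT2 DERIV_\<Psi> iter_log_defined_from_start) auto
  then obtain z where z: "real n < z" "z < real (Suc n)" "\<Psi> (real (Suc n)) - \<Psi> (real n) = \<Lambda> z" by auto
  show "\<Lambda> (real (Suc n)) \<le> \<Psi> (real (Suc n)) - \<Psi> (real n)"
    unfolding z(3) using Lambda_B_pos_antimono[of K z "real (Suc n)" B] iter_log_defined_from_start[of z] assms z B by auto
  show "\<Psi> (real (Suc n)) - \<Psi> (real n) \<le> \<Lambda> (real n)"
    unfolding z(3) using Lambda_B_pos_antimono[of K "real n" z B] iter_log_defined_from_start[of "real n"] assms z B by auto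
qed

lemma \<phi>_diff:
  assumes "drift_start K B \<le> n"
  shows "(B - 1) * exp (- \<Psi> (real (Suc n))) \<le> \<phi> (real n) - \<phi> (real (Suc n))"
    "\<phi> (real n) - \<phi> (real (Suc n)) \<le> (B - 1) * exp (- \<Psi> (real n))"
proof -
  have "\<exists>z. real n < z \<and> z < real (Suc n) \<and> \<phi> (real (Suc n)) - \<phi> (real n)
      = (real (Suc n) - real n) * ((1 - B) * exp (- \<Psi> z))"
    using assms by (intro MVT2 DERIV_\<phi> iter_log_defined_from_start) auto
  then obtain z where z: "real n < z" "z < real (Suc n)"
    "\<phi> (real n) - \<phi> (real (Suc n)) = (B - 1) * exp (- \<Psi> z)" by (auto simp: algebra_simps)
  show "(B - 1) * exp (- \<Psi> (real (Suc n))) \<le> \<phi> (real n) - \<phi> (real (Suc n))"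
    unfolding z(3) using \<Psi>_mono[of z "real (Suc n)"] assms z B by (intro mult_left_mono) auto
  show "\<phi> (real n) - \<phi> (real (Suc n)) \<le> (B - 1) * exp (- \<Psi> (real n))"
    unfolding z(3) using \<Psi>_mono[of "real n" z] assms z B by (intro mult_left_mono) auto
qed

lemma \<phi>_tendsto_0: "(\<lambda>n. \<phi> (real n)) \<longlonglongrightarrow> 0"
proof -
  have "filterlim (\<lambda>n. (1 - B) * iter_log K (real n)) at_bot sequentially"
    using B by (intro filterlim_tendsto_neg_mult_at_bot[OF tendsto_const]
        filterlim_compose[OF iter_log_at_top filterlim_real_sequentially]) auto
  then show ?thesis unfolding \<phi>_def by (rule filterlim_compose[OF exp_at_bot])
qed

lemma eventually_\<Lambda>_le: "\<forall>\<^sub>F n in sequentially. \<Lambda> (real n) \<le> (real K + B) / real n"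
  using eventually_Lambda_B_le[OF K, of B] filterlim_real_sequentially B
  by (auto simp: filterlim_iff)

text \<open>With \<open>x = 2 * p\<close> the ratio is \<open>(1 - x) / (1 + x)\<close>, whose
  logarithm is \<open>- 2 * x\<close> up to second order. As \<Lambda> is of order
  \<open>1 / n\<close>, this error is summable.\<close>

lemma ln_U_ratio:
  assumes "drift_start K B \<le> n" "\<Lambda> (real n) \<le> 1"
  shows "\<bar>ln (U_ratio (drift K B) n) + \<Lambda> (real n)\<bar> \<le> (\<Lambda> (real n))\<^sup>2"
proof -
  define x where "x = \<Lambda> (real n) / 2"
  have p: "drift K B n = x / 2" using drift_eq[OF assms(1)] by (simp add: x_def)
  have x: "0 \<le> x" "x \<le> 1/2" using p_nonneg[of n] p assms by (auto simp: x_def)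
  have "U_ratio (drift K B) n = (1 - x) / (1 + x)" unfolding U_ratio_def p using x by (simp add: field_simps)
  then have "ln (U_ratio (drift K B) n) = ln (1 - x) - ln (1 + x)" using x by (simp add: ln_div)
  moreover have "- x - 2 * x\<^sup>2 \<le> ln (1 - x)" using x by (intro ln_one_minus_pos_lower_bound) auto
  moreover have "ln (1 - x) \<le> - x" using x ln_one_minus_pos_upper_bound[of x] by simp
  moreover have "x - x\<^sup>2 \<le> ln (1 + x)" using x by (intro ln_one_plus_pos_lower_bound) auto
  moreover have "ln (1 + x) \<le> x" using x by (intro ln_add_one_self_le_self) auto
  ultimately have "\<bar>ln (U_ratio (drift K B) n) + 2 * x\<bar> \<le> 2 * x\<^sup>2" by (auto simp: abs_le_iff)
  also have "\<dots> \<le> (2 * x)\<^sup>2" by (simp add: power2_eq_square)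
  finally show ?thesis by (simp add: x_def)
qed

text \<open>The logarithm of \<open>rho\<close> over its model has bounded variation: each increment
  is at most the telescoping difference of \<Lambda>, which compares sum and integral, plus a
  multiple of \<open>1 / n^2\<close> from \<open>ln_U_ratio\<close>. This yields two-sided bounds up
  to a constant.\<close>

lemma rho_asymp:
  obtains n0 C where "C > 0" "drift_start K B \<le> n0"
    "\<And>n. n0 \<le> n \<Longrightarrow> rho (drift K B) n \<le> C * exp (- \<Psi> (real n))"
    "\<And>n. n0 \<le> n \<Longrightarrow> exp (- \<Psi> (real n)) \<le> C * rho (drift K B) n"
proof -
  let ?\<rho> = "rho (drift K B)" and ?c = "real K + B"
  have "\<forall>\<^sub>F n in sequentially. \<Lambda> (real n) \<le> 1 \<and> \<Lambda> (real n) \<le> ?c / real n \<and> drift_start K B \<le> n"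
    using eventually_\<Lambda>_le eventually_ge_at_top[of "nat \<lceil>?c\<rceil>"] eventually_gt_at_top[of 0]
      eventually_ge_at_top[of "drift_start K B"]
  proof eventually_elim
    case (elim n)
    have "?c / real n \<le> 1" using elim(2,3) by (simp add: divide_simps)
    then show ?case using elim by linarith
  qed
  then obtain n0 where n0: "\<And>n. n0 \<le> n \<Longrightarrow> \<Lambda> (real n) \<le> 1 \<and> \<Lambda> (real n) \<le> ?c / real n \<and> drift_start K B \<le> n"
    by (auto simp: eventually_sequentially)
  have summ: "summable (\<lambda>n. ?c\<^sup>2 * inverse (real n ^ 2))"
    by (intro summable_mult inverse_power_summable) auto
  define T where "T = (\<Sum>n. ?c\<^sup>2 * inverse (real n ^ 2))"
  have \<Lambda>_nonneg: "0 \<le> \<Lambda> (real n)" if "n0 \<le> n" for n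
    using p_nonneg[of n] drift_eq[of n] n0[OF that] by simp
  define r where "r n = ln (?\<rho> n) + \<Psi> (real n)" for n :: nat
  have incr: "\<bar>r (Suc n) - r n\<bar> \<le> \<Lambda> (real n) - \<Lambda> (real (Suc n)) + ?c\<^sup>2 * inverse (real (Suc n) ^ 2)"
    if n: "n0 \<le> n" for n
  proof -
    have "ln (?\<rho> (Suc n)) = ln (?\<rho> n) + ln (U_ratio (drift K B) (Suc n))"
      unfolding rho_Suc by (intro ln_mult_pos rho_pos U_ratio_bounds)
    then have "r (Suc n) - r n = (ln (U_ratio (drift K B) (Suc n)) + \<Lambda> (real (Suc n)))
        + (\<Psi> (real (Suc n)) - \<Psi> (real n) - \<Lambda> (real (Suc n)))" by (simp add: r_def)
    moreover have "\<bar>ln (U_ratio (drift K B) (Suc n)) + \<Lambda> (real (Suc n))\<bar> \<le> (\<Lambda> (real (Suc n)))\<^sup>2"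
      using n0[of "Suc n"] n by (intro ln_U_ratio) auto
    moreover have "(\<Lambda> (real (Suc n)))\<^sup>2 \<le> (?c / real (Suc n))\<^sup>2"
      using n0[of "Suc n"] n \<Lambda>_nonneg[of "Suc n"] by (intro power_mono) auto
    moreover have "(?c / real (Suc n))\<^sup>2 = ?c\<^sup>2 * inverse (real (Suc n) ^ 2)"
      by (simp add: power_mult_distrib power_inverse divide_inverse del: of_nat_Suc)
    ultimately show ?thesis using \<Psi>_diff[of n] n0[OF n] by linarith
  qed
  have bound: "\<bar>r n - r n0\<bar> \<le> \<Lambda> (real n0) - \<Lambda> (real n) + (\<Sum>i<Suc n. ?c\<^sup>2 * inverse (real i ^ 2))" if "n0 \<le> n" for n
    using that
  proof (induction n rule: dec_induct)
    case base
    then show ?case by (auto intro!: add_nonneg_nonneg sum_nonneg)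
  next
    case (step n)
    then show ?case using incr[OF step(1)] unfolding sum.lessThan_Suc[of _ "Suc n"] by linarith
  qed
  define b where "b = \<bar>r n0\<bar> + \<Lambda> (real n0) + T"
  have rb: "\<bar>r n\<bar> \<le> b" if "n0 \<le> n" for n
  proof -
    have "(\<Sum>i<Suc n. ?c\<^sup>2 * inverse (real i ^ 2)) \<le> T" unfolding T_def
      by (intro sum_le_suminf summ) auto
    then show ?thesis using bound[OF that] \<Lambda>_nonneg[OF that] unfolding b_def by linarith
  qed
  have \<rho>: "?\<rho> n = exp (r n) * exp (- \<Psi> (real n))" for n
    using rho_pos[of n] by (simp add: r_def flip: exp_add)
  show ?thesis
  proof
    show "0 < exp b" "drift_start K B \<le> n0" using n0[of n0] by auto
    fix n assume "n0 \<le> n"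
    then have "r n \<le> b" "- b \<le> r n" using rb[of n] by auto
    then show "?\<rho> n \<le> exp b * exp (- \<Psi> (real n))" unfolding \<rho> by simp
    have "1 \<le> exp b * exp (r n)" using \<open>- b \<le> r n\<close> by (simp flip: exp_add)
    then have "1 * exp (- \<Psi> (real n)) \<le> (exp b * exp (r n)) * exp (- \<Psi> (real n))" by (intro mult_right_mono) auto
    then show "exp (- \<Psi> (real n)) \<le> exp b * ?\<rho> n" unfolding \<rho> by simp
  qed
qed

lemma summable_rho: "summable (rho (drift K B))"
proof -
  obtain n0 C where C: "C > 0" "drift_start K B \<le> n0"
    "\<And>n. n0 \<le> n \<Longrightarrow> rho (drift K B) n \<le> C * exp (- \<Psi> (real n))"
    "\<And>n. n0 \<le> n \<Longrightarrow> exp (- \<Psi> (real n)) \<le> C * rho (drift K B) n" by (rule rho_asymp, rule that)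
  have "summable (\<lambda>n. C / (B - 1) * (\<phi> (real n) - \<phi> (real (Suc n))))"
    using telescope_summable'[OF \<phi>_tendsto_0] by (rule summable_mult)
  then have "summable (\<lambda>n. rho (drift K B) (Suc n))"
  proof (rule summable_comparison_test_ev[rotated])
    show "\<forall>\<^sub>F n in sequentially. norm (rho (drift K B) (Suc n)) \<le> C / (B - 1) * (\<phi> (real n) - \<phi> (real (Suc n)))"
      using eventually_ge_at_top[of n0]
    proof eventually_elim
      case (elim n)
      have "rho (drift K B) (Suc n) \<le> C * exp (- \<Psi> (real (Suc n)))" using elim by (intro C) auto
      also have "\<dots> = C / (B - 1) * ((B - 1) * exp (- \<Psi> (real (Suc n))))" using B by simp
      also have "\<dots> \<le> C / (B - 1) * (\<phi> (real n) - \<phi> (real (Suc n)))"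
        using C B elim by (intro mult_left_mono \<phi>_diff) auto
      finally show ?case using rho_pos[of "Suc n"] by simp
    qed
  qed
  then show ?thesis by (simp only: summable_Suc_iff)
qed

sublocale transient_drift "drift K B"
  by unfold_locales (rule summable_rho)

text \<open>Termwise comparison with the telescoping series of \<phi>. The mean value theorem bounds
  a difference of \<phi> below by the value of \<open>exp (- \<Psi>)\<close> at its right end, which
  is why the upper estimate concerns \<open>Suc n\<close>.\<close>

lemma scale_tail_asymp:
  obtains n0 C where "C > 0" "drift_start K B \<le> n0"
    "\<And>n. n0 \<le> n \<Longrightarrow> rho (drift K B) n \<le> C * exp (- \<Psi> (real n))"
    "\<And>n. n0 \<le> n \<Longrightarrow> scale_tail (drift K B) (Suc n) \<le> C * \<phi> (real n)"
    "\<And>n. n0 \<le> n \<Longrightarrow> \<phi> (real n) \<le> C * scale_tail (drift K B) n"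
proof -
  let ?\<rho> = "rho (drift K B)"
  obtain n0 C where C: "C > 0" "drift_start K B \<le> n0"
    "\<And>n. n0 \<le> n \<Longrightarrow> ?\<rho> n \<le> C * exp (- \<Psi> (real n))"
    "\<And>n. n0 \<le> n \<Longrightarrow> exp (- \<Psi> (real n)) \<le> C * ?\<rho> n" by (rule rho_asymp, rule that)
  have tel: "(\<lambda>j. \<phi> (real (n + j)) - \<phi> (real (Suc (n + j)))) sums \<phi> (real n)" for n
  proof -
    have "(\<lambda>j. \<phi> (real (n + j))) \<longlonglongrightarrow> 0"
      using LIMSEQ_ignore_initial_segment[OF \<phi>_tendsto_0, of n] by (simp add: add.commute)
    from telescope_sums'[OF this] show ?thesis by simp
  qed
  define c where "c = max (C / (B - 1)) (max ((B - 1) * C) C)"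
  have c: "C / (B - 1) \<le> c" "(B - 1) * C \<le> c" "C \<le> c" by (auto simp: c_def)
  have \<phi>_pos: "0 < \<phi> x" for x by (simp add: \<phi>_def)
  show ?thesis
  proof
    show "c > 0" using c C by simp
    show "drift_start K B \<le> n0" by (rule C)
    fix n assume n: "n0 \<le> n"
    show "?\<rho> n \<le> c * exp (- \<Psi> (real n))" using C(3)[OF n] c(3)
      by (meson exp_ge_zero mult_right_mono order_trans)
    have "scale_tail (drift K B) (Suc n) \<le> C / (B - 1) * \<phi> (real n)"
      unfolding scale_tail_def
    proof (rule sums_le[OF _ summable_sums[OF summable_rho_shift] sums_mult[OF tel]])
      fix j
      have "?\<rho> (Suc n + j) \<le> C * exp (- \<Psi> (real (Suc (n + j))))" using C(3)[of "Suc n + j"] n by simp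
      also have "\<dots> = C / (B - 1) * ((B - 1) * exp (- \<Psi> (real (Suc (n + j)))))" using B by simp
      also have "\<dots> \<le> C / (B - 1) * (\<phi> (real (n + j)) - \<phi> (real (Suc (n + j))))"
        using C B n by (intro mult_left_mono \<phi>_diff) auto
      finally show "?\<rho> (Suc n + j) \<le> C / (B - 1) * (\<phi> (real (n + j)) - \<phi> (real (Suc (n + j))))" .
    qed
    also have "\<dots> \<le> c * \<phi> (real n)" using c \<phi>_pos[of "real n"] by (intro mult_right_mono) auto
    finally show "scale_tail (drift K B) (Suc n) \<le> c * \<phi> (real n)" .
    have "\<phi> (real n) \<le> (B - 1) * C * scale_tail (drift K B) n"
      unfolding scale_tail_def
    proof (rule sums_le[OF _ tel sums_mult[OF summable_sums[OF summable_rho_shift]]])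
      fix j
      have "\<phi> (real (n + j)) - \<phi> (real (Suc (n + j))) \<le> (B - 1) * exp (- \<Psi> (real (n + j)))"
        using C n by (intro \<phi>_diff) auto
      also have "\<dots> \<le> (B - 1) * (C * ?\<rho> (n + j))" using C(4)[of "n + j"] n B by (intro mult_left_mono) auto
      finally show "\<phi> (real (n + j)) - \<phi> (real (Suc (n + j))) \<le> (B - 1) * C * ?\<rho> (n + j)" by simp
    qed
    also have "\<dots> \<le> c * scale_tail (drift K B) n"
      using c scale_tail_pos[of n] by (intro mult_right_mono) auto
    finally show "\<phi> (real n) \<le> c * scale_tail (drift K B) n" .
  qed
qed

text \<open>From \<open>n\<close> on, \<open>rho\<close> loses at most the fraction
  \<open>c / n\<close> per step, where \<open>c = K + B\<close>. By Bernoulli's inequality it keeps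
  half its size for \<open>n / (2 * c)\<close> steps, and those terms alone contribute
  \<open>n / (4 * c)\<close> to \<open>D_val\<close>.\<close>

lemma D_val_linear_lower:
  obtains r0 c where "c > 0" "\<And>r. r \<ge> r0 \<Longrightarrow> c * real r \<le> D_val (drift K B) r"
proof -
  let ?\<rho> = "rho (drift K B)" and ?c = "real K + B"
  have c0: "?c > 0" using B by simp
  have "\<forall>\<^sub>F n in sequentially. \<Lambda> (real n) \<le> ?c / real n \<and> drift_start K B \<le> n \<and> ?c \<le> real n \<and> 0 < n"
    using eventually_\<Lambda>_le eventually_ge_at_top[of "nat \<lceil>?c\<rceil>"] eventually_gt_at_top[of 0]
      eventually_ge_at_top[of "drift_start K B"]
    by eventually_elim linarith
  then obtain n0 where n0: "\<And>n. n0 \<le> n \<Longrightarrow> \<Lambda> (real n) \<le> ?c / real n \<and> drift_start K B \<le> n \<and> ?c \<le> real n \<and> 0 < n"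
    by (auto simp: eventually_sequentially)
  have U: "1 - ?c / real n \<le> U_ratio (drift K B) i" if "n0 \<le> n" "n \<le> i" for n i
  proof -
    have pos: "0 < n" using n0[OF that(1)] by simp
    have "1 - ?c / real n \<le> 1 - ?c / real i" using that c0 pos by (simp add: divide_left_mono)
    also have "\<dots> \<le> 1 - 4 * drift K B i" using n0[of i] drift_eq[of i] that by simp
    also have "\<dots> \<le> U_ratio (drift K B) i"
      unfolding U_ratio_def using p_nonneg[of i] by (simp add: field_simps)
    finally show ?thesis .
  qed
  show ?thesis
  proof
    show "1 / (4 * ?c) > 0" using c0 by simp
    fix n assume n: "n0 \<le> n"
    have npos: "0 < real n" "?c \<le> real n" using n0[OF n] by auto
    have b: "0 \<le> 1 - ?c / real n" using npos by simp
    have pw: "?\<rho> n * (1 - ?c / real n) ^ j \<le> ?\<rho> (n + j)" for j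
    proof (induction j)
      case (Suc j)
      have "?\<rho> n * (1 - ?c / real n) ^ j * (1 - ?c / real n) \<le> ?\<rho> (n + j) * U_ratio (drift K B) (Suc (n + j))"
        using Suc U[OF n, of "Suc (n + j)"] b rho_pos[of n] rho_pos[of "n + j"] by (intro mult_mono) auto
      then show ?case by (simp add: rho_Suc mult_ac)
    qed simp
    have half: "?\<rho> n / 2 \<le> ?\<rho> (n + j)" if "real j \<le> real n / (2 * ?c)" for j
    proof -
      have "1 / 2 \<le> 1 + real j * (- (?c / real n))" using that c0 npos by (simp add: field_simps)
      also have "\<dots> \<le> (1 + (- (?c / real n))) ^ j" using b by (intro Bernoulli_inequality) auto
      finally have "1 / 2 \<le> (1 - ?c / real n) ^ j" by simp
      then have "?\<rho> n * (1 / 2) \<le> ?\<rho> n * (1 - ?c / real n) ^ j" using rho_pos[of n] by (intro mult_left_mono) auto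
      then show ?thesis using pw[of j] by simp
    qed
    define J where "J = nat \<lfloor>real n / (2 * ?c)\<rfloor>"
    have J: "real J \<le> real n / (2 * ?c)" "real n / (2 * ?c) \<le> real (Suc J)"
      using npos c0 by (auto simp: J_def) linarith
    have "real n / (2 * ?c) * (?\<rho> n / 2) \<le> real (Suc J) * (?\<rho> n / 2)"
      using J rho_pos[of n] by (intro mult_right_mono) auto
    also have "\<dots> = (\<Sum>j<Suc J. ?\<rho> n / 2)" by simp
    also have "\<dots> \<le> (\<Sum>j<Suc J. ?\<rho> (n + j))" using J by (intro sum_mono half) (auto simp: less_Suc_eq_le)
    also have "\<dots> \<le> scale_tail (drift K B) n" unfolding scale_tail_def
      using rho_pos by (intro sum_le_suminf summable_rho_shift) (auto simp: less_imp_le)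
    finally show "1 / (4 * ?c) * real n \<le> D_val (drift K B) n"
      using rho_pos[of n] c0 by (simp add: D_val_def field_simps)
  qed
qed

text \<open>The affine function \<open>L\<close> solves the recursion of \<open>D_val\<close>
  exactly: its intercept is \<open>B / (2 * (B - 1))\<close>, so \<open>L (Suc n)\<close> cancels
  the denominator of \<open>U_ratio\<close>. Multiplied by \<open>rho\<close>, the difference of two
  solutions is constant in \<open>n\<close>; it tends to 0, hence vanishes.\<close>

lemma D_val_exact:
  assumes K1: "K = 1" and n: "drift_start K B \<le> n"
  shows "D_val (drift K B) n = real n / (B - 1) + (1 / (B - 1) + 1) / 2"
proof -
  let ?\<rho> = "rho (drift K B)"
  define b where "b = (1 / (B - 1) + 1) / 2"
  define L where "L n = real n / (B - 1) + b" for n :: nat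
  have U: "U_ratio (drift K B) (Suc n) = (2 * real (Suc n) - B) / (2 * real (Suc n) + B)"
    if "drift_start K B \<le> n" for n
  proof -
    have "4 * drift K B (Suc n) = B / real (Suc n)"
      using drift_eq[of "Suc n"] that K1 by (simp add: Lambda_B_1[unfolded One_nat_def] del: of_nat_Suc)
    moreover have "drift K B (Suc n) = 4 * drift K B (Suc n) / 4" by simp
    ultimately have "drift K B (Suc n) = B / (4 * real (Suc n))"
      by (metis divide_divide_eq_left mult.commute)
    moreover have "(1 / 2 - B / (4 * m)) / (1 / 2 + B / (4 * m)) = (2 * m - B) / (2 * m + B)" if "m > 0" for m
    proof -
      have "1 / 2 - B / (4 * m) = (2 * m - B) / (4 * m)" "1 / 2 + B / (4 * m) = (2 * m + B) / (4 * m)"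
        using that by (auto simp: field_simps)
      then show ?thesis using that by simp
    qed
    ultimately show ?thesis unfolding U_ratio_def by (simp del: of_nat_Suc)
  qed
  have L_rec: "L n = 1 + U_ratio (drift K B) (Suc n) * L (Suc n)" if "drift_start K B \<le> n" for n
  proof -
    have "2 * real (Suc n) + B > 0" using B by simp
    then show ?thesis unfolding U[OF that] L_def b_def using B by (simp add: divide_simps) (simp add: algebra_simps)
  qed
  define e where "e n = ?\<rho> n * (D_val (drift K B) n - L n)" for n
  have e_Suc: "e n = e (Suc n)" if "drift_start K B \<le> n" for n
    unfolding e_def rho_Suc using L_rec[OF that] D_val_pred[of n] by (simp add: algebra_simps)
  have e_const: "e (n + j) = e n" for j
  proof (induction j)
    case (Suc j)
    then show ?case using e_Suc[of "n + j"] n by simp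
  qed simp
  obtain n0 C where C: "C > 0" "drift_start K B \<le> n0"
    "\<And>n. n0 \<le> n \<Longrightarrow> ?\<rho> n \<le> C * exp (- \<Psi> (real n))"
    "\<And>n. n0 \<le> n \<Longrightarrow> scale_tail (drift K B) (Suc n) \<le> C * \<phi> (real n)"
    "\<And>n. n0 \<le> n \<Longrightarrow> \<phi> (real n) \<le> C * scale_tail (drift K B) n" by (rule scale_tail_asymp, rule that)
  have "(\<lambda>n. scale_tail (drift K B) (Suc n)) \<longlonglongrightarrow> 0"
  proof (rule tendsto_sandwich[where f="\<lambda>_. 0"])
    show "(\<lambda>n. C * \<phi> (real n)) \<longlonglongrightarrow> 0" using tendsto_mult_right_zero[OF \<phi>_tendsto_0] by simp
    show "\<forall>\<^sub>F n in sequentially. scale_tail (drift K B) (Suc n) \<le> C * \<phi> (real n)"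
      using C(4) eventually_sequentially by blast
  qed (auto simp: scale_tail_pos less_imp_le)
  then have S0: "(\<lambda>n. scale_tail (drift K B) n) \<longlonglongrightarrow> 0" by (rule LIMSEQ_imp_Suc)
  have \<rho>n: "(\<lambda>n. ?\<rho> n * real n) \<longlonglongrightarrow> 0"
  proof (rule tendsto_sandwich[where f="\<lambda>_. 0"])
    show "(\<lambda>n. C * \<phi> (real n)) \<longlonglongrightarrow> 0" using tendsto_mult_right_zero[OF \<phi>_tendsto_0] by simp
    show "\<forall>\<^sub>F n in sequentially. ?\<rho> n * real n \<le> C * \<phi> (real n)"
      using eventually_ge_at_top[of n0] eventually_gt_at_top[of 0]
    proof eventually_elim
      case (elim n)
      have "?\<rho> n * real n \<le> C * (exp (- \<Psi> (real n)) * real n)"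
        using mult_right_mono[OF C(3)[OF elim(1)], of "real n"] by (simp add: mult.assoc)
      \<comment> \<open>For \<open>K = 1\<close> the model of \<open>rho\<close> is
        \<open>n powr - B\<close>, so the extra factor \<open>n\<close> gives
        \<open>n powr (1 - B)\<close>.\<close>
      also have "exp (- \<Psi> (real n)) * real n = \<phi> (real n)"
      proof -
        have "real n = exp (ln (real n))" using elim by simp
        then have "exp (- \<Psi> (real n)) * real n = exp (- \<Psi> (real n)) * exp (ln (real n))" by simp
        also have "\<dots> = \<phi> (real n)"
          unfolding \<Psi>_def \<phi>_def by (simp add: K1 algebra_simps flip: exp_add)
        finally show ?thesis .
      qed
      finally show ?case .
    qed
  qed (auto simp: rho_pos less_imp_le)
  have \<rho>0: "?\<rho> \<longlonglongrightarrow> 0" by (rule summable_LIMSEQ_zero[OF summable_rho])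
  have "e = (\<lambda>n. scale_tail (drift K B) n - (?\<rho> n * real n / (B - 1) + ?\<rho> n * b))"
    by (auto simp: e_def D_val_def L_def fun_eq_iff field_simps)
  moreover have "(\<lambda>n. scale_tail (drift K B) n - (?\<rho> n * real n / (B - 1) + ?\<rho> n * b)) \<longlonglongrightarrow> 0 - (0 / (B - 1) + 0 * b)"
    using B by (intro tendsto_intros S0 \<rho>n \<rho>0) auto
  ultimately have "e \<longlonglongrightarrow> 0" by simp
  then have "(\<lambda>j. e (j + n)) \<longlonglongrightarrow> 0" by (rule LIMSEQ_ignore_initial_segment)
  then have "(\<lambda>j. e n) \<longlonglongrightarrow> 0" using e_const by (simp add: add.commute)
  then have "e n = 0" by (simp add: LIMSEQ_const_iff)
  then show ?thesis by (simp add: e_def L_def b_def)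
qed

end

subsection \<open>Limits superior\<close>

lemma limsup_ratio_le_1:
  fixes f d :: "nat \<Rightarrow> real"
  assumes le: "\<And>\<epsilon>. 0 < \<epsilon> \<Longrightarrow> \<forall>\<^sub>F r in sequentially. f r \<le> (1 + \<epsilon>) * d r"
    and d: "\<forall>\<^sub>F r in sequentially. 0 < d r"
    and F: "\<forall>\<^sub>F r in sequentially. F r = ereal (f r / d r)"
  shows "limsup F \<le> 1"
proof (rule ereal_le_epsilon2)
  fix \<epsilon> :: real assume "0 < \<epsilon>"
  have "\<forall>\<^sub>F r in sequentially. F r \<le> ereal (1 + \<epsilon>)"
    using le[OF \<open>0 < \<epsilon>\<close>] d F by eventually_elim (simp add: divide_le_eq)
  then show "limsup F \<le> 1 + ereal \<epsilon>" by (intro Limsup_bounded) (simp add: one_ereal_def)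
qed

lemma limsup_ratio_ge_1:
  fixes f d :: "nat \<Rightarrow> real"
  assumes ge: "\<And>\<epsilon> m. 0 < \<epsilon> \<Longrightarrow> \<epsilon> < 1 \<Longrightarrow> \<exists>r\<ge>m. (1 - \<epsilon>) * d r \<le> f r"
    and d: "\<forall>\<^sub>F r in sequentially. 0 < d r"
    and F: "\<forall>\<^sub>F r in sequentially. F r = ereal (f r / d r)"
  shows "1 \<le> limsup F"
proof (rule ereal_le_epsilon2)
  fix \<epsilon> :: real assume \<epsilon>: "0 < \<epsilon>"
  define \<delta> where "\<delta> = min \<epsilon> (1 / 2)"
  have \<delta>: "0 < \<delta>" "\<delta> < 1" "\<delta> \<le> \<epsilon>" using \<epsilon> by (auto simp: \<delta>_def)
  have "ereal (1 - \<delta>) \<le> limsup F"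
  proof (rule ccontr)
    assume "\<not> ?thesis"
    then have "\<forall>\<^sub>F r in sequentially. F r < ereal (1 - \<delta>)" by (intro Limsup_lessD) (simp add: not_le)
    with d F have "\<forall>\<^sub>F r in sequentially. f r < (1 - \<delta>) * d r"
      by eventually_elim (simp add: divide_less_eq)
    then obtain m where m: "\<And>r. r \<ge> m \<Longrightarrow> f r < (1 - \<delta>) * d r" by (auto simp: eventually_sequentially)
    obtain r where "r \<ge> m" "(1 - \<delta>) * d r \<le> f r" using ge[OF \<delta>(1,2), of m] by blast
    with m[of r] show False by simp
  qed
  moreover have "1 = ereal (1 - \<delta>) + ereal \<delta>" by (simp add: one_ereal_def)
  moreover have "ereal (1 - \<delta>) + ereal \<delta> \<le> limsup F + ereal \<epsilon>"
    using \<delta> calculation(1) by (intro add_mono) auto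
  ultimately show "1 \<le> limsup F + ereal \<epsilon>" by (simp add: one_ereal_def)
qed

lemma filterlim_ln_ln: "filterlim (\<lambda>r. ln (ln (real r))) at_top sequentially"
  by (intro filterlim_compose[OF ln_at_top] filterlim_real_sequentially)

lemma ln_ln_mono: "1 < x \<Longrightarrow> x \<le> y \<Longrightarrow> ln (ln x) \<le> ln (ln (y::real))"
  by (simp add: ln_mono)

section \<open>Almost sure bounds for visits\<close>

locale iterated_log_walk = iterated_log_drift K B + transient_nn_walk M X "drift K B"
  for K B M X
begin

abbreviation D :: "nat \<Rightarrow> real" where "D \<equiv> D_val (drift K B)"

abbreviation \<xi> :: "nat \<Rightarrow> 'a \<Rightarrow> real" where "\<xi> r \<omega> \<equiv> real (card {n. X n \<omega> = r})"

lemma D_at_top: "filterlim D at_top sequentially"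
proof -
  obtain r0 c where c: "c > 0" "\<And>r. r \<ge> r0 \<Longrightarrow> c * real r \<le> D r" using D_val_linear_lower by blast
  have "filterlim (\<lambda>r. c * real r) at_top sequentially"
    using c by (intro filterlim_tendsto_pos_mult_at_top[OF tendsto_const] filterlim_real_sequentially) auto
  then show ?thesis
    by (rule filterlim_at_top_mono) (use c(2) eventually_sequentially in blast)
qed

lemma AE_Z_le: "AE \<omega> in M. \<forall>\<epsilon>>0. \<forall>\<^sub>F r in sequentially. Z r \<omega> \<le> (1 + \<epsilon>) * (D r * ln (ln (real r)))"
proof -
  obtain r0 c where c: "c > 0" "\<And>r. r \<ge> r0 \<Longrightarrow> c * real r \<le> D r" using D_val_linear_lower by blast
  show ?thesis using AE_Z_eventually_le[OF c] by (simp add: mult.assoc)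
qed

lemma AE_visits_le:
  "AE \<omega> in M. \<forall>\<epsilon>>0. \<forall>\<^sub>F r in sequentially. \<xi> r \<omega> \<le> (1 + \<epsilon>) * (2 * D r * ln (ln (real r)))"
  using AE_Z_le AE_finite_visits
proof eventually_elim
  case (elim \<omega>)
  show ?case
  proof (intro allI impI)
    fix \<epsilon> :: real assume "0 < \<epsilon>"
    \<comment> \<open>For \<open>\<delta> \<le> 1\<close> one has
      \<open>(1 + \<delta>)^2 \<le> 1 + 3 * \<delta>\<close>: one factor is spent on the bound for
      \<open>Z\<close>, the other on replacing \<open>D r\<close> by
      \<open>D (Suc r)\<close>.\<close>
    define \<delta> where "\<delta> = min 1 (\<epsilon> / 3)"
    have \<delta>: "0 < \<delta>" "\<delta> \<le> 1" "3 * \<delta> \<le> \<epsilon>" using \<open>0 < \<epsilon>\<close> by (auto simp: \<delta>_def)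
    have Z: "\<forall>\<^sub>F r in sequentially. Z r \<omega> \<le> (1 + \<delta>) * (D r * ln (ln (real r)))"
      using elim(1) \<delta>(1) by blast
    have "\<forall>\<^sub>F r in sequentially. \<xi> (Suc r) \<omega> \<le> (1 + \<epsilon>) * (2 * D (Suc r) * ln (ln (real (Suc r))))"
      using Z eventually_sequentially_Suc[THEN iffD2, OF Z]
        filterlim_at_top_dense[THEN iffD1, OF filterlim_compose[OF D_at_top filterlim_Suc], rule_format, of "1 / (2 * \<delta>)"]
        filterlim_at_top_dense[THEN iffD1, OF filterlim_ln_ln, rule_format, of 0] eventually_gt_at_top[of 1]
    proof eventually_elim
      case (elim r)
      let ?l = "ln (ln (real (Suc r)))"
      have l1: "ln (ln (real r)) \<le> ?l" using elim(5) by (intro ln_ln_mono) auto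
      moreover have "0 < ln (ln (real r))" by (rule elim(4))
      ultimately have l: "ln (ln (real r)) \<le> ?l" "0 \<le> ?l" by linarith+
      have Dr: "D r \<le> 1 + D (Suc r)"
        unfolding D_val_pred[of r] using U_ratio_bounds[of "Suc r"] D_val_pos[of "Suc r"] by (simp add: mult_left_le_one_le less_imp_le)
      have "\<xi> (Suc r) \<omega> \<le> Z (Suc r) \<omega> + Z r \<omega>" using \<open>\<forall>r. finite _ \<and> _ r\<close> by blast
      also have "\<dots> \<le> (1 + \<delta>) * (D (Suc r) * ?l) + (1 + \<delta>) * ((1 + D (Suc r)) * ?l)"
      proof (intro add_mono elim(2) order_trans[OF elim(1)] mult_left_mono)
        show "D r * ln (ln (real r)) \<le> (1 + D (Suc r)) * ?l"
          using Dr l elim(4) D_val_pos[of "Suc r"] by (intro mult_mono) auto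
      qed (use \<delta> in auto)
      also have "\<dots> = (1 + \<delta>) * ((2 * D (Suc r) + 1) * ?l)" by (simp add: algebra_simps)
      \<comment> \<open>\<open>D (Suc r) > 1 / (2 * \<delta>)\<close> absorbs the extra 1 into the
        second factor \<open>1 + \<delta>\<close>.\<close>
      also have "\<dots> \<le> (1 + \<delta>) * (((1 + \<delta>) * (2 * D (Suc r))) * ?l)"
        using elim(3) \<delta> l by (intro mult_left_mono mult_right_mono) (auto simp: field_simps)
      also have "\<dots> = (1 + \<delta>)\<^sup>2 * (2 * D (Suc r) * ?l)" by (simp add: power2_eq_square)
      also have "\<dots> \<le> (1 + \<epsilon>) * (2 * D (Suc r) * ?l)"
      proof (intro mult_right_mono)
        have "\<delta> * \<delta> \<le> 1 * \<delta>" using \<delta> by (intro mult_right_mono) auto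
        moreover have "(1 + \<delta>)\<^sup>2 = 1 + 2 * \<delta> + \<delta> * \<delta>" by (simp add: power2_eq_square algebra_simps)
        ultimately show "(1 + \<delta>)\<^sup>2 \<le> 1 + \<epsilon>" using \<delta>(3) by linarith
        show "0 \<le> 2 * D (Suc r) * ?l" using l D_val_pos[of "Suc r"] by simp
      qed
      finally show ?case .
    qed
    then show "\<forall>\<^sub>F r in sequentially. \<xi> r \<omega> \<le> (1 + \<epsilon>) * (2 * D r * ln (ln (real r)))"
      by (rule eventually_sequentially_Suc[THEN iffD1])
  qed
qed

lemma drift_tendsto_0: "(\<lambda>n. drift K B n) \<longlonglongrightarrow> 0"
proof (rule tendsto_sandwich[where f="\<lambda>_. 0"])
  show "(\<lambda>n. (real K + B) / real n) \<longlonglongrightarrow> 0" by (intro real_tendsto_divide_at_top[OF tendsto_const] filterlim_real_sequentially)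
  show "\<forall>\<^sub>F n in sequentially. drift K B n \<le> (real K + B) / real n"
    using eventually_\<Lambda>_le eventually_ge_at_top[of "drift_start K B"]
  proof eventually_elim
    case (elim n)
    then show ?case using drift_eq[of n] p_nonneg[of n] by simp
  qed
qed (auto simp: p_nonneg)

text \<open>Up to relative errors of order \<eta> the escape probability is
  \<open>1 / (2 * D r)\<close>, because \<open>up_prob\<close> is near \<open>1/2\<close> and the
  scale tail at \<open>r'\<close> is negligible. The slack \<open>10 * \<eta>\<close> pays for these
  two errors and for \<open>ln (1 - q) \<ge> - (1 + \<eta>) * q\<close>.\<close>

lemma escape_power_ge:
  assumes \<eta>: "0 < \<eta>" "\<eta> \<le> 1/10" and rr': "r < r'"
    and S: "scale_tail (drift K B) r' \<le> \<eta> * scale_tail (drift K B) r"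
    and p: "drift K B r \<le> \<eta>" "r > 0" and Dr: "4 / \<eta> \<le> D r" and l: "0 \<le> l"
    and \<nu>: "\<nu> = max 1 (nat \<lceil>(1 - 10 * \<eta>) * (2 * D r * l)\<rceil>)"
  shows "exp (- l) \<le> (1 - escape_prob (drift K B) r r') ^ (\<nu> - 1)"
proof -
  let ?S = "scale_tail (drift K B)" and ?q = "escape_prob (drift K B) r r'"
  have D0: "0 < D r" by (rule D_val_pos)
  have q0: "0 \<le> ?q" by (rule escape_prob_bounds[OF rr'])
  have S0: "0 < ?S r" "0 < rho (drift K B) r" by (auto intro: scale_tail_pos rho_pos)
  have "?q \<le> (1/2 + \<eta>) * rho (drift K B) r / ((1 - \<eta>) * ?S r)"
    unfolding escape_prob_def using p \<eta> S S0 p_nonneg[of r]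
    by (intro frac_le mult_right_mono mult_nonneg_nonneg) (auto simp: up_prob_def algebra_simps)
  also have "\<dots> = (1/2 + \<eta>) / ((1 - \<eta>) * D r)" using S0 by (simp add: D_val_def)
  finally have q: "?q \<le> (1/2 + \<eta>) / ((1 - \<eta>) * D r)" .
  also have "\<dots> \<le> 2 / D r"
  proof -
    have "(1/2 + \<eta>) / (1 - \<eta>) \<le> 2" using \<eta> by (simp add: divide_le_eq)
    then have "(1/2 + \<eta>) / (1 - \<eta>) / D r \<le> 2 / D r" using D0 by (intro divide_right_mono) auto
    then show ?thesis by simp
  qed
  also have "2 / D r \<le> \<eta> / 2" using Dr D0 \<eta> by (simp add: field_simps)
  finally have q2: "?q \<le> \<eta> / 2" .
  have "?q * (2 * ?q) \<le> ?q * \<eta>" using q0 q2 by (intro mult_left_mono) auto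
  then have "- ((1 + \<eta>) * ?q) \<le> - ?q - 2 * ?q\<^sup>2" by (simp add: power2_eq_square algebra_simps)
  also have "\<dots> \<le> ln (1 - ?q)" using q0 q2 \<eta> by (intro ln_one_minus_pos_lower_bound) auto
  finally have ln_q: "- ((1 + \<eta>) * ?q) \<le> ln (1 - ?q)" .
  define x where "x = (1 - 10 * \<eta>) * (2 * D r * l)"
  have x0: "0 \<le> x" using \<eta> D0 l by (simp add: x_def)
  \<comment> \<open>The free first visit compensates for rounding up.\<close>
  have \<nu>x: "real (\<nu> - 1) \<le> x" unfolding \<nu> x_def[symmetric] using x0 by linarith
  have "real (\<nu> - 1) * ((1 + \<eta>) * ?q) \<le> x * ((1 + \<eta>) * ((1/2 + \<eta>) / ((1 - \<eta>) * D r)))"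
    using \<nu>x q q0 \<eta> x0 by (intro mult_mono) auto
  also have "\<dots> = l * ((1 - 10 * \<eta>) * ((1 + \<eta>) * (1 + 2 * \<eta>)) / (1 - \<eta>))"
    using D0 \<eta> by (simp add: x_def field_simps)
  also have "\<dots> \<le> l * 1"
  proof (intro mult_left_mono l)
    have "(1 - 10 * \<eta>) * ((1 + \<eta>) * (1 + 2 * \<eta>)) = 1 - 7 * \<eta> - 28 * \<eta>\<^sup>2 - 20 * \<eta> ^ 3"
      by (simp add: algebra_simps power2_eq_square power3_eq_cube)
    also have "\<dots> \<le> 1 - \<eta>" using \<eta> zero_le_power2[of \<eta>] zero_le_power[of \<eta> 3] by linarith
    finally show "(1 - 10 * \<eta>) * ((1 + \<eta>) * (1 + 2 * \<eta>)) / (1 - \<eta>) \<le> 1" using \<eta> by (simp add: divide_le_eq)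
  qed
  finally have "real (\<nu> - 1) * ((1 + \<eta>) * ?q) \<le> l" by simp
  moreover have "real (\<nu> - 1) * (- ((1 + \<eta>) * ?q)) \<le> real (\<nu> - 1) * ln (1 - ?q)"
    by (intro mult_left_mono ln_q) auto
  ultimately have "exp (- l) \<le> exp (real (\<nu> - 1) * ln (1 - ?q))" by simp
  also have "\<dots> = (1 - ?q) ^ (\<nu> - 1)" using q2 \<eta> by (simp add: exp_of_nat_mult)
  finally show ?thesis .
qed

text \<open>\<phi> is exponential in \<open>iter_log K\<close>, so levels with spacing
  \<open>b\<close> on that scale reduce \<open>scale_tail\<close> by
  \<open>exp (- ((B - 1) * b))\<close> up to constants, and a large fixed \<open>b\<close> beats
  those constants and \<eta>.\<close>

lemma sparse_levels:
  assumes \<eta>: "0 < \<eta>"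
  obtains R :: "nat \<Rightarrow> nat" and b where "strict_mono R" "\<And>k. 0 < R k" "b > 0"
    "\<And>k. real k * b \<le> iter_log K (real (R k))" "\<And>k. iter_log K (real (R k)) \<le> real k * b + 1"
    "\<forall>\<^sub>F k in sequentially. scale_tail (drift K B) (R (Suc k)) \<le> \<eta> * scale_tail (drift K B) (R k)"
proof -
  let ?S = "scale_tail (drift K B)"
  obtain n0 C where C: "C > 0" "drift_start K B \<le> n0"
    "\<And>n. n0 \<le> n \<Longrightarrow> rho (drift K B) n \<le> C * exp (- \<Psi> (real n))"
    "\<And>n. n0 \<le> n \<Longrightarrow> ?S (Suc n) \<le> C * \<phi> (real n)"
    "\<And>n. n0 \<le> n \<Longrightarrow> \<phi> (real n) \<le> C * ?S n" by (rule scale_tail_asymp, rule that)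
  \<comment> \<open>The 2 covers two roundings: \<open>iter_log K (R k)\<close> may exceed
    \<open>k * b\<close> by 1, and passing to the predecessor of \<open>R (Suc k)\<close>, where the
    upper bound for \<open>scale_tail\<close> lives, costs another 1. The factor \<open>C^2\<close>
    comes from the two comparisons with \<phi>.\<close>
  define b where "b = 2 + max 0 (ln (C\<^sup>2 / \<eta>) / (B - 1))"
  have b: "b \<ge> 2" "ln (C\<^sup>2 / \<eta>) \<le> (B - 1) * (b - 2)"
    using B by (auto simp: b_def max_def field_simps)
  have "\<exists>n. iter_log_defined K (real n) \<and> real k * b \<le> iter_log K (real n) \<and> iter_log K (real n) \<le> real k * b + 1" for k
    using b by (intro exists_nat_iter_log K) auto
  then obtain R where R: "\<And>k. iter_log_defined K (real (R k))" "\<And>k. real k * b \<le> iter_log K (real (R k))"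
    "\<And>k. iter_log K (real (R k)) \<le> real k * b + 1" by metis
  have mono: "R k < R (Suc k)" for k
  proof (rule ccontr)
    assume "\<not> ?thesis"
    then have "iter_log K (real (R (Suc k))) \<le> iter_log K (real (R k))" using iter_log_mono[OF R(1)] by simp
    moreover have "real (Suc k) * b = real k * b + b" by (simp add: algebra_simps)
    ultimately show False using R(2)[of "Suc k"] R(3)[of k] b by linarith
  qed
  then have sm: "strict_mono R" by (simp add: strict_mono_Suc_iff)
  show ?thesis
  proof
    show "strict_mono R" by (rule sm)
    show "0 < R k" for k using iter_log_defined_pos[OF R(1), of 0 k] K by simp
    show "b > 0" using b by simp
    show "real k * b \<le> iter_log K (real (R k))" "iter_log K (real (R k)) \<le> real k * b + 1" for k by (rule R)+
    show "\<forall>\<^sub>F k in sequentially. ?S (R (Suc k)) \<le> \<eta> * ?S (R k)"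
      using eventually_ge_at_top[of n0]
    proof eventually_elim
      case (elim k)
      obtain n where n: "R (Suc k) = Suc n" using mono[of k] by (cases "R (Suc k)") auto
      have Rk: "n0 \<le> R k" using elim seq_suble[OF sm, of k] by simp
      have nR: "R k \<le> n" using mono[of k] n by simp
      have d: "iter_log_defined K (real n)" "iter_log K (real (R k)) \<le> iter_log K (real n)"
        using iter_log_mono[OF R(1), of k "real n"] nR by auto
      have "0 \<le> real k * b" using b by simp
      then have "iter_log K (real n + 1) \<le> iter_log K (real n) + 1"
        using d R(2)[of k] by (intro iter_log_add_one_le) auto
      then have Ln: "real (Suc k) * b - 1 \<le> iter_log K (real n)"
        using R(2)[of "Suc k"] unfolding n by (simp add: add.commute)
      have "?S (R (Suc k)) \<le> C * \<phi> (real n)" unfolding n using Rk nR by (intro C) auto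
      also have "\<phi> (real n) \<le> exp ((1 - B) * (real (Suc k) * b - 1))"
        unfolding \<phi>_def using Ln B by (simp add: mult_left_mono_neg)
      also have "\<dots> = exp (- ((B - 1) * (b - 2))) * exp ((1 - B) * (real k * b + 1))"
        by (simp add: algebra_simps flip: exp_add)
      also have "exp ((1 - B) * (real k * b + 1)) \<le> \<phi> (real (R k))"
        unfolding \<phi>_def using R(3)[of k] B by (simp add: mult_left_mono_neg)
      also have "\<phi> (real (R k)) \<le> C * ?S (R k)" using Rk by (intro C)
      also have "exp (- ((B - 1) * (b - 2))) \<le> exp (- ln (C\<^sup>2 / \<eta>))" using b by simp
      also have "\<dots> = \<eta> / C\<^sup>2" using C \<eta> by (simp add: exp_minus)
      finally have "?S (R (Suc k)) \<le> C * (\<eta> / C\<^sup>2 * (C * ?S (R k)))"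
        using C scale_tail_pos[of "R k"] by (simp add: mult_left_mono)
      also have "\<dots> = \<eta> * ?S (R k)" using C by (simp add: power2_eq_square)
      finally show ?case .
    qed
  qed
qed

text \<open>With \<open>l = iter_log (Suc K) (R k)\<close> the success probability is at least
  \<open>exp (- l) = 1 / iter_log K (R k)\<close>, and the latter is at least
  \<open>1 / ((b + 1) * k)\<close>: the series diverges like the harmonic one.\<close>

lemma AE_visits_ge_aux:
  assumes \<eta>: "0 < \<eta>" "\<eta> \<le> 1/10"
  shows "AE \<omega> in M. \<forall>m. \<exists>r\<ge>m. (1 - 10 * \<eta>) * (2 * D r * iter_log (Suc K) (real r)) \<le> \<xi> r \<omega>"
proof -
  obtain R b where R: "strict_mono R" "\<And>k. 0 < R k" "b > 0"
    "\<And>k. real k * b \<le> iter_log K (real (R k))" "\<And>k. iter_log K (real (R k)) \<le> real k * b + 1"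
    "\<forall>\<^sub>F k in sequentially. scale_tail (drift K B) (R (Suc k)) \<le> \<eta> * scale_tail (drift K B) (R k)"
    by (rule sparse_levels[OF \<eta>(1)], rule that)
  define \<nu> where "\<nu> k = max 1 (nat \<lceil>(1 - 10 * \<eta>) * (2 * D (R k) * iter_log (Suc K) (real (R k)))\<rceil>)" for k
  have R_top: "filterlim R at_top sequentially" by (rule filterlim_subseq[OF R(1)])
  have p_ev: "\<forall>\<^sub>F k in sequentially. drift K B (R k) < \<eta>"
    using order_tendstoD(2)[OF filterlim_compose[OF drift_tendsto_0 R_top], of \<eta>] \<eta> by simp
  have D_ev: "\<forall>\<^sub>F k in sequentially. 4 / \<eta> \<le> D (R k)"
    using filterlim_compose[OF D_at_top R_top] by (simp add: filterlim_at_top)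
  have "\<not> summable (\<lambda>k. (1 - escape_prob (drift K B) (R k) (R (Suc k))) ^ (\<nu> k - 1))"
  proof
    assume "summable (\<lambda>k. (1 - escape_prob (drift K B) (R k) (R (Suc k))) ^ (\<nu> k - 1))"
    moreover have "\<forall>\<^sub>F k in sequentially. norm (1 / (b + 1) * (1 / real k)) \<le>
        (1 - escape_prob (drift K B) (R k) (R (Suc k))) ^ (\<nu> k - 1)"
      using p_ev D_ev R(6) eventually_ge_at_top[of "nat \<lceil>1 / b\<rceil>"] eventually_gt_at_top[of 0]
    proof eventually_elim
      case (elim k)
      let ?L = "iter_log K (real (R k))"
      have "1 \<le> real k * b"
      proof -
        have "1 / b \<le> real k" using elim(4) by linarith
        then show ?thesis using R(3) by (simp add: field_simps)
      qed
      then have L: "1 \<le> ?L" using R(4)[of k] by simp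
      have "exp (- iter_log (Suc K) (real (R k))) \<le> (1 - escape_prob (drift K B) (R k) (R (Suc k))) ^ (\<nu> k - 1)"
        using elim L R(1,2) \<eta> by (intro escape_power_ge[of \<eta>]) (auto simp: \<nu>_def strict_mono_Suc_iff)
      moreover have "exp (- iter_log (Suc K) (real (R k))) = 1 / ?L" using L by (simp add: exp_minus divide_inverse)
      moreover have "1 / (b + 1) * (1 / real k) \<le> 1 / ?L"
      proof -
        have "?L \<le> real k * b + 1 * real k" using R(5)[of k] elim(5) by simp
        also have "\<dots> = (b + 1) * real k" by (simp add: algebra_simps)
        finally have "1 / ((b + 1) * real k) \<le> 1 / ?L" using L R(3) elim(5) by (intro divide_left_mono mult_pos_pos) auto
        then show ?thesis by simp
      qed
      ultimately show ?case using R(3) by simp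
    qed
    ultimately have "summable (\<lambda>k. 1 / (b + 1) * (1 / real k))"
      by (rule summable_comparison_test_ev[rotated])
    then have "summable (\<lambda>k. (b + 1) * (1 / (b + 1) * (1 / real k)))" by (rule summable_mult)
    then have "summable (\<lambda>k. 1 / real k)" using R(3) by simp
    then show False using not_summable_harmonic[where 'a=real] by (simp add: inverse_eq_divide)
  qed
  then have "AE \<omega> in M. \<forall>m. \<exists>k\<ge>m. \<nu> k \<le> card {n. X n \<omega> = R k}"
    by (intro AE_infinitely_often_many_visits R) (auto simp: \<nu>_def)
  then show ?thesis
  proof eventually_elim
    case (elim \<omega>)
    show ?case
    proof
      fix m
      obtain k where k: "k \<ge> m" "\<nu> k \<le> card {n. X n \<omega> = R k}" using elim by blast
      have "(1 - 10 * \<eta>) * (2 * D (R k) * iter_log (Suc K) (real (R k))) \<le> real (\<nu> k)"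
        unfolding \<nu>_def by linarith
      also have "\<dots> \<le> \<xi> (R k) \<omega>" using k by simp
      finally show "\<exists>r\<ge>m. (1 - 10 * \<eta>) * (2 * D r * iter_log (Suc K) (real r)) \<le> \<xi> r \<omega>"
        using k(1) seq_suble[OF R(1), of k] by (intro exI[of _ "R k"]) auto
    qed
  qed
qed

lemma eventually_iter_log_pos: "\<forall>\<^sub>F r in sequentially. 0 < iter_log k (real r)"
  using filterlim_at_top_dense[THEN iffD1, OF filterlim_compose[OF iter_log_at_top filterlim_real_sequentially]] by blast

lemma AE_visits_ge:
  "AE \<omega> in M. \<forall>\<epsilon>. 0 < \<epsilon> \<longrightarrow> (\<forall>m. \<exists>r\<ge>m. (1 - \<epsilon>) * (2 * D r * iter_log (Suc K) (real r)) \<le> \<xi> r \<omega>)"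
proof -
  have "AE \<omega> in M. \<forall>i m. \<exists>r\<ge>m. (1 - 10 * (1 / (10 * real (Suc i)))) * (2 * D r * iter_log (Suc K) (real r)) \<le> \<xi> r \<omega>"
    by (subst AE_all_countable, intro allI AE_visits_ge_aux) auto
  then show ?thesis
  proof eventually_elim
    case (elim \<omega>)
    show ?case
    proof (intro allI impI)
      fix \<epsilon> :: real and m assume "0 < \<epsilon>"
      then obtain i where i: "1 / real (Suc i) < \<epsilon>" by (meson nat_approx_posE)
      obtain n0 where n0: "\<And>r. r \<ge> n0 \<Longrightarrow> 0 < iter_log (Suc K) (real r)"
        using eventually_iter_log_pos[of "Suc K"] by (auto simp only: eventually_sequentially)
      obtain r where r: "r \<ge> max m n0"
        "(1 - 10 * (1 / (10 * real (Suc i)))) * (2 * D r * iter_log (Suc K) (real r)) \<le> \<xi> r \<omega>"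
        using elim by blast
      have "(1 - \<epsilon>) * (2 * D r * iter_log (Suc K) (real r))
          \<le> (1 - 10 * (1 / (10 * real (Suc i)))) * (2 * D r * iter_log (Suc K) (real r))"
      proof (rule mult_right_mono)
        have "10 * (1 / (10 * real (Suc i))) = 1 / real (Suc i)" by (simp add: field_simps)
        then show "1 - \<epsilon> \<le> 1 - 10 * (1 / (10 * real (Suc i)))" using i by (simp only:)
        show "0 \<le> 2 * D r * iter_log (Suc K) (real r)"
          using n0[of r] r(1) D_val_pos[of r] by (simp del: iter_log.simps)
      qed
      then show "\<exists>r\<ge>m. (1 - \<epsilon>) * (2 * D r * iter_log (Suc K) (real r)) \<le> \<xi> r \<omega>"
        using r by (intro exI[of _ r]) (auto simp del: iter_log.simps)
    qed
  qed
qed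

lemma AE_local_time_eq: "AE \<omega> in M. \<forall>r. local_time (\<lambda>n. X n \<omega>) r = ereal (\<xi> r \<omega>)"
  using AE_finite_visits
  by eventually_elim (simp add: local_time_def emeasure_count_space_finite ennreal_of_nat_eq_real_of_nat)

lemma AE_upcrossings_eq: "AE \<omega> in M. \<forall>r. upcrossings (\<lambda>n. X n \<omega>) r = ereal (Z r \<omega>)"
  using AE_ups_eventually_Z AE_finite_visits
proof eventually_elim
  case (elim \<omega>)
  have "finite {k. X k \<omega> = r \<and> X (Suc k) \<omega> = Suc r}" for r
    using elim(2) by (rule_tac finite_subset[of _ "{k. X k \<omega> = r}"]) auto
  then show ?case using elim(1)
    by (simp add: upcrossings_def emeasure_count_space_finite ennreal_of_nat_eq_real_of_nat)
qed

lemma AE_limsup_le_1: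
  "AE \<omega> in M. limsup (\<lambda>R. local_time (\<lambda>n. X n \<omega>) R / (2 * D_inf (drift K B) R * ereal (ln (ln (real R))))) \<le> 1"
  using AE_visits_le AE_local_time_eq
proof eventually_elim
  case (elim \<omega>)
  have pos: "\<forall>\<^sub>F r in sequentially. 0 < 2 * D r * ln (ln (real r))"
    using filterlim_at_top_dense[THEN iffD1, OF filterlim_ln_ln, rule_format, of 0]
    by eventually_elim (simp add: D_val_pos)
  show ?case
  proof (rule limsup_ratio_le_1[OF _ pos])
    show "\<forall>\<^sub>F r in sequentially. \<xi> r \<omega> \<le> (1 + \<epsilon>) * (2 * D r * ln (ln (real r)))" if "0 < \<epsilon>" for \<epsilon>
      using elim(1) that by blast
    show "\<forall>\<^sub>F r in sequentially. local_time (\<lambda>n. X n \<omega>) r / (2 * D_inf (drift K B) r * ereal (ln (ln (real r))))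
        = ereal (\<xi> r \<omega> / (2 * D r * ln (ln (real r))))"
      using pos by eventually_elim (use elim(2) in \<open>auto simp: D_inf_eq zero_less_mult_iff\<close>)
  qed
qed

lemma AE_limsup_ge_1:
  "AE \<omega> in M. limsup (\<lambda>R. local_time (\<lambda>n. X n \<omega>) R / (2 * D_inf (drift K B) R * ereal (iter_log (K + 1) (real R)))) \<ge> 1"
  using AE_visits_ge AE_local_time_eq
proof eventually_elim
  case (elim \<omega>)
  have pos: "\<forall>\<^sub>F r in sequentially. 0 < 2 * D r * iter_log (Suc K) (real r)"
    using eventually_iter_log_pos[of "Suc K"]
    by eventually_elim (simp add: D_val_pos del: iter_log.simps)
  show ?case
  proof (rule limsup_ratio_ge_1[OF _ pos])
    show "\<exists>r\<ge>m. (1 - \<epsilon>) * (2 * D r * iter_log (Suc K) (real r)) \<le> \<xi> r \<omega>" if "0 < \<epsilon>" for \<epsilon> m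
      using elim(1) that by blast
    show "\<forall>\<^sub>F r in sequentially. local_time (\<lambda>n. X n \<omega>) r / (2 * D_inf (drift K B) r * ereal (iter_log (K + 1) (real r)))
        = ereal (\<xi> r \<omega> / (2 * D r * iter_log (Suc K) (real r)))"
      using pos by eventually_elim (use elim(2) in \<open>auto simp: D_inf_eq zero_less_mult_iff simp del: iter_log.simps\<close>)
  qed
qed

section \<open>The case \<open>K = 1\<close>: upper and lower bounds meet\<close>

context
  assumes K1: "K = 1"
begin

abbreviation g :: "nat \<Rightarrow> real" where "g r \<equiv> real r / (B - 1)"

text \<open>The intercept of the exact formula is positive, so lower bounds pass from
  \<open>D\<close> to \<open>g\<close> without any loss.\<close>

lemma D_ge_g: "drift_start K B \<le> r \<Longrightarrow> g r \<le> D r"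
  using D_val_exact[OF K1, of r] B by simp

lemma D_over_g: "(\<lambda>r. D r / g r) \<longlonglongrightarrow> 1"
proof -
  define b where "b = (1 / (B - 1) + 1) / 2"
  have "(\<lambda>r. 1 + b * (B - 1) / real r) \<longlonglongrightarrow> 1 + 0"
    by (intro tendsto_intros real_tendsto_divide_at_top[OF tendsto_const] filterlim_real_sequentially)
  moreover have "\<forall>\<^sub>F r in sequentially. 1 + b * (B - 1) / real r = D r / g r"
    using eventually_ge_at_top[of "drift_start K B"] eventually_gt_at_top[of 0]
  proof eventually_elim
    case (elim r)
    have "D r = g r + b" using D_val_exact[OF K1 elim(1)] by (simp add: b_def)
    then show ?case using elim(2) B by (simp add: field_simps)
  qed
  ultimately have "(\<lambda>r. D r / g r) \<longlonglongrightarrow> 1 + 0" by (rule Lim_transform_eventually)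
  then show ?thesis by simp
qed

lemma D_inf_over_g: "(\<lambda>R. D_inf (drift K B) R / ereal (g R)) \<longlonglongrightarrow> 1"
proof -
  have "(\<lambda>r. ereal (D r / g r)) \<longlonglongrightarrow> ereal 1" using D_over_g by simp
  moreover have "\<forall>\<^sub>F r in sequentially. ereal (D r / g r) = D_inf (drift K B) r / ereal (g r)"
    using eventually_gt_at_top[of 0] by eventually_elim (use B in \<open>simp add: D_inf_eq\<close>)
  ultimately show ?thesis unfolding one_ereal_def by (rule Lim_transform_eventually)
qed

text \<open>The factor \<open>c\<close> is 2 for visits and 1 for upcrossings.\<close>

lemma eventually_le_gI:
  assumes f: "\<forall>\<epsilon>>0. \<forall>\<^sub>F r in sequentially. f r \<le> (1 + \<epsilon>) * (c * D r * ln (ln (real r)))"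
    and c: "0 \<le> c" and \<epsilon>: "0 < \<epsilon>"
  shows "\<forall>\<^sub>F r in sequentially. f r \<le> (1 + \<epsilon>) * (c * g r * ln (ln (real r)))"
proof -
  define \<delta> where "\<delta> = min 1 (\<epsilon> / 3)"
  have \<delta>: "0 < \<delta>" "\<delta> \<le> 1" "3 * \<delta> \<le> \<epsilon>" using \<epsilon> by (auto simp: \<delta>_def)
  have "\<forall>\<^sub>F r in sequentially. D r / g r < 1 + \<delta>"
    using order_tendstoD(2)[OF D_over_g, of "1 + \<delta>"] \<delta> by simp
  with f[rule_format, OF \<delta>(1)] eventually_gt_at_top[of 0]
    filterlim_at_top_dense[THEN iffD1, OF filterlim_ln_ln, rule_format, of 0]
  show ?thesis
  proof eventually_elim
    case (elim r)
    let ?l = "ln (ln (real r))"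
    have g0: "0 < g r" using elim B by simp
    have "D r < (1 + \<delta>) * g r" using elim(4) pos_divide_less_eq[OF g0] by blast
    then have "(1 + \<delta>) * (c * D r * ?l) \<le> (1 + \<delta>) * (c * ((1 + \<delta>) * g r) * ?l)"
      using c \<delta> elim(3) by (intro mult_left_mono mult_right_mono) auto
    also have "\<dots> = (1 + \<delta>)\<^sup>2 * (c * g r * ?l)" by (simp add: power2_eq_square)
    also have "\<dots> \<le> (1 + \<epsilon>) * (c * g r * ?l)"
    proof (intro mult_right_mono)
      have "\<delta> * \<delta> \<le> 1 * \<delta>" using \<delta> by (intro mult_right_mono) auto
      moreover have "(1 + \<delta>)\<^sup>2 = 1 + 2 * \<delta> + \<delta> * \<delta>" by (simp add: power2_eq_square algebra_simps)
      ultimately show "(1 + \<delta>)\<^sup>2 \<le> 1 + \<epsilon>" using \<delta>(3) by linarith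
      show "0 \<le> c * g r * ?l"
        by (intro mult_nonneg_nonneg c less_imp_le[OF g0] less_imp_le[OF elim(3)])
    qed
    finally show ?case using elim(1) by simp
  qed
qed

lemma AE_visits_ge_g:
  "AE \<omega> in M. \<forall>\<epsilon> m. 0 < \<epsilon> \<longrightarrow> \<epsilon> < 1 \<longrightarrow> (\<exists>r\<ge>m. (1 - \<epsilon>) * (2 * g r * ln (ln (real r))) \<le> \<xi> r \<omega>)"
  using AE_visits_ge
proof eventually_elim
  case (elim \<omega>)
  show ?case
  proof (intro allI impI)
    fix \<epsilon> :: real and m assume \<epsilon>: "0 < \<epsilon>" "\<epsilon> < 1"
    obtain n0 where n0: "\<And>r. r \<ge> n0 \<Longrightarrow> 0 < ln (ln (real r))"
      using filterlim_at_top_dense[THEN iffD1, OF filterlim_ln_ln, rule_format, of 0]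
      by (auto simp only: eventually_sequentially)
    obtain r where r: "r \<ge> max m (max n0 (drift_start K B))"
      "(1 - \<epsilon>) * (2 * D r * iter_log (Suc K) (real r)) \<le> \<xi> r \<omega>" using elim \<epsilon>(1) by blast
    have "(1 - \<epsilon>) * (2 * g r * ln (ln (real r))) \<le> (1 - \<epsilon>) * (2 * D r * ln (ln (real r)))"
      using \<epsilon> D_ge_g[of r] r(1) n0[of r] by (intro mult_left_mono mult_right_mono) auto
    then show "\<exists>r\<ge>m. (1 - \<epsilon>) * (2 * g r * ln (ln (real r))) \<le> \<xi> r \<omega>"
      using r by (intro exI[of _ r]) (auto simp: K1)
  qed
qed

text \<open>Many visits to \<open>Suc r\<close> force many upcrossings from \<open>r\<close> or from
  \<open>Suc r\<close>, since the larger of two summands is at least half their sum. The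
  normalisation increases with the level, so either outcome serves.\<close>

lemma AE_Z_ge_g:
  "AE \<omega> in M. \<forall>\<epsilon> m. 0 < \<epsilon> \<longrightarrow> \<epsilon> < 1 \<longrightarrow> (\<exists>r\<ge>m. (1 - \<epsilon>) * (g r * ln (ln (real r))) \<le> Z r \<omega>)"
  using AE_visits_ge_g AE_finite_visits
proof eventually_elim
  case (elim \<omega>)
  show ?case
  proof (intro allI impI)
    fix \<epsilon> :: real and m assume \<epsilon>: "0 < \<epsilon>" "\<epsilon> < 1"
    obtain n0 where n0: "\<And>r. r \<ge> n0 \<Longrightarrow> 0 < ln (ln (real r))"
      using filterlim_at_top_dense[THEN iffD1, OF filterlim_ln_ln, rule_format, of 0]
      by (auto simp only: eventually_sequentially)
    \<comment> \<open>The successors and the 3 keep the predecessor of \<open>r'\<close> above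
      \<open>m\<close> and \<open>n0\<close> and at least 2, where \<open>ln (ln x)\<close> is
      monotone.\<close>
    obtain r' where r': "r' \<ge> max (Suc m) (max (Suc n0) 3)"
      "(1 - \<epsilon>) * (2 * g r' * ln (ln (real r'))) \<le> \<xi> r' \<omega>" using elim(1) \<epsilon> by blast
    obtain r where r: "r' = Suc r" using r'(1) by (cases r') auto
    let ?t = "\<lambda>r. (1 - \<epsilon>) * (g r * ln (ln (real r)))"
    have "2 * ?t (Suc r) = (1 - \<epsilon>) * (2 * g (Suc r) * ln (ln (real (Suc r))))" by simp
    also have "\<dots> \<le> \<xi> (Suc r) \<omega>" using r'(2) unfolding r .
    also have "\<dots> \<le> Z (Suc r) \<omega> + Z r \<omega>" using elim(2) by blast
    finally have "2 * ?t (Suc r) \<le> Z (Suc r) \<omega> + Z r \<omega>" .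
    moreover have "a \<le> x \<or> a \<le> y" if "2 * a \<le> x + y" for a x y :: real using that by auto
    ultimately have "?t (Suc r) \<le> Z (Suc r) \<omega> \<or> ?t (Suc r) \<le> Z r \<omega>" by blast
    moreover have "?t r \<le> ?t (Suc r)"
    proof (intro mult_left_mono mult_mono)
      show "g r \<le> g (Suc r)" using B by (simp add: divide_right_mono)
      show "ln (ln (real r)) \<le> ln (ln (real (Suc r)))" using r' r by (intro ln_ln_mono) auto
    qed (use \<epsilon> B n0[of r] r' r in auto)
    ultimately have "?t (Suc r) \<le> Z (Suc r) \<omega> \<or> ?t r \<le> Z r \<omega>" by linarith
    then show "\<exists>r\<ge>m. ?t r \<le> Z r \<omega>" using r' r by (metis Suc_le_mono le_SucI max.bounded_iff)
  qed
qed

lemma AE_limsup_eq_1: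
  "AE \<omega> in M.
     limsup (\<lambda>R. ereal (B - 1) * local_time (\<lambda>n. X n \<omega>) R / ereal (2 * real R * ln (ln (real R)))) = 1 \<and>
     limsup (\<lambda>R. ereal (B - 1) * upcrossings (\<lambda>n. X n \<omega>) R / ereal (real R * ln (ln (real R)))) = 1"
  using AE_visits_le AE_Z_le AE_visits_ge_g AE_Z_ge_g AE_local_time_eq AE_upcrossings_eq
proof eventually_elim
  case (elim \<omega>)
  let ?l = "\<lambda>r. ln (ln (real r))"
  have pos: "\<forall>\<^sub>F r in sequentially. 0 < real r * ?l r"
    using filterlim_at_top_dense[THEN iffD1, OF filterlim_ln_ln, rule_format, of 0] eventually_gt_at_top[of 0]
    by eventually_elim simp
  then have pos1: "\<forall>\<^sub>F r in sequentially. 0 < 2 * g r * ?l r" and pos2: "\<forall>\<^sub>F r in sequentially. 0 < g r * ?l r"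
    using B by (auto elim!: eventually_mono)
  have eq1: "\<forall>\<^sub>F r in sequentially. ereal (B - 1) * local_time (\<lambda>n. X n \<omega>) r / ereal (2 * real r * ?l r)
      = ereal (\<xi> r \<omega> / (2 * g r * ?l r))"
    using pos by eventually_elim (use elim(5) B in \<open>auto simp: zero_less_mult_iff\<close>)
  have eq2: "\<forall>\<^sub>F r in sequentially. ereal (B - 1) * upcrossings (\<lambda>n. X n \<omega>) r / ereal (real r * ?l r)
      = ereal (Z r \<omega> / (g r * ?l r))"
    using pos by eventually_elim (use elim(6) B in \<open>auto simp: zero_less_mult_iff\<close>)
  have le1: "\<forall>\<^sub>F r in sequentially. \<xi> r \<omega> \<le> (1 + \<epsilon>) * (2 * g r * ?l r)" if "0 < \<epsilon>" for \<epsilon>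
    using elim(1) that by (intro eventually_le_gI) auto
  have le2: "\<forall>\<^sub>F r in sequentially. Z r \<omega> \<le> (1 + \<epsilon>) * (g r * ?l r)" if "0 < \<epsilon>" for \<epsilon>
    using eventually_le_gI[of "\<lambda>r. Z r \<omega>" 1 \<epsilon>] elim(2) that by simp
  show ?case
  proof (intro conjI antisym)
    show "limsup (\<lambda>r. ereal (B - 1) * local_time (\<lambda>n. X n \<omega>) r / ereal (2 * real r * ?l r)) \<le> 1"
      by (rule limsup_ratio_le_1[OF le1 pos1 eq1])
    show "1 \<le> limsup (\<lambda>r. ereal (B - 1) * local_time (\<lambda>n. X n \<omega>) r / ereal (2 * real r * ?l r))"
      by (rule limsup_ratio_ge_1[OF _ pos1 eq1]) (use elim(3) in blast)
    show "limsup (\<lambda>r. ereal (B - 1) * upcrossings (\<lambda>n. X n \<omega>) r / ereal (real r * ?l r)) \<le> 1"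
      by (rule limsup_ratio_le_1[OF le2 pos2 eq2])
    show "1 \<le> limsup (\<lambda>r. ereal (B - 1) * upcrossings (\<lambda>n. X n \<omega>) r / ereal (real r * ?l r))"
      by (rule limsup_ratio_ge_1[OF _ pos2 eq2]) (use elim(4) in blast)
  qed
qed

end

end

theorem theorem3p3:
  fixes K :: nat and B :: real
    and M :: "'a measure" and X :: "nat \<Rightarrow> 'a \<Rightarrow> nat"
  assumes "K \<ge> 1" and "B > 1"
    and "nearest_neighbour_walk M X (drift K B)"
  shows "(AE \<omega> in M. limsup (\<lambda>R. local_time (\<lambda>n. X n \<omega>) R /
              (2 * D_inf (drift K B) R * ereal (ln (ln (real R))))) \<le> 1) \<and>
         (AE \<omega> in M. limsup (\<lambda>R. local_time (\<lambda>n. X n \<omega>) R /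
              (2 * D_inf (drift K B) R * ereal (iter_log (K + 1) (real R)))) \<ge> 1) \<and>
         (K = 1 \<longrightarrow>
            (\<lambda>R. D_inf (drift K B) R / ereal (real R / (B - 1))) \<longlonglongrightarrow> 1 \<and>
            (AE \<omega> in M.
               limsup (\<lambda>R. ereal (B - 1) * local_time (\<lambda>n. X n \<omega>) R /
                 ereal (2 * real R * ln (ln (real R)))) = 1 \<and>
               limsup (\<lambda>R. ereal (B - 1) * upcrossings (\<lambda>n. X n \<omega>) R /
                 ereal (real R * ln (ln (real R)))) = 1))"
proof -
  interpret iterated_log_drift K B using assms by unfold_locales
  interpret nearest_neighbour_walk M X "drift K B" by (rule assms)
  interpret iterated_log_walk K B M X by unfold_locales
  show ?thesis using AE_limsup_le_1 AE_limsup_ge_1 D_inf_over_g AE_limsup_eq_1 by blast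
qed

end
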